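(* For all integers $s\geq 3$ and $m\geq 1$, the moduli space $X_s^m=\mathcal{MCG}_{1,s}^m$ of $m$-colored one-loop graphs with $s$ legs is simply connected.
   Context: Graphs are finite non-empty multigraphs (self-loops and multiple edges allowed) with a set $E(G)$ of internal edges and $s$ external legs labeled bijectively by $1,\ldots,s$, each leg attached to a vertex. The valency of a vertex is the number of half-edges at it (legs count once, self-loops twice). A graph is admissible if it is connected, stays connected upon removal of any single internal edge, and all vertices have valency $\geq 3$. Its rank is its first Betti number. Hence an admissible graph of rank one with $s$ legs is a cycle with $k$ vertices and $k$ internal edges, $1\leq k\leq s$ ($k=1$: one vertex with a self-loop; $k=2$: two vertices joined by a double edge), each vertex carrying at least one leg. An $m$-coloring is any map $c:E(G)\to\{1,\ldots,m\}$. A metric $\lambda:E(G)\to\mathbb{R}_{\geq 0}$ is regular if $Z=\{e:\lambda(e)=0\}$ is (the edge set of) a forest; in rank one this means $\lambda\not\equiv 0$. $G/Z$ denotes $G$ with the edges of $Z$ collapsed. The points of $X_s^m$ are the triples $(G,\lambda,c)$ with $G$ admissible of rank one with $s$ legs, $\lambda$ a regular metric, $c$ an $m$-coloring, modulo the relation: $(G,\lambda,c)\sim(G',\lambda',c')$ iff, with $Z,Z'$ the zero sets of $\lambda,\lambda'$, there are a graph isomorphism $\varphi:G/Z\to G'/Z'$ preserving the leg labels and a constant $a>0$ with $\lambda'\circ\varphi=a\lambda$ and $c'\circ\varphi=c$ on $E(G)\setminus Z$. Topology: for each isomorphism class of pairs $(G,c)$ the regular metrics of total length $1$ form a closed simplex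 of dimension $|E(G)|-1$; $X_s^m$ carries the quotient topology from the disjoint union of these simplices. *)

theory Defs
  imports "HOL-Analysis.Analysis"
begin

section \<open>Finite multigraphs with labelled legs\<close>

text \<open>
  The ends of an internal edge form a multiset of size two, a self-loop at \<open>v\<close> having ends
  \<open>{#v, v#}\<close>. The legs are \<open>1, \<dots>, nlegs G\<close>, and leg \<open>i\<close> is attached to the vertex \<open>leg G i\<close>.
\<close>

record ('v, 'e) legged_graph =
  verts :: "'v set"
  edges :: "'e set"
  ends  :: "'e \<Rightarrow> 'v multiset"
  nlegs :: nat
  leg   :: "nat \<Rightarrow> 'v"

definition multigraph :: "('v, 'e) legged_graph \<Rightarrow> bool" where
  "multigraph G \<longleftrightarrow>
     finite (verts G) \<and> verts G \<noteq> {} \<and> finite (edges G) \<and>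
     (\<forall>e\<in>edges G. size (ends G e) = 2 \<and> set_mset (ends G e) \<subseteq> verts G) \<and>
     (\<forall>i\<in>{1..nlegs G}. leg G i \<in> verts G)"

definition valency :: "('v, 'e) legged_graph \<Rightarrow> 'v \<Rightarrow> nat" where
  "valency G v = (\<Sum>e\<in>edges G. count (ends G e) v) + card {i \<in> {1..nlegs G}. leg G i = v}"

definition adjacency :: "('v, 'e) legged_graph \<Rightarrow> 'v rel" where
  "adjacency G = {(u, v). \<exists>e\<in>edges G. ends G e = {#u, v#}}"

definition component :: "('v, 'e) legged_graph \<Rightarrow> 'v \<Rightarrow> 'v set" where
  "component G v = (adjacency G)\<^sup>* `` {v}"

definition connected_graph :: "('v, 'e) legged_graph \<Rightarrow> bool" where
  "connected_graph G \<longleftrightarrow> (\<forall>u\<in>verts G. \<forall>v\<in>verts G. (u, v) \<in> (adjacency G)\<^sup>*)"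

definition admissible :: "('v, 'e) legged_graph \<Rightarrow> bool" where
  "admissible G \<longleftrightarrow>
     connected_graph G \<and>
     (\<forall>e\<in>edges G. connected_graph (G\<lparr>edges := edges G - {e}\<rparr>)) \<and>
     (\<forall>v\<in>verts G. 3 \<le> valency G v)"

text \<open>The first Betti number: edges minus vertices plus connected components.\<close>

definition graph_rank :: "('v, 'e) legged_graph \<Rightarrow> int" where
  "graph_rank G =
     int (card (edges G)) - int (card (verts G)) + int (card (component G ` verts G))"

text \<open>A forest is a set of edges spanning a subgraph without cycles, i.e. of rank zero.\<close>

definition forest :: "('v, 'e) legged_graph \<Rightarrow> 'e set \<Rightarrow> bool" where
  "forest G Z \<longleftrightarrow> Z \<subseteq> edges G \<and> graph_rank (G\<lparr>edges := Z\<rparr>) = 0"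

text \<open>
  \<open>G/Z\<close>: its vertices are the connected components of the subgraph with all vertices of \<open>G\<close> and
  edge set \<open>Z\<close>.
\<close>

definition contract :: "('v, 'e) legged_graph \<Rightarrow> 'e set \<Rightarrow> ('v set, 'e) legged_graph" where
  "contract G Z =
     (let q = component (G\<lparr>edges := Z\<rparr>) in
      \<lparr>verts = q ` verts G,
       edges = edges G - Z,
       ends = (\<lambda>e. image_mset q (ends G e)),
       nlegs = nlegs G,
       leg = (\<lambda>i. q (leg G i))\<rparr>)"

text \<open>
  Isomorphisms preserving the leg labels, given by their action on vertices and on internal edges.
  Interchanging the two halves of a self-loop is not recorded; it affects neither metrics nor
  colorings.
\<close>

definition graph_iso ::
    "('v, 'e) legged_graph \<Rightarrow> ('w, 'f) legged_graph \<Rightarrow> ('v \<Rightarrow> 'w) \<Rightarrow> ('e \<Rightarrow> 'f) \<Rightarrow> bool" where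
  "graph_iso G H \<phi> \<psi> \<longleftrightarrow>
     bij_betw \<phi> (verts G) (verts H) \<and> bij_betw \<psi> (edges G) (edges H) \<and>
     (\<forall>e\<in>edges G. ends H (\<psi> e) = image_mset \<phi> (ends G e)) \<and>
     nlegs H = nlegs G \<and> (\<forall>i\<in>{1..nlegs G}. leg H i = \<phi> (leg G i))"


section \<open>Metrics and colorings\<close>

definition zero_edges :: "('v, 'e) legged_graph \<Rightarrow> ('e \<Rightarrow> real) \<Rightarrow> 'e set" where
  "zero_edges G l = {e \<in> edges G. l e = 0}"

definition regular_metrics :: "('v, 'e) legged_graph \<Rightarrow> ('e \<Rightarrow> real) set" where
  "regular_metrics G = {l \<in> edges G \<rightarrow>\<^sub>E {0..}. forest G (zero_edges G l)}"

definition colorings :: "nat \<Rightarrow> ('v, 'e) legged_graph \<Rightarrow> ('e \<Rightarrow> nat) set" where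
  "colorings m G = edges G \<rightarrow>\<^sub>E {1..m}"

definition length_simplex :: "('v, 'e) legged_graph \<Rightarrow> ('e \<Rightarrow> real) topology" where
  "length_simplex G =
     subtopology (product_topology (\<lambda>_. euclideanreal) (edges G))
       {l \<in> regular_metrics G. (\<Sum>e\<in>edges G. l e) = 1}"


section \<open>The moduli space of colored one-loop graphs\<close>

text \<open>
  Every finite graph is isomorphic to one whose vertices and edges are natural numbers, so graphs
  of that type suffice and keep the moduli space a set.
\<close>

type_synonym lgraph = "(nat, nat) legged_graph"
type_synonym colored_graph = "lgraph \<times> (nat \<Rightarrow> nat)"
type_synonym metric_graph = "lgraph \<times> (nat \<Rightarrow> real) \<times> (nat \<Rightarrow> nat)"

definition one_loop_graphs :: "nat \<Rightarrow> lgraph set" where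
  "one_loop_graphs s = {G. multigraph G \<and> admissible G \<and> graph_rank G = 1 \<and> nlegs G = s}"

definition colored_graphs :: "nat \<Rightarrow> nat \<Rightarrow> colored_graph set" where
  "colored_graphs s m = {(G, c). G \<in> one_loop_graphs s \<and> c \<in> colorings m G}"

definition metric_graphs :: "nat \<Rightarrow> nat \<Rightarrow> metric_graph set" where
  "metric_graphs s m =
     {(G, l, c). G \<in> one_loop_graphs s \<and> l \<in> regular_metrics G \<and> c \<in> colorings m G}"

definition metric_graph_rel :: "nat \<Rightarrow> nat \<Rightarrow> metric_graph rel" where
  "metric_graph_rel s m =
     {((G, l, c), (G', l', c')).
        (G, l, c) \<in> metric_graphs s m \<and> (G', l', c') \<in> metric_graphs s m \<and>
        (\<exists>\<phi> \<psi> a. a > 0 \<and>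
           graph_iso (contract G (zero_edges G l)) (contract G' (zero_edges G' l')) \<phi> \<psi> \<and>
           (\<forall>e\<in>edges G - zero_edges G l. l' (\<psi> e) = a * l e \<and> c' (\<psi> e) = c e))}"

definition colored_graph_rel :: "nat \<Rightarrow> nat \<Rightarrow> colored_graph rel" where
  "colored_graph_rel s m =
     {((G, c), (G', c')).
        (G, c) \<in> colored_graphs s m \<and> (G', c') \<in> colored_graphs s m \<and>
        (\<exists>\<phi> \<psi>. graph_iso G G' \<phi> \<psi> \<and> (\<forall>e\<in>edges G. c' (\<psi> e) = c e))}"

text \<open>One chosen representative for each isomorphism class of pairs \<open>(G, c)\<close>.\<close>

definition cells :: "nat \<Rightarrow> nat \<Rightarrow> colored_graph set" where
  "cells s m = (\<lambda>C. SOME x. x \<in> C) ` (colored_graphs s m // colored_graph_rel s m)"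

definition cell_sum :: "nat \<Rightarrow> nat \<Rightarrow> (colored_graph \<times> (nat \<Rightarrow> real)) topology" where
  "cell_sum s m = sum_topology (\<lambda>(G, c). length_simplex G) (cells s m)"

definition cell_map ::
    "nat \<Rightarrow> nat \<Rightarrow> colored_graph \<times> (nat \<Rightarrow> real) \<Rightarrow> metric_graph set" where
  "cell_map s m = (\<lambda>((G, c), l). metric_graph_rel s m `` {(G, l, c)})"

text \<open>
  The finest topology on the set of equivalence classes making \<open>cell_map s m\<close> continuous; it is
  a quotient map by \<open>quotient_map_cell_map\<close> below.
\<close>

definition MCG1 :: "nat \<Rightarrow> nat \<Rightarrow> metric_graph set topology" where
  "MCG1 s m = topology (\<lambda>U. U \<subseteq> metric_graphs s m // metric_graph_rel s m \<and>
     openin (cell_sum s m) {x \<in> topspace (cell_sum s m). cell_map s m x \<in> U})"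

text \<open>
  Nonempty, path-connected, and every loop is null-homotopic relative to its end points. The
  library notion \<^const>\<open>simply_connected\<close> is only available for subsets of a topological type.
\<close>

definition simply_connected_space :: "'a topology \<Rightarrow> bool" where
  "simply_connected_space X \<longleftrightarrow>
     topspace X \<noteq> {} \<and> path_connected_space X \<and>
     (\<forall>p. pathin X p \<and> p 1 = p 0 \<longrightarrow>
        homotopic_with (\<lambda>r. r 0 = p 0 \<and> r 1 = p 0) (top_of_set {0..1}) X p (\<lambda>_. p 0))"


section \<open>Consistency of the definitions\<close>

lemma simply_connected_space_top_of_set:
  fixes S :: "'a::real_normed_vector set"
  shows "simply_connected_space (top_of_set S) \<longleftrightarrow> S \<noteq> {} \<and> simply_connected S"
proof -
  have lin: "linepath a a = (\<lambda>_. a)" for a :: 'a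
    by (auto simp: linepath_def algebra_simps)
  show ?thesis
    by (auto simp: simply_connected_space_def simply_connected_eq_contractible_path
        lin
        homotopic_paths_def pathin_def path_def path_image_def pathstart_def pathfinish_def
        image_subset_iff continuous_map_in_subtopology Pi_iff)
qed

lemma openin_MCG1:
  "openin (MCG1 s m) U \<longleftrightarrow> U \<subseteq> metric_graphs s m // metric_graph_rel s m \<and>
     openin (cell_sum s m) {x \<in> topspace (cell_sum s m). cell_map s m x \<in> U}"
proof -
  let ?X = "cell_sum s m"
  let ?P = "\<lambda>U. {x \<in> topspace ?X. cell_map s m x \<in> U}"
  have "istopology (\<lambda>U. U \<subseteq> metric_graphs s m // metric_graph_rel s m \<and> openin ?X (?P U))"
    unfolding istopology_def
  proof (intro conjI allI impI; (elim conjE)?)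
    fix S T assume "openin ?X (?P S)" "openin ?X (?P T)"
    then have "openin ?X (?P S \<inter> ?P T)" by blast
    moreover have "?P S \<inter> ?P T = ?P (S \<inter> T)" by blast
    ultimately show "openin ?X (?P (S \<inter> T))" by simp
  next
    fix K assume "\<forall>S\<in>K. S \<subseteq> metric_graphs s m // metric_graph_rel s m \<and> openin ?X (?P S)"
    then have "openin ?X (\<Union>(?P ` K))" by blast
    moreover have "\<Union>(?P ` K) = ?P (\<Union>K)" by blast
    ultimately show "openin ?X (?P (\<Union>K))" by simp
  qed blast+
  then show ?thesis
    by (simp add: MCG1_def topology_inverse')
qed

lemma graph_iso_refl: "graph_iso G G (\<lambda>v. v) (\<lambda>e. e)"
  by (auto simp: graph_iso_def bij_betw_def)

lemma graph_iso_trans: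
  assumes "graph_iso G H f g" "graph_iso H K f' g'"
  shows "graph_iso G K (f' \<circ> f) (g' \<circ> g)"
proof -
  have "g e \<in> edges H" if "e \<in> edges G" for e
    using assms(1) that by (auto simp: graph_iso_def bij_betw_def)
  then show ?thesis
    using assms by (auto simp: graph_iso_def multiset.map_comp intro: bij_betw_trans)
qed

lemma graph_iso_sym:
  assumes iso: "graph_iso G H f g"
    and wf: "\<And>e. e \<in> edges G \<Longrightarrow> set_mset (ends G e) \<subseteq> verts G"
      "\<And>i. i \<in> {1..nlegs G} \<Longrightarrow> leg G i \<in> verts G"
  shows "graph_iso H G (inv_into (verts G) f) (inv_into (edges G) g)"
proof -
  let ?f = "inv_into (verts G) f" and ?g = "inv_into (edges G) g"
  have f: "bij_betw f (verts G) (verts H)" and g: "bij_betw g (edges G) (edges H)"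
    using iso by (auto simp: graph_iso_def)
  have ff: "?f (f v) = v" if "v \<in> verts G" for v
    using f that by (simp add: bij_betw_def)
  have "ends G (?g e) = image_mset ?f (ends H e)" if "e \<in> edges H" for e
  proof -
    have e: "?g e \<in> edges G" "g (?g e) = e"
      using g that by (auto simp: bij_betw_def inv_into_into f_inv_into_f)
    then have "ends H e = image_mset f (ends G (?g e))"
      using iso by (metis graph_iso_def)
    then have "image_mset ?f (ends H e) = image_mset (\<lambda>v. ?f (f v)) (ends G (?g e))"
      by (simp add: multiset.map_comp o_def)
    also have "\<dots> = image_mset (\<lambda>v. v) (ends G (?g e))"
      using wf(1)[OF e(1)] ff by (intro image_mset_cong) auto
    finally show ?thesis by simp
  qed
  then show ?thesis
    using iso wf(2) ff f g by (auto simp: graph_iso_def bij_betw_inv_into)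
qed

lemma contract_sel [simp]:
  "verts (contract G Z) = component (G\<lparr>edges := Z\<rparr>) ` verts G"
  "edges (contract G Z) = edges G - Z"
  "ends (contract G Z) e = image_mset (component (G\<lparr>edges := Z\<rparr>)) (ends G e)"
  "nlegs (contract G Z) = nlegs G"
  "leg (contract G Z) i = component (G\<lparr>edges := Z\<rparr>) (leg G i)"
  by (simp_all add: contract_def Let_def)

lemma equiv_metric_graph_rel: "equiv (metric_graphs s m) (metric_graph_rel s m)"
proof (rule equivI)
  show "metric_graph_rel s m \<subseteq> metric_graphs s m \<times> metric_graphs s m"
    by (auto simp: metric_graph_rel_def)
  show "refl_on (metric_graphs s m) (metric_graph_rel s m)"
  proof (rule refl_onI)
    fix x assume "x \<in> metric_graphs s m"
    then show "(x, x) \<in> metric_graph_rel s m"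
      unfolding metric_graph_rel_def
      by (cases x) (auto intro!: exI[of _ "1::real"] exI[of _ "\<lambda>v. v"] graph_iso_refl)
  qed
  show "sym (metric_graph_rel s m)"
  proof (rule symI)
    fix x y assume xy: "(x, y) \<in> metric_graph_rel s m"
    obtain G l c G' l' c' where x: "x = (G, l, c)" and y: "y = (G', l', c')"
      by (metis prod.exhaust)
    let ?C = "contract G (zero_edges G l)" and ?C' = "contract G' (zero_edges G' l')"
    obtain f g a where a: "a > 0" and iso: "graph_iso ?C ?C' f g"
      and lc: "\<And>e. e \<in> edges ?C \<Longrightarrow> l' (g e) = a * l e \<and> c' (g e) = c e"
      and mem: "x \<in> metric_graphs s m" "y \<in> metric_graphs s m"
      using xy unfolding x y metric_graph_rel_def by auto
    have "multigraph G"
      using mem by (simp add: x metric_graphs_def one_loop_graphs_def)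
    then have iso': "graph_iso ?C' ?C (inv_into (verts ?C) f) (inv_into (edges ?C) g)"
      by (intro graph_iso_sym[OF iso]) (auto simp: multigraph_def)
    have g: "bij_betw g (edges ?C) (edges ?C')"
      using iso by (simp add: graph_iso_def)
    have "l (inv_into (edges ?C) g e) = inverse a * l' e \<and> c (inv_into (edges ?C) g e) = c' e"
      if "e \<in> edges ?C'" for e
    proof -
      have "inv_into (edges ?C) g e \<in> edges ?C" "g (inv_into (edges ?C) g e) = e"
        using g that unfolding bij_betw_def by (metis inv_into_into, metis f_inv_into_f)
      then show ?thesis
        using lc[of "inv_into (edges ?C) g e"] a by (simp add: field_simps)
    qed
    moreover have "inverse a > 0"
      using a by simp
    ultimately have "\<exists>\<phi> \<psi> b. b > 0 \<and> graph_iso ?C' ?C \<phi> \<psi> \<and>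
        (\<forall>e\<in>edges ?C'. l (\<psi> e) = b * l' e \<and> c (\<psi> e) = c' e)"
      using iso' by blast
    then show "(y, x) \<in> metric_graph_rel s m"
      using mem unfolding x y metric_graph_rel_def by simp
  qed
  show "trans (metric_graph_rel s m)"
  proof (rule transI)
    fix x y z assume xy: "(x, y) \<in> metric_graph_rel s m" and yz: "(y, z) \<in> metric_graph_rel s m"
    obtain G l c G' l' c' G'' l'' c''
      where x: "x = (G, l, c)" and y: "y = (G', l', c')" and z: "z = (G'', l'', c'')"
      by (metis prod.exhaust)
    let ?C = "contract G (zero_edges G l)" and ?C' = "contract G' (zero_edges G' l')"
      and ?C'' = "contract G'' (zero_edges G'' l'')"
    obtain f g a where a: "a > 0" and iso: "graph_iso ?C ?C' f g"
      and lc: "\<And>e. e \<in> edges ?C \<Longrightarrow> l' (g e) = a * l e \<and> c' (g e) = c e"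
      and mem: "x \<in> metric_graphs s m" "y \<in> metric_graphs s m"
      using xy unfolding x y metric_graph_rel_def by auto
    obtain f' g' b where b: "b > 0" and iso': "graph_iso ?C' ?C'' f' g'"
      and lc': "\<And>e. e \<in> edges ?C' \<Longrightarrow> l'' (g' e) = b * l' e \<and> c'' (g' e) = c' e"
      and mem': "z \<in> metric_graphs s m"
      using yz unfolding y z metric_graph_rel_def by auto
    have "g e \<in> edges ?C'" if "e \<in> edges ?C" for e
      using iso that by (auto simp: graph_iso_def bij_betw_def)
    then have "l'' ((g' \<circ> g) e) = (b * a) * l e \<and> c'' ((g' \<circ> g) e) = c e" if "e \<in> edges ?C" for e
      using lc lc' that by auto
    moreover have "b * a > 0"
      using a b by simp
    ultimately have "\<exists>\<phi> \<psi> a. a > 0 \<and> graph_iso ?C ?C'' \<phi> \<psi> \<and>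
        (\<forall>e\<in>edges ?C. l'' (\<psi> e) = a * l e \<and> c'' (\<psi> e) = c e)"
      using graph_iso_trans[OF iso iso'] by blast
    then show "(x, z) \<in> metric_graph_rel s m"
      using mem mem' unfolding x z metric_graph_rel_def by simp
  qed
qed

lemma equiv_colored_graph_rel: "equiv (colored_graphs s m) (colored_graph_rel s m)"
proof (rule equivI)
  show "colored_graph_rel s m \<subseteq> colored_graphs s m \<times> colored_graphs s m"
    by (auto simp: colored_graph_rel_def)
  show "refl_on (colored_graphs s m) (colored_graph_rel s m)"
  proof (rule refl_onI)
    fix x assume "x \<in> colored_graphs s m"
    then show "(x, x) \<in> colored_graph_rel s m"
      unfolding colored_graph_rel_def
      by (cases x) (auto intro!: exI[of _ "\<lambda>v. v"] graph_iso_refl)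
  qed
  show "sym (colored_graph_rel s m)"
  proof (rule symI)
    fix x y assume xy: "(x, y) \<in> colored_graph_rel s m"
    obtain G c G' c' where x: "x = (G, c)" and y: "y = (G', c')"
      by (metis prod.exhaust)
    obtain f g where iso: "graph_iso G G' f g"
      and c: "\<And>e. e \<in> edges G \<Longrightarrow> c' (g e) = c e"
      and mem: "x \<in> colored_graphs s m" "y \<in> colored_graphs s m"
      using xy unfolding x y colored_graph_rel_def by auto
    have "multigraph G"
      using mem by (simp add: x colored_graphs_def one_loop_graphs_def)
    then have iso': "graph_iso G' G (inv_into (verts G) f) (inv_into (edges G) g)"
      by (intro graph_iso_sym[OF iso]) (auto simp: multigraph_def)
    have g: "bij_betw g (edges G) (edges G')"
      using iso by (simp add: graph_iso_def)
    have "c (inv_into (edges G) g e) = c' e" if "e \<in> edges G'" for e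
    proof -
      have "inv_into (edges G) g e \<in> edges G" "g (inv_into (edges G) g e) = e"
        using g that unfolding bij_betw_def by (metis inv_into_into, metis f_inv_into_f)
      then show ?thesis
        using c[of "inv_into (edges G) g e"] by simp
    qed
    then show "(y, x) \<in> colored_graph_rel s m"
      using iso' mem unfolding x y colored_graph_rel_def by auto
  qed
  show "trans (colored_graph_rel s m)"
  proof (rule transI)
    fix x y z assume xy: "(x, y) \<in> colored_graph_rel s m" and yz: "(y, z) \<in> colored_graph_rel s m"
    obtain G c G' c' G'' c'' where x: "x = (G, c)" and y: "y = (G', c')" and z: "z = (G'', c'')"
      by (metis prod.exhaust)
    obtain f g where iso: "graph_iso G G' f g"
      and c: "\<And>e. e \<in> edges G \<Longrightarrow> c' (g e) = c e"
      and mem: "x \<in> colored_graphs s m"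
      using xy unfolding x y colored_graph_rel_def by auto
    obtain f' g' where iso': "graph_iso G' G'' f' g'"
      and c': "\<And>e. e \<in> edges G' \<Longrightarrow> c'' (g' e) = c' e"
      and mem': "z \<in> colored_graphs s m"
      using yz unfolding y z colored_graph_rel_def by auto
    have "g e \<in> edges G'" if "e \<in> edges G" for e
      using iso that by (auto simp: graph_iso_def bij_betw_def)
    then have "c'' ((g' \<circ> g) e) = c e" if "e \<in> edges G" for e
      using c c' that by auto
    then show "(x, z) \<in> colored_graph_rel s m"
      using mem mem' graph_iso_trans[OF iso iso'] unfolding x z colored_graph_rel_def by blast
  qed
qed

lemma component_subset_verts:
  assumes "multigraph G" "Z \<subseteq> edges G" "v \<in> verts G"
  shows "component (G\<lparr>edges := Z\<rparr>) v \<subseteq> verts G"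
proof
  fix w assume "w \<in> component (G\<lparr>edges := Z\<rparr>) v"
  then have "(v, w) \<in> (adjacency (G\<lparr>edges := Z\<rparr>))\<^sup>*"
    by (simp add: component_def)
  then show "w \<in> verts G"
  proof induction
    case (step y z)
    then obtain e where "e \<in> Z" "ends G e = {#y, z#}"
      by (auto simp: adjacency_def)
    then show ?case
      using assms(1,2) unfolding multigraph_def by (metis in_mono set_mset_add_mset_insert insertI1 insertI2)
  qed (use assms in simp)
qed

lemma graph_iso_component:
  assumes G: "multigraph G" and H: "multigraph H" and iso: "graph_iso G H f g"
    and Z: "Z \<subseteq> edges G" and v: "v \<in> verts G"
  shows "component (H\<lparr>edges := g ` Z\<rparr>) (f v) = f ` component (G\<lparr>edges := Z\<rparr>) v"
proof -
  let ?A = "adjacency (G\<lparr>edges := Z\<rparr>)" and ?B = "adjacency (H\<lparr>edges := g ` Z\<rparr>)"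
  have e: "ends H (g e) = image_mset f (ends G e)" if "e \<in> Z" for e
    using iso Z that by (auto simp: graph_iso_def)
  have f: "inj_on f (verts G)"
    using iso by (simp add: graph_iso_def bij_betw_def)
  have 1: "(f v, f w) \<in> ?B\<^sup>*" if "(v, w) \<in> ?A\<^sup>*" for w
    using that
  proof induction
    case (step y z)
    then obtain d where "d \<in> Z" "ends G d = {#y, z#}"
      by (auto simp: adjacency_def)
    then have "g d \<in> g ` Z" "ends H (g d) = {#f y, f z#}"
      using e by auto
    then have "(f y, f z) \<in> ?B"
      unfolding adjacency_def by auto
    with step show ?case by simp
  qed simp
  have 2: "\<exists>w. w \<in> verts G \<and> u = f w \<and> (v, w) \<in> ?A\<^sup>*" if "(f v, u) \<in> ?B\<^sup>*" for u
    using that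
  proof induction
    case base
    then show ?case using v by blast
  next
    case (step y z)
    then obtain w d where w: "w \<in> verts G" "y = f w" "(v, w) \<in> ?A\<^sup>*"
      and d: "d \<in> Z" "image_mset f (ends G d) = {#y, z#}"
      using e by (auto simp: adjacency_def)
    have sub: "set_mset (ends G d) \<subseteq> verts G"
      using G Z d by (auto simp: multigraph_def)
    obtain p q where pq: "ends G d = {#p, q#}" "f p = y" "f q = z"
    proof -
      obtain p N where p: "ends G d = add_mset p N" "f p = y" "image_mset f N = {#z#}"
        using msed_map_invR[OF d(2)] by blast
      obtain q where "N = {#q#}" "f q = z"
        using msed_map_invR[OF p(3)] by auto
      with p show ?thesis using that by simp
    qed
    then have "p \<in> verts G" "q \<in> verts G" using sub by auto
    then have "p = w" using f pq w by (auto dest: inj_onD)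
    then have "(w, q) \<in> ?A" using pq d by (auto simp: adjacency_def)
    with w(3) have "(v, q) \<in> ?A\<^sup>*" by (rule rtrancl.rtrancl_into_rtrancl)
    then show ?case using pq \<open>q \<in> verts G\<close> by blast
  qed
  show ?thesis
    using 1 2 by (auto simp: component_def)
qed

lemma graph_iso_contract:
  assumes G: "multigraph G" and H: "multigraph H" and iso: "graph_iso G H f g"
    and Z: "Z \<subseteq> edges G"
  shows "graph_iso (contract G Z) (contract H (g ` Z)) ((`) f) g"
    and "graph_rank (H\<lparr>edges := g ` Z\<rparr>) = graph_rank (G\<lparr>edges := Z\<rparr>)"
proof -
  let ?p = "component (G\<lparr>edges := Z\<rparr>)" and ?q = "component (H\<lparr>edges := g ` Z\<rparr>)"
  have f: "bij_betw f (verts G) (verts H)" and g: "bij_betw g (edges G) (edges H)"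
    using iso by (auto simp: graph_iso_def)
  have comp: "?q (f v) = f ` ?p v" if "v \<in> verts G" for v
    using graph_iso_component[OF G H iso Z that] .
  have im: "?q ` verts H = (`) f ` ?p ` verts G"
  proof -
    have "verts H = f ` verts G"
      using f by (simp add: bij_betw_def)
    then show ?thesis
      using comp by (simp add: image_image cong: image_cong)
  qed
  have inj: "inj_on ((`) f) (?p ` verts G)"
  proof (rule inj_on_subset)
    show "inj_on ((`) f) (Pow (verts G))"
      using f by (simp add: bij_betw_def inj_on_image_Pow)
    show "?p ` verts G \<subseteq> Pow (verts G)"
      using component_subset_verts[OF G Z] by blast
  qed
  have "image_mset ?q (ends H (g e)) = image_mset ((`) f) (image_mset ?p (ends G e))"
    if "e \<in> edges G" for e
  proof -
    have "set_mset (ends G e) \<subseteq> verts G"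
      using G that by (auto simp: multigraph_def)
    moreover have "ends H (g e) = image_mset f (ends G e)"
      using iso that by (simp add: graph_iso_def)
    ultimately show ?thesis
      using comp by (auto simp: multiset.map_comp intro!: image_mset_cong)
  qed
  moreover have "bij_betw g (edges G - Z) (edges H - g ` Z)"
    using g Z by (intro bij_betw_DiffI) (auto simp: bij_betw_def intro: inj_on_subset)
  moreover have "?q (leg H i) = f ` ?p (leg G i)" if "i \<in> {1..nlegs G}" for i
    using iso G comp that by (auto simp: graph_iso_def multigraph_def)
  ultimately show "graph_iso (contract G Z) (contract H (g ` Z)) ((`) f) g"
    using im inj iso by (auto simp: graph_iso_def bij_betw_def)
  have "card (g ` Z) = card Z"
    using g Z by (meson bij_betw_def card_image inj_on_subset)
  moreover have "card (verts H) = card (verts G)"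
    using f by (simp add: bij_betw_same_card)
  ultimately show "graph_rank (H\<lparr>edges := g ` Z\<rparr>) = graph_rank (G\<lparr>edges := Z\<rparr>)"
    using im inj by (simp add: graph_rank_def card_image)
qed

lemma cells_subset: "cells s m \<subseteq> colored_graphs s m"
  unfolding cells_def
proof (rule image_subsetI)
  fix C assume C: "C \<in> colored_graphs s m // colored_graph_rel s m"
  then have "C \<noteq> {}"
    by (rule in_quotient_imp_non_empty[OF equiv_colored_graph_rel])
  then have "(SOME x. x \<in> C) \<in> C"
    by (simp add: some_in_eq)
  then show "(SOME x. x \<in> C) \<in> colored_graphs s m"
    using in_quotient_imp_subset[OF equiv_colored_graph_rel C] by blast
qed

lemma ex_cell:
  assumes "x \<in> colored_graphs s m"
  shows "\<exists>y\<in>cells s m. (y, x) \<in> colored_graph_rel s m"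
proof -
  let ?r = "colored_graph_rel s m"
  let ?C = "?r `` {x}"
  have C: "?C \<in> colored_graphs s m // ?r"
    using assms by (rule quotientI)
  have "x \<in> ?C"
    by (rule equiv_class_self[OF equiv_colored_graph_rel assms])
  then have "(SOME y. y \<in> ?C) \<in> ?C"
    by (rule someI)
  moreover have "(SOME y. y \<in> ?C) \<in> cells s m"
    unfolding cells_def using C by (rule imageI)
  ultimately have "(SOME y. y \<in> ?C) \<in> cells s m" "(x, SOME y. y \<in> ?C) \<in> ?r"
    by simp_all
  then show ?thesis
    using equiv_colored_graph_rel by (meson equivE symD)
qed

lemma topspace_cell_sum:
  "topspace (cell_sum s m) =
     {((G, c), l). (G, c) \<in> cells s m \<and> l \<in> regular_metrics G \<and> (\<Sum>e\<in>edges G. l e) = 1}"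
  by (auto simp: cell_sum_def length_simplex_def regular_metrics_def PiE_iff split: prod.splits)

lemma cell_map_image:
  "cell_map s m ` topspace (cell_sum s m) = metric_graphs s m // metric_graph_rel s m"
proof (intro subset_antisym subsetI)
  fix C assume "C \<in> cell_map s m ` topspace (cell_sum s m)"
  then obtain G c l where "(G, c) \<in> cells s m" "l \<in> regular_metrics G"
    and C: "C = metric_graph_rel s m `` {(G, l, c)}"
    by (auto simp: topspace_cell_sum cell_map_def)
  then have "(G, l, c) \<in> metric_graphs s m"
    using cells_subset by (auto simp: metric_graphs_def colored_graphs_def)
  then show "C \<in> metric_graphs s m // metric_graph_rel s m"
    unfolding C by (rule quotientI)
next
  fix C assume "C \<in> metric_graphs s m // metric_graph_rel s m"
  then obtain G l c where x: "(G, l, c) \<in> metric_graphs s m"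
    and C: "C = metric_graph_rel s m `` {(G, l, c)}"
    by (auto elim!: quotientE)
  then have Gc: "(G, c) \<in> colored_graphs s m"
    by (auto simp: metric_graphs_def colored_graphs_def)
  obtain H d where H: "(H, d) \<in> cells s m" and rel: "((H, d), (G, c)) \<in> colored_graph_rel s m"
    using ex_cell[OF Gc] by (metis prod.exhaust)
  obtain f g where iso: "graph_iso H G f g" and d: "\<And>e. e \<in> edges H \<Longrightarrow> c (g e) = d e"
    and Hd: "(H, d) \<in> colored_graphs s m"
    using rel by (auto simp: colored_graph_rel_def)
  have mG: "multigraph G" and rk: "graph_rank G = 1" and mH: "multigraph H"
    and l: "l \<in> edges G \<rightarrow>\<^sub>E {0..}" and fo: "forest G (zero_edges G l)"
    using x Hd
    by (auto simp: metric_graphs_def colored_graphs_def one_loop_graphs_def regular_metrics_def)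
  have g: "bij_betw g (edges H) (edges G)"
    using iso by (simp add: graph_iso_def)
  define L where "L = (\<Sum>e\<in>edges G. l e)"
  have "zero_edges G l \<noteq> edges G"
  proof
    assume "zero_edges G l = edges G"
    then have "graph_rank (G\<lparr>edges := edges G\<rparr>) = 0"
      using fo by (simp add: forest_def)
    then show False using rk by simp
  qed
  moreover have nonneg: "l e \<ge> 0" if "e \<in> edges G" for e
    using l that by auto
  moreover have "finite (edges G)"
    using mG by (simp add: multigraph_def)
  ultimately have L: "L > 0"
    unfolding L_def zero_edges_def
    by (metis (mono_tags, lifting) Collect_cong Collect_mem_eq order_le_less sum_nonneg
        sum_nonneg_eq_0_iff)
  define \<mu> where "\<mu> = (\<lambda>e\<in>edges H. l (g e) / L)"
  let ?Z = "zero_edges H \<mu>"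
  have ge: "g e \<in> edges G" if "e \<in> edges H" for e
    using g that by (auto simp: bij_betw_def)
  have Z: "g ` ?Z = zero_edges G l"
    using g L ge by (force simp: zero_edges_def \<mu>_def bij_betw_def)
  have ZH: "?Z \<subseteq> edges H"
    by (auto simp: zero_edges_def)
  have isoC: "graph_iso (contract H ?Z) (contract G (zero_edges G l)) ((`) f) g"
    using graph_iso_contract(1)[OF mH mG iso ZH] by (simp only: Z)
  have "forest H ?Z"
    using graph_iso_contract(2)[OF mH mG iso ZH] fo ZH by (simp add: forest_def Z)
  then have \<mu>: "\<mu> \<in> regular_metrics H"
    using nonneg ge L by (auto simp: regular_metrics_def \<mu>_def)
  have "(\<Sum>e\<in>edges H. \<mu> e) = (\<Sum>e\<in>edges H. l (g e)) / L"
    by (simp add: \<mu>_def sum_divide_distrib)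
  also have "(\<Sum>e\<in>edges H. l (g e)) = L"
    using g unfolding L_def by (rule sum.reindex_bij_betw)
  finally have "((H, d), \<mu>) \<in> topspace (cell_sum s m)"
    using L H \<mu> by (simp add: topspace_cell_sum)
  moreover have "((H, \<mu>, d), (G, l, c)) \<in> metric_graph_rel s m"
  proof -
    have "(H, \<mu>, d) \<in> metric_graphs s m"
      using Hd \<mu> by (simp add: metric_graphs_def colored_graphs_def)
    moreover have "\<forall>e\<in>edges H - ?Z. l (g e) = L * \<mu> e \<and> c (g e) = d e"
      using d L by (simp add: \<mu>_def)
    ultimately show ?thesis
      using x L isoC unfolding metric_graph_rel_def by blast
  qed
  then have "cell_map s m ((H, d), \<mu>) = C"
    using equiv_class_eq[OF equiv_metric_graph_rel] by (simp add: cell_map_def C)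
  ultimately show "C \<in> cell_map s m ` topspace (cell_sum s m)"
    by blast
qed

lemma topspace_MCG1: "topspace (MCG1 s m) = metric_graphs s m // metric_graph_rel s m"
proof (rule subset_antisym)
  show "topspace (MCG1 s m) \<subseteq> metric_graphs s m // metric_graph_rel s m"
    using openin_MCG1 openin_topspace by blast
  have "{x \<in> topspace (cell_sum s m). cell_map s m x \<in> metric_graphs s m // metric_graph_rel s m}
      = topspace (cell_sum s m)"
    using cell_map_image by blast
  then have "openin (MCG1 s m) (metric_graphs s m // metric_graph_rel s m)"
    by (simp add: openin_MCG1)
  then show "metric_graphs s m // metric_graph_rel s m \<subseteq> topspace (MCG1 s m)"
    by (rule openin_subset)
qed

lemma quotient_map_cell_map: "quotient_map (cell_sum s m) (MCG1 s m) (cell_map s m)"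
  by (simp add: quotient_map_def topspace_MCG1 cell_map_image openin_MCG1)

end

theory Submission
  imports Defs
begin

text \<open>
  A space is simply connected as soon as every point \<open>x\<close> carries a path \<open>\<gamma> x\<close> from a base point to
  \<open>x\<close> whose homotopy class is preserved by transport along all sufficiently small paths.

  In the moduli space, a graph concentrated on a single edge is determined by the color of that
  edge. Let \<open>\<gamma> x\<close> run from the base point to the graph of color \<open>c e\<close>, for some edge \<open>e\<close> of
  a graph representing \<open>x\<close>, and then straight to \<open>x\<close> inside the closed cell. The choice of \<open>e\<close>
  is irrelevant because any two one-cells with the same end colors are homotopic: one-cells are given by partitions of
  the legs into two parts, and triangles with two sides of the same color identify the one-cells of
  two disjoint sets of legs that do not exhaust all legs, which suffices when there are three legs.
  Fixing a threshold \<open>\<epsilon>\<close>, the graphs without an edge of length \<open>\<epsilon>\<close> fall into open sets on which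
  shrinking all shorter edges and equalizing all longer ones is a well-defined contraction to a
  point along straight lines in cells. These sets cover the space, and transport inside them
  preserves the classes of the \<open>\<gamma> x\<close>.
\<close>

section \<open>Simple connectedness by transport of paths\<close>

text \<open>Up to homotopy the one-cells form a complete graph on the colors: a monochromatic
  one-cell is folded in half by exchanging its two edges and contracts, and all one-cells between
  two given colors agree. Each cycle of three colors bounds a two-cell, so the class of a path from
  the base point depends only on its end. The triangles needed here are cycles with three vertices,
  each carrying a leg. With two legs the space is a complete graph on the colors with folded
  intervals attached, which is not simply connected for three or more colors. The closed cells do
  not inject into the quotient, and representatives of one point differ by isomorphisms and
  collapsed edges. Neighborhoods and deformations are therefore described by functions of the
  normalized edge lengths that vanish at zero, since these descend to the quotient. A threshold
  \<epsilon> > 0 supplies one: short edges go to 0, long ones to 1. Only homotopy classes matter, so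
  the paths \<open>\<gamma> x\<close> can be chosen without any continuity in
  \<open>x\<close>.\<close>

text \<open>
  The library develops homotopies of paths only in types of class \<^class>\<open>topological_space\<close>. The
  disjoint union of all topologies on a type is such a type and contains each of them as an open and
  closed subspace.
\<close>

typedef 'a located = "UNIV :: ('a topology \<times> 'a) set" ..

instantiation located :: (type) topological_space
begin

definition open_located :: "'a located set \<Rightarrow> bool" where
  "open_located U \<longleftrightarrow> (\<forall>X. openin X {x \<in> topspace X. Abs_located (X, x) \<in> U})"

instance
proof
  show "open (UNIV :: 'a located set)"
    by (simp add: open_located_def)
next
  fix S T :: "'a located set" assume "open S" "open T"
  then have "openin X ({x \<in> topspace X. Abs_located (X, x) \<in> S} \<inter>
      {x \<in> topspace X. Abs_located (X, x) \<in> T})" for X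
    unfolding open_located_def by blast
  moreover have "{x \<in> topspace X. Abs_located (X, x) \<in> S} \<inter> {x \<in> topspace X. Abs_located (X, x) \<in> T}
      = {x \<in> topspace X. Abs_located (X, x) \<in> S \<inter> T}" for X
    by blast
  ultimately show "open (S \<inter> T)"
    by (simp add: open_located_def)
next
  fix K :: "'a located set set" assume "\<forall>S\<in>K. open S"
  then have "openin X (\<Union>S\<in>K. {x \<in> topspace X. Abs_located (X, x) \<in> S})" for X
    unfolding open_located_def by blast
  moreover have "(\<Union>S\<in>K. {x \<in> topspace X. Abs_located (X, x) \<in> S})
      = {x \<in> topspace X. Abs_located (X, x) \<in> \<Union>K}" for X
    by blast
  ultimately show "open (\<Union>K)"
    by (simp add: open_located_def)
qed

end

definition locate :: "'a topology \<Rightarrow> 'a \<Rightarrow> 'a located" where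
  "locate X x = Abs_located (X, x)"

definition unlocate :: "'a located \<Rightarrow> 'a" where
  "unlocate y = snd (Rep_located y)"

lemma unlocate_locate [simp]: "unlocate (locate X x) = x"
  by (simp add: unlocate_def locate_def Abs_located_inverse)

lemma locate_eq_iff: "locate X x = locate Y y \<longleftrightarrow> X = Y \<and> x = y"
  by (simp add: locate_def Abs_located_inject)

lemma open_located_iff: "open U \<longleftrightarrow> (\<forall>X. openin X {x \<in> topspace X. locate X x \<in> U})"
  by (simp add: open_located_def locate_def)

lemma continuous_map_locate: "continuous_map X euclidean (locate X)"
  by (auto simp: continuous_map_def open_located_iff simp flip: open_openin)

lemma open_locate_image:
  assumes "openin X U"
  shows "open (locate X ` U)"
proof -
  have "openin Y {y \<in> topspace Y. locate Y y \<in> locate X ` U}" for Y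
  proof (cases "Y = X")
    case True
    then have "{y \<in> topspace Y. locate Y y \<in> locate X ` U} = U"
      using openin_subset[OF assms] by (auto simp: locate_eq_iff)
    with assms True show ?thesis by simp
  next
    case False
    then have "{y \<in> topspace Y. locate Y y \<in> locate X ` U} = {}"
      by (auto simp: locate_eq_iff)
    then show ?thesis by (metis openin_empty)
  qed
  then show ?thesis
    by (simp add: open_located_iff)
qed

lemma closed_locate_topspace: "closed (locate X ` topspace X)"
proof -
  have "openin Y {y \<in> topspace Y. locate Y y \<in> - locate X ` topspace X}" for Y
  proof (cases "Y = X")
    case True
    then have "{y \<in> topspace Y. locate Y y \<in> - locate X ` topspace X} = {}"
      by auto
    then show ?thesis by (metis openin_empty)
  next
    case False
    then have "{y \<in> topspace Y. locate Y y \<in> - locate X ` topspace X} = topspace Y"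
      by (auto simp: locate_eq_iff)
    then show ?thesis by (metis openin_topspace)
  qed
  then show ?thesis
    by (simp add: closed_def open_located_iff)
qed

lemma continuous_map_unlocate:
  "continuous_map (top_of_set (locate X ` topspace X)) X unlocate"
  unfolding continuous_map_def
proof (intro conjI allI impI)
  fix U assume U: "openin X U"
  then have "{y \<in> locate X ` topspace X. unlocate y \<in> U} = locate X ` topspace X \<inter> locate X ` U"
    using openin_subset[OF U] by (auto simp: locate_eq_iff)
  then show "openin (top_of_set (locate X ` topspace X))
      {y \<in> topspace (top_of_set (locate X ` topspace X)). unlocate y \<in> U}"
    using open_locate_image[OF U] by (auto simp: openin_open)
qed auto

text \<open>The copy of \<open>X\<close> is open and closed, so a connected image that meets it
  cannot leave it. Paths and homotopies found in the whole type are therefore paths and homotopies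
  in \<open>X\<close>, which is why \<open>homotopic\<close> can be taken in
  \<open>UNIV\<close>.\<close>

lemma connected_image_locate:
  assumes "continuous_on C f" "connected C" "c \<in> C" "f c \<in> locate X ` topspace X"
  shows "f ` C \<subseteq> locate X ` topspace X"
proof -
  have "connected (f ` C)"
    using assms by (simp add: connected_continuous_image)
  then show ?thesis
    using connected_closedD[of "f ` C" "locate X ` topspace X" "- locate X ` topspace X"]
      open_locate_image[of X "topspace X"] closed_locate_topspace[of X] assms(3,4)
    by (auto simp: closed_def)
qed

section \<open>Calculus of path homotopies\<close>

abbreviation homotopic :: "(real \<Rightarrow> 'a::topological_space) \<Rightarrow> (real \<Rightarrow> 'a) \<Rightarrow> bool" where
  "homotopic \<equiv> homotopic_paths UNIV"

text \<open>Convex sets are simply connected, and continuous maps carry homotopies along. Intervals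
  as \<open>K\<close> give the laws of path composition, triangles and squares give the geometric
  homotopies.\<close>

lemma homotopic_convex_image:
  fixes K :: "'b::real_normed_vector set"
  assumes "continuous_on K F" "convex K" "path f" "path g" "path_image f \<subseteq> K" "path_image g \<subseteq> K"
    "pathstart f = pathstart g" "pathfinish f = pathfinish g"
  shows "homotopic (F \<circ> f) (F \<circ> g)"
proof -
  have "homotopic_paths K f g"
    using convex_imp_simply_connected[OF assms(2)] assms(3-8)
    by (simp add: simply_connected_eq_homotopic_paths)
  then show ?thesis
    by (rule homotopic_paths_continuous_image) (use assms in auto)
qed

lemma homotopic_join_linepath:
  fixes K :: "'b::real_normed_vector set"
  assumes "continuous_on K F" "convex K" "a \<in> K" "b \<in> K" "c \<in> K"
  shows "homotopic ((F \<circ> linepath a b) +++ (F \<circ> linepath b c)) (F \<circ> linepath a c)"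
proof -
  have "homotopic (F \<circ> (linepath a b +++ linepath b c)) (F \<circ> linepath a c)"
    by (rule homotopic_convex_image[OF assms(1,2)])
      (use assms in \<open>auto simp: path_image_join closed_segment_subset\<close>)
  then show ?thesis
    by (simp add: path_compose_join)
qed

text \<open>The constant path is \<open>p\<close> composed with the degenerate segment from 1 to 1,
  so this is a triangle identity in the unit interval with \<open>p\<close> as the continuous
  map.\<close>

lemma homotopic_const_right:
  assumes "path p" "a = pathfinish p"
  shows "homotopic (p +++ (\<lambda>_. a)) p"
proof -
  have "homotopic ((p \<circ> linepath 0 1) +++ (p \<circ> linepath 1 1)) (p \<circ> linepath 0 1)"
    by (rule homotopic_join_linepath[of "{0..1}"]) (use assms in \<open>auto simp: path_def\<close>)
  moreover have "p \<circ> linepath 0 1 = p" "p \<circ> linepath 1 1 = (\<lambda>_. a)"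
    using assms by (auto simp: linepath_def pathfinish_def)
  ultimately show ?thesis by simp
qed

lemma homotopic_const_left:
  assumes "path p" "a = pathstart p"
  shows "homotopic ((\<lambda>_. a) +++ p) p"
proof -
  have "homotopic ((p \<circ> linepath 0 0) +++ (p \<circ> linepath 0 1)) (p \<circ> linepath 0 1)"
    by (rule homotopic_join_linepath[of "{0..1}"]) (use assms in \<open>auto simp: path_def\<close>)
  moreover have "p \<circ> linepath 0 1 = p" "p \<circ> linepath 0 0 = (\<lambda>_. a)"
    using assms by (auto simp: linepath_def pathstart_def)
  ultimately show ?thesis by simp
qed

lemma homotopic_join_reversepath:
  assumes "path p"
  shows "homotopic (p +++ reversepath p) (\<lambda>_. pathstart p)"
proof -
  have "homotopic ((p \<circ> linepath 0 1) +++ (p \<circ> linepath 1 0)) (p \<circ> linepath 0 0)"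
    by (rule homotopic_join_linepath[of "{0..1}"]) (use assms in \<open>auto simp: path_def\<close>)
  moreover have "p \<circ> linepath 0 1 = p" "p \<circ> linepath 0 0 = (\<lambda>_. pathstart p)"
      "p \<circ> linepath 1 0 = reversepath p"
    using assms by (auto simp: linepath_def pathstart_def reversepath_def)
  ultimately show ?thesis by simp
qed

lemma homotopic_reversepath_join:
  assumes "path p"
  shows "homotopic (reversepath p +++ p) (\<lambda>_. pathfinish p)"
  using homotopic_join_reversepath[of "reversepath p"] assms by simp

text \<open>The second half of such a path is its first half run backwards.\<close>

lemma homotopic_palindrome:
  assumes "path p" "\<And>t. t \<in> {0..1} \<Longrightarrow> p (1 - t) = p t"
  shows "homotopic p (\<lambda>_. pathstart p)"
proof -
  let ?q = "p \<circ> linepath 0 (1/2)"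
  have q: "path ?q"
    using assms(1) unfolding path_def
    by (intro continuous_on_compose continuous_on_linepath)
      (auto simp: linepath_def elim!: continuous_on_subset)
  have "homotopic p (?q +++ (p \<circ> linepath (1/2) 1))"
  proof -
    have "homotopic ((p \<circ> linepath 0 (1/2)) +++ (p \<circ> linepath (1/2) 1)) (p \<circ> linepath 0 1)"
      by (rule homotopic_join_linepath[of "{0..1}"]) (use assms in \<open>auto simp: path_def\<close>)
    moreover have "p \<circ> linepath 0 1 = p"
      by (auto simp: linepath_def)
    ultimately show ?thesis by (simp add: homotopic_paths_sym)
  qed
  also have "homotopic (?q +++ (p \<circ> linepath (1/2) 1)) (?q +++ reversepath ?q)"
  proof (rule homotopic_paths_join)
    show "homotopic (p \<circ> linepath (1/2) 1) (reversepath ?q)"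
    proof (rule homotopic_paths_sym, rule homotopic_paths_eq)
      fix t :: real assume t: "t \<in> {0..1}"
      then have "p (1 - (1 - t) / 2) = p ((1 - t) / 2)"
        by (intro assms) auto
      then show "reversepath ?q t = (p \<circ> linepath (1/2) 1) t"
        by (simp add: reversepath_def linepath_def field_simps)
    qed (use q in auto)
  qed (use q in \<open>auto simp: pathstart_def pathfinish_def linepath_def\<close>)
  also have "homotopic \<dots> (\<lambda>_. pathstart ?q)"
    by (rule homotopic_join_reversepath[OF q])
  finally show ?thesis
    by (simp add: pathstart_def linepath_def)
qed

text \<open>In a convex square, one side is homotopic to the way around along the other
  three.\<close>

lemma homotopic_square:
  assumes "continuous_on ({0..1} \<times> {0..1}) H"
  shows "homotopic (\<lambda>t. H (t, 0))
    ((\<lambda>u. H (0, u)) +++ ((\<lambda>t. H (t, 1)) +++ reversepath (\<lambda>u. H (1, u))))"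
proof -
  let ?K = "{0..1} \<times> {0..1} :: (real \<times> real) set"
  let ?p = "linepath (0, 0) (0, 1) +++ (linepath (0, 1) (1, 1) +++ linepath (1, 1) (1, 0))
      :: real \<Rightarrow> real \<times> real"
  have K: "convex ?K"
    by (intro convex_Times convex_real_interval)
  have seg: "closed_segment a b \<subseteq> ?K" if "a \<in> ?K" "b \<in> ?K" for a b
    using that by (intro closed_segment_subset K)
  have "homotopic (H \<circ> linepath (0, 0) (1, 0)) (H \<circ> ?p)"
    by (rule homotopic_convex_image[OF assms K])
      (use seg in \<open>auto simp: path_image_join\<close>)
  moreover have "H \<circ> linepath (0, 0) (1, 0) = (\<lambda>t. H (t, 0))"
    "H \<circ> linepath (0, 0) (0, 1) = (\<lambda>t. H (0, t))"
    "H \<circ> linepath (0, 1) (1, 1) = (\<lambda>t. H (t, 1))"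
    "H \<circ> linepath (1, 1) (1, 0) = reversepath (\<lambda>t. H (1, t))"
    by (auto simp: linepath_def reversepath_def fun_eq_iff)
  ultimately show ?thesis
    by (simp add: path_compose_join)
qed

lemma homotopic_cancel_left:
  assumes "homotopic (g +++ p) (g +++ q)" "path g" "path p" "path q"
    "pathfinish g = pathstart p" "pathfinish g = pathstart q"
  shows "homotopic p q"
proof -
  have *: "homotopic r (reversepath g +++ (g +++ r))" if "path r" "pathfinish g = pathstart r" for r
  proof -
    have "homotopic (reversepath g +++ (g +++ r)) ((reversepath g +++ g) +++ r)"
      using that assms by (intro homotopic_paths_assoc) auto
    also have "homotopic \<dots> ((\<lambda>_. pathfinish g) +++ r)"
      using that assms by (intro homotopic_paths_join homotopic_reversepath_join) auto
    also have "homotopic \<dots> r"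
      using that by (intro homotopic_const_left) auto
    finally show ?thesis by (rule homotopic_paths_sym)
  qed
  have "homotopic p (reversepath g +++ (g +++ p))"
    by (rule *) (use assms in auto)
  also have "homotopic \<dots> (reversepath g +++ (g +++ q))"
    by (rule homotopic_paths_join[OF _ assms(1)]) (use assms in auto)
  also have "homotopic \<dots> q"
    by (rule homotopic_paths_sym[OF *]) (use assms in auto)
  finally show ?thesis .
qed

text \<open>The local condition is the only link between the chosen paths \<open>\<gamma> x\<close>.
  A Lebesgue number cuts \<open>p\<close> into finitely many pieces, each inside one good set, and
  the pieces are appended to \<open>\<gamma> (p 0)\<close> one after the other.\<close>

lemma homotopic_transport:
  assumes cont: "continuous_map (top_of_set {0..1}) X p"
    and \<gamma>: "\<And>x. x \<in> topspace X \<Longrightarrow> path (\<gamma> x) \<and> pathfinish (\<gamma> x) = locate X x"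
    and small: "\<And>x. x \<in> topspace X \<Longrightarrow> \<exists>W. openin X W \<and> x \<in> W \<and>
      (\<forall>d. continuous_map (top_of_set {0..1}) X d \<and> d ` {0..1} \<subseteq> W \<longrightarrow>
        homotopic (\<gamma> (d 0) +++ (locate X \<circ> d)) (\<gamma> (d 1)))"
  shows "homotopic (\<gamma> (p 0) +++ (locate X \<circ> p)) (\<gamma> (p 1))"
proof -
  have pX: "p t \<in> topspace X" if "t \<in> {0..1}" for t
    using cont that by (auto simp: continuous_map_def)
  define good where "good W \<longleftrightarrow> openin X W \<and>
      (\<forall>d. continuous_map (top_of_set {0..1}) X d \<and> d ` {0..1} \<subseteq> W \<longrightarrow>
        homotopic (\<gamma> (d 0) +++ (locate X \<circ> d)) (\<gamma> (d 1)))" for W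
  \<comment> \<open>The covering lemma needs a metric, so the good sets are pulled back to open sets
    of parameters.\<close>
  define \<B> where "\<B> = {B. open B \<and> (\<exists>W. good W \<and> p ` ({0..1} \<inter> B) \<subseteq> W)}"
  have cov: "\<exists>B\<in>\<B>. t \<in> B" if t: "t \<in> {0..1}" for t
  proof -
    obtain W where W: "good W" "p t \<in> W"
      using small[OF pX[OF t]] by (auto simp: good_def)
    then have "openin (top_of_set {0..1}) {t \<in> {0..1}. p t \<in> W}"
      using cont by (auto simp: continuous_map_def good_def)
    then obtain B where "open B" "{t \<in> {0..1}. p t \<in> W} = {0..1} \<inter> B"
      by (auto simp: openin_open)
    then have "B \<in> \<B>" "t \<in> B"
      using W t by (auto simp: \<B>_def)
    then show ?thesis by blast
  qed
  obtain \<delta> where \<delta>: "\<delta> > 0" and leb: "\<And>T. T \<subseteq> {0..1} \<Longrightarrow> diameter T < \<delta> \<Longrightarrow> \<exists>B\<in>\<B>. T \<subseteq> B"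
  proof (rule Lebesgue_number_lemma[of "{0..1::real}" \<B>])
    show "\<B> \<noteq> {}"
      using cov[of 0] by auto
    show "{0..1} \<subseteq> \<Union>\<B>"
      using cov by blast
  qed (auto simp: \<B>_def)
  obtain n :: nat where n: "n > 0" "1 / real n < \<delta>"
    using \<delta> by (metis nat_approx_posE of_nat_Suc zero_less_Suc)
  let ?q = "locate X \<circ> p"
  have q: "continuous_on {0..1} ?q"
    using continuous_map_compose[OF cont continuous_map_locate] by auto
  have path: "path (?q \<circ> linepath a b)" if "a \<in> {0..1}" "b \<in> {0..1}" for a b
    using that unfolding path_def
    by (intro continuous_on_compose continuous_on_linepath continuous_on_subset[OF q])
      (auto simp: linepath_image_01 closed_segment_subset)
  have "homotopic (\<gamma> (p 0) +++ (?q \<circ> linepath 0 (real k / n))) (\<gamma> (p (real k / n)))"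
    if "k \<le> n" for k
    using that
  proof (induction k)
    case 0
    have "?q \<circ> linepath 0 0 = (\<lambda>_. locate X (p 0))"
      by (simp add: linepath_def comp_def)
    then show ?case
      using homotopic_const_right[of "\<gamma> (p 0)"] \<gamma> pX[of 0] by simp
  next
    case (Suc k)
    let ?a = "real k / n" and ?b = "real (Suc k) / n"
    have ab: "?a \<in> {0..1}" "?b \<in> {0..1}" "?a \<le> ?b" "?b - ?a = 1 / n"
      using Suc n by (auto simp: field_simps)
    have "{?a..?b} \<subseteq> {0..1}" "diameter {?a..?b} < \<delta>"
      using ab n by auto
    then obtain B where B: "B \<in> \<B>" "{?a..?b} \<subseteq> B"
      using leb by blast
    then obtain W where W: "good W" "p ` ({0..1} \<inter> B) \<subseteq> W"
      by (auto simp: \<B>_def)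
    have "{?a..?b} \<subseteq> {0..1} \<inter> B"
      using B \<open>{?a..?b} \<subseteq> {0..1}\<close> by blast
    then have W: "good W" "p ` {?a..?b} \<subseteq> W"
      using W by blast+
    have im: "linepath ?a ?b ` {0..1} = {?a..?b}"
      using ab by (simp add: linepath_image_01 closed_segment_eq_real_ivl)
    have "continuous_map (top_of_set {0..1}) X (p \<circ> linepath ?a ?b)"
    proof (rule continuous_map_compose[OF _ cont])
      have "continuous_on {0..1} (linepath ?a ?b)"
        by (rule continuous_on_linepath)
      moreover have "linepath ?a ?b ` {0..1} \<subseteq> {0..1}"
        unfolding im by fact
      ultimately show "continuous_map (top_of_set {0..1}) (top_of_set {0..1}) (linepath ?a ?b)"
        by (simp add: continuous_map_in_subtopology image_subset_iff_funcset)
    qed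
    moreover have "(p \<circ> linepath ?a ?b) ` {0..1} \<subseteq> W"
      unfolding image_comp[symmetric] im by (rule W(2))
    ultimately have "homotopic (\<gamma> ((p \<circ> linepath ?a ?b) 0) +++ (locate X \<circ> (p \<circ> linepath ?a ?b)))
        (\<gamma> ((p \<circ> linepath ?a ?b) 1))"
      using W(1) unfolding good_def by blast
    then have step: "homotopic (\<gamma> (p ?a) +++ (?q \<circ> linepath ?a ?b)) (\<gamma> (p ?b))"
      by (simp only: comp_apply linepath_0' linepath_1' comp_assoc)
    have fin: "pathfinish (\<gamma> (p t)) = locate X (p t)" "path (\<gamma> (p t))" if "t \<in> {0..1}" for t
      using \<gamma> pX that by auto
    have *: "homotopic (?q \<circ> linepath 0 ?b) ((?q \<circ> linepath 0 ?a) +++ (?q \<circ> linepath ?a ?b))"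
      by (rule homotopic_paths_sym, rule homotopic_join_linepath[OF q]) (use ab in auto)
    have "homotopic (\<gamma> (p 0) +++ (?q \<circ> linepath 0 ?b))
        (\<gamma> (p 0) +++ ((?q \<circ> linepath 0 ?a) +++ (?q \<circ> linepath ?a ?b)))"
      by (intro homotopic_paths_join *)
        (use fin in \<open>auto simp: pathstart_compose\<close>)
    also have "homotopic \<dots> ((\<gamma> (p 0) +++ (?q \<circ> linepath 0 ?a)) +++ (?q \<circ> linepath ?a ?b))"
      using fin path ab by (intro homotopic_paths_assoc) (auto simp: pathstart_compose pathfinish_compose)
    also have "homotopic \<dots> (\<gamma> (p ?a) +++ (?q \<circ> linepath ?a ?b))"
    proof (rule homotopic_paths_join)
      show "homotopic (\<gamma> (p 0) +++ (?q \<circ> linepath 0 ?a)) (\<gamma> (p ?a))"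
        using Suc by (meson Suc_leD)
    qed (use path[OF ab(1,2)] in \<open>auto simp: pathstart_compose pathfinish_compose\<close>)
    also note step
    finally show ?case .
  qed
  from this[of n] n show ?thesis
    by (simp add: linepath_def comp_def)
qed

text \<open>For a loop \<open>p\<close>, transport says that \<open>\<gamma> (p 0)\<close> followed
  by \<open>p\<close> is homotopic to \<open>\<gamma> (p 0)\<close>; cancelling this path leaves
  \<open>p\<close> null-homotopic. The homotopy obtained in the disjoint union stays in the copy of
  \<open>X\<close>, so \<open>unlocate\<close> brings it back.\<close>

lemma simply_connected_spaceI:
  assumes b: "b \<in> topspace X"
    and \<gamma>: "\<And>x. x \<in> topspace X \<Longrightarrow>
      path (\<gamma> x) \<and> pathstart (\<gamma> x) = locate X b \<and> pathfinish (\<gamma> x) = locate X x"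
    and small: "\<And>x. x \<in> topspace X \<Longrightarrow> \<exists>W. openin X W \<and> x \<in> W \<and>
      (\<forall>d. continuous_map (top_of_set {0..1}) X d \<and> d ` {0..1} \<subseteq> W \<longrightarrow>
        homotopic (\<gamma> (d 0) +++ (locate X \<circ> d)) (\<gamma> (d 1)))"
  shows "simply_connected_space X"
proof -
  have "path_connected_space X"
    unfolding path_connected_space_def
  proof (intro ballI)
    fix x y assume xy: "x \<in> topspace X" "y \<in> topspace X"
    let ?p = "reversepath (\<gamma> x) +++ \<gamma> y"
    have "path ?p"
      using \<gamma>[OF xy(1)] \<gamma>[OF xy(2)] by auto
    moreover have "?p 0 = locate X x" "?p 1 = locate X y"
      using \<gamma>[OF xy(1)] \<gamma>[OF xy(2)]
      by (auto simp: joinpaths_def reversepath_def pathstart_def pathfinish_def)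
    ultimately have p: "path ?p" "?p 0 = locate X x" "?p 1 = locate X y" .
    have "?p ` {0..1} \<subseteq> locate X ` topspace X"
      using p xy by (intro connected_image_locate[of _ _ 0]) (auto simp: path_def)
    then have "continuous_map (top_of_set {0..1}) (top_of_set (locate X ` topspace X)) ?p"
      using p by (auto simp: path_def)
    then have "pathin X (unlocate \<circ> ?p)"
      unfolding pathin_def by (rule continuous_map_compose) (rule continuous_map_unlocate)
    then show "\<exists>g. pathin X g \<and> g 0 = x \<and> g 1 = y"
      using p by (intro exI[of _ "unlocate \<circ> ?p"]) auto
  qed
  moreover have "homotopic_with (\<lambda>r. r 0 = p 0 \<and> r 1 = p 0) (top_of_set {0..1}) X p (\<lambda>_. p 0)"
    if p: "pathin X p" "p 1 = p 0" for p
  proof -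
    let ?S = "locate X ` topspace X"
    let ?q = "locate X \<circ> p"
    have cont: "continuous_map (top_of_set {0..1}) X p"
      using p by (simp add: pathin_def)
    have p0: "p 0 \<in> topspace X"
      using cont by (auto simp: continuous_map_def)
    have q: "path ?q"
      using continuous_map_compose[OF cont continuous_map_locate] by (auto simp: path_def)
    have "homotopic (\<gamma> (p 0) +++ ?q) (\<gamma> (p 1))"
      using \<gamma> by (intro homotopic_transport[OF cont _ small]) auto
    also have "homotopic (\<gamma> (p 1)) (\<gamma> (p 0) +++ (\<lambda>_. locate X (p 0)))"
      using homotopic_const_right[of "\<gamma> (p 0)" "locate X (p 0)"] \<gamma>[OF p0] p(2)
      by (simp add: homotopic_paths_sym)
    finally have "homotopic ?q (\<lambda>_. locate X (p 0))"
      by (rule homotopic_cancel_left)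
        (use \<gamma>[OF p0] q in \<open>auto simp: path_def pathstart_def\<close>)
    then obtain h where h: "continuous_on ({0..1} \<times> {0..1}) h"
      "\<forall>t\<in>{0..1}. h (0, t) = ?q t" "\<forall>t\<in>{0..1}. h (1, t) = locate X (p 0)"
      "\<forall>u\<in>{0..1::real}. h (u, 0) = ?q 0 \<and> h (u, 1) = ?q 1"
      unfolding homotopic_paths by (auto simp: pathstart_def pathfinish_def)
    have "h ` ({0..1} \<times> {0..1}) \<subseteq> ?S"
      by (rule connected_image_locate[OF h(1), of "(0,0)"])
        (use h p0 in \<open>auto intro!: connected_Times\<close>)
    then have "continuous_map (prod_topology (top_of_set {0..1}) (top_of_set {0..1})) (top_of_set ?S) h"
      using h(1) by (auto simp: prod_topology_subtopology_eu)
    then have "continuous_map (prod_topology (top_of_set {0..1}) (top_of_set {0..1})) X (unlocate \<circ> h)"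
      by (rule continuous_map_compose) (rule continuous_map_unlocate)
    then show ?thesis
      using h p(2) by (subst homotopic_with) (auto intro!: exI[of _ "unlocate \<circ> h"])
  qed
  ultimately show ?thesis
    using b by (auto simp: simply_connected_space_def)
qed

section \<open>Ranks and valencies of one-loop graphs\<close>

lemma adjacency_sym: "(u, v) \<in> adjacency G \<longleftrightarrow> (v, u) \<in> adjacency G"
  by (simp add: adjacency_def add_mset_commute)

lemma adjacency_rtrancl_sym: "(u, v) \<in> (adjacency G)\<^sup>* \<longleftrightarrow> (v, u) \<in> (adjacency G)\<^sup>*"
proof -
  have "sym (adjacency G)"
    by (rule symI) (rule adjacency_sym[THEN iffD1])
  then have "sym ((adjacency G)\<^sup>*)"
    by (rule sym_rtrancl)
  then show ?thesis
    using symD[of "(adjacency G)\<^sup>*"] by metis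
qed

lemma component_self: "v \<in> component G v"
  by (simp add: component_def)

lemma component_eq_iff: "component G u = component G v \<longleftrightarrow> (u, v) \<in> (adjacency G)\<^sup>*"
proof
  assume "component G u = component G v"
  then have "v \<in> component G u"
    by (simp add: component_self)
  then show "(u, v) \<in> (adjacency G)\<^sup>*"
    by (simp add: component_def)
next
  assume uv: "(u, v) \<in> (adjacency G)\<^sup>*"
  then have vu: "(v, u) \<in> (adjacency G)\<^sup>*"
    by (rule adjacency_rtrancl_sym[THEN iffD1])
  show "component G u = component G v"
    unfolding component_def using rtrancl_trans[OF uv] rtrancl_trans[OF vu] by blast
qed

lemma component_eq_of_mem: "w \<in> component G v \<Longrightarrow> component G w = component G v"
  using component_eq_iff[of G v w] by (simp add: component_def)

lemma adjacency_mono: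
  assumes "Z \<subseteq> Y" shows "adjacency (G\<lparr>edges := Z\<rparr>) \<subseteq> adjacency (G\<lparr>edges := Y\<rparr>)"
  using assms by (auto simp: adjacency_def)

lemma component_mono:
  assumes "Z \<subseteq> Y" shows "component (G\<lparr>edges := Z\<rparr>) v \<subseteq> component (G\<lparr>edges := Y\<rparr>) v"
  using rtrancl_mono[OF adjacency_mono[OF assms]] by (auto simp: component_def)

lemma ends_pair:
  assumes "multigraph G" "e \<in> edges G"
  obtains u w where "ends G e = {#u, w#}" "u \<in> verts G" "w \<in> verts G"
proof -
  have e: "size (ends G e) = Suc (Suc 0)" "set_mset (ends G e) \<subseteq> verts G"
    using assms by (auto simp: multigraph_def)
  obtain u N where N: "ends G e = add_mset u N"
    using size_eq_Suc_imp_eq_union[OF e(1)] by blast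
  then obtain w where "N = {#w#}"
    using e(1) size_1_singleton_mset[of N] by auto
  with N e(2) show ?thesis
    using that by auto
qed

text \<open>A connection needs to cross \<open>e\<close> at most once; the last two cases are the
  two directions of crossing.\<close>

lemma adjacency_rtrancl_insert:
  assumes "ends G e = {#u, w#}" "(a, b) \<in> (adjacency (G\<lparr>edges := insert e Z\<rparr>))\<^sup>*"
  shows "(a, b) \<in> (adjacency (G\<lparr>edges := Z\<rparr>))\<^sup>* \<or>
    (a, u) \<in> (adjacency (G\<lparr>edges := Z\<rparr>))\<^sup>* \<and> (w, b) \<in> (adjacency (G\<lparr>edges := Z\<rparr>))\<^sup>* \<or>
    (a, w) \<in> (adjacency (G\<lparr>edges := Z\<rparr>))\<^sup>* \<and> (u, b) \<in> (adjacency (G\<lparr>edges := Z\<rparr>))\<^sup>*"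
  using assms(2)
proof induction
  case base
  then show ?case by simp
next
  case (step b c)
  let ?A = "adjacency (G\<lparr>edges := Z\<rparr>)"
  have "(b, c) \<in> ?A \<or> b = u \<and> c = w \<or> b = w \<and> c = u"
    using step.hyps(2) assms(1) by (auto simp: adjacency_def add_eq_conv_ex)
  then show ?case
  proof (elim disjE)
    assume "(b, c) \<in> ?A"
    then show ?thesis
      using step.IH by (meson rtrancl.rtrancl_into_rtrancl)
  next
    assume "b = u \<and> c = w"
    then show ?thesis
      using step.IH adjacency_rtrancl_sym by blast
  next
    assume "b = w \<and> c = u"
    then show ?thesis
      using step.IH adjacency_rtrancl_sym by blast
  qed
qed

lemma component_insert_eq:
  assumes "ends G e = {#u, w#}" "component (G\<lparr>edges := Z\<rparr>) u = component (G\<lparr>edges := Z\<rparr>) w"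
  shows "component (G\<lparr>edges := insert e Z\<rparr>) v = component (G\<lparr>edges := Z\<rparr>) v"
proof -
  have uw: "(u, w) \<in> (adjacency (G\<lparr>edges := Z\<rparr>))\<^sup>*" "(w, u) \<in> (adjacency (G\<lparr>edges := Z\<rparr>))\<^sup>*"
    using assms(2) component_eq_iff by metis+
  have "component (G\<lparr>edges := insert e Z\<rparr>) v \<subseteq> component (G\<lparr>edges := Z\<rparr>) v"
  proof
    fix x assume "x \<in> component (G\<lparr>edges := insert e Z\<rparr>) v"
    then have "(v, x) \<in> (adjacency (G\<lparr>edges := insert e Z\<rparr>))\<^sup>*"
      by (simp add: component_def)
    then have "(v, x) \<in> (adjacency (G\<lparr>edges := Z\<rparr>))\<^sup>*"
      using adjacency_rtrancl_insert[OF assms(1)] uw by (meson rtrancl_trans)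
    then show "x \<in> component (G\<lparr>edges := Z\<rparr>) v"
      by (simp add: component_def)
  qed
  then show ?thesis
    using component_mono[of Z "insert e Z" G v] by blast
qed

text \<open>A new edge merges at most two components. Sending each component to the larger one
  containing it is thus injective once the component of the end \<open>u\<close> is left
  out.\<close>

lemma card_components_insert:
  assumes "multigraph G" "e \<in> edges G"
  shows "card (component (G\<lparr>edges := Z\<rparr>) ` verts G)
    \<le> card (component (G\<lparr>edges := insert e Z\<rparr>) ` verts G) + 1"
proof -
  let ?q = "component (G\<lparr>edges := Z\<rparr>)" and ?r = "component (G\<lparr>edges := insert e Z\<rparr>)"
  obtain u w where uw: "ends G e = {#u, w#}" "u \<in> verts G" "w \<in> verts G"
    using ends_pair assms by metis
  have fin: "finite (verts G)"
    using assms by (simp add: multigraph_def)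
  define f where "f C = ?r (SOME v. v \<in> C)" for C
  have f: "f (?q v) = ?r v" if "v \<in> verts G" for v
  proof -
    have "(SOME x. x \<in> ?q v) \<in> ?q v"
      using component_self by (rule someI)
    then have "(SOME x. x \<in> ?q v) \<in> ?r v"
      using component_mono[of Z "insert e Z" G v] by blast
    then show ?thesis
      unfolding f_def by (rule component_eq_of_mem)
  qed
  have "inj_on f (?q ` verts G - {?q u})"
  proof (rule inj_onI)
    fix A B assume "A \<in> ?q ` verts G - {?q u}" "B \<in> ?q ` verts G - {?q u}" "f A = f B"
    then obtain a b where AB: "A = ?q a" "B = ?q b" and
      ab: "a \<in> verts G" "b \<in> verts G" "?q a \<noteq> ?q u" "?q b \<noteq> ?q u" "f (?q a) = f (?q b)"
      by blast
    then have "(a, b) \<in> (adjacency (G\<lparr>edges := insert e Z\<rparr>))\<^sup>*"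
      by (simp add: f component_eq_iff)
    then show "A = B"
      unfolding AB using adjacency_rtrancl_insert[OF uw(1)] ab(3,4) by (metis component_eq_iff)
  qed
  moreover have "f ` (?q ` verts G - {?q u}) \<subseteq> ?r ` verts G"
    using f by auto
  ultimately have "card (?q ` verts G - {?q u}) \<le> card (?r ` verts G)"
    using fin by (intro card_inj_on_le) auto
  then show ?thesis
    using fin by (simp add: card_Diff_singleton_if split: if_splits)
qed

lemma graph_rank_insert:
  assumes "multigraph G" "e \<in> edges G" "finite Z" "e \<notin> Z"
  shows "graph_rank (G\<lparr>edges := Z\<rparr>) \<le> graph_rank (G\<lparr>edges := insert e Z\<rparr>)"
  using card_components_insert[OF assms(1,2), of Z] assms(3,4) by (simp add: graph_rank_def)

lemma graph_rank_mono:
  assumes "multigraph G" "Z \<subseteq> Y" "Y \<subseteq> edges G"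
  shows "graph_rank (G\<lparr>edges := Z\<rparr>) \<le> graph_rank (G\<lparr>edges := Y\<rparr>)"
proof -
  have fin: "finite (edges G)"
    using assms by (simp add: multigraph_def)
  have "finite (Y - Z)"
    using fin assms by (auto intro: finite_subset)
  moreover have "Y - Z \<subseteq> edges G - Z"
    using assms by auto
  ultimately have "graph_rank (G\<lparr>edges := Z\<rparr>) \<le> graph_rank (G\<lparr>edges := Z \<union> (Y - Z)\<rparr>)"
  proof (induction rule: finite_subset_induct')
    case empty
    then show ?case by simp
  next
    case (insert e F)
    have "graph_rank (G\<lparr>edges := Z \<union> F\<rparr>) \<le> graph_rank (G\<lparr>edges := insert e (Z \<union> F)\<rparr>)"
      using insert assms fin by (intro graph_rank_insert) (auto intro: finite_subset)
    with insert show ?case by simp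
  qed
  moreover have "Z \<union> (Y - Z) = Y"
    using assms by auto
  ultimately show ?thesis by simp
qed

lemma graph_rank_no_edges:
  assumes "multigraph G"
  shows "graph_rank (G\<lparr>edges := {}\<rparr>) = 0"
proof -
  have "component (G\<lparr>edges := {}\<rparr>) v = {v}" for v
    by (simp add: component_def adjacency_def)
  moreover have "card ((\<lambda>v. {v}) ` verts G) = card (verts G)"
    by (intro card_image) auto
  ultimately show ?thesis
    by (simp add: graph_rank_def)
qed

lemma component_connected:
  assumes "multigraph G" "connected_graph (G\<lparr>edges := Z\<rparr>)" "Z \<subseteq> edges G" "v \<in> verts G"
  shows "component (G\<lparr>edges := Z\<rparr>) v = verts G"
proof
  show "component (G\<lparr>edges := Z\<rparr>) v \<subseteq> verts G"
    by (rule component_subset_verts) (use assms in auto)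
  show "verts G \<subseteq> component (G\<lparr>edges := Z\<rparr>) v"
    using assms by (auto simp: connected_graph_def component_def)
qed

lemma graph_rank_connected:
  assumes "multigraph G" "connected_graph (G\<lparr>edges := Z\<rparr>)" "Z \<subseteq> edges G"
  shows "graph_rank (G\<lparr>edges := Z\<rparr>) = int (card Z) - int (card (verts G)) + 1"
proof -
  have "component (G\<lparr>edges := Z\<rparr>) ` verts G = {verts G}"
    using component_connected[OF assms] assms(1) by (auto simp: multigraph_def)
  then show ?thesis
    by (simp add: graph_rank_def)
qed

lemma one_loop_graphsD:
  assumes "G \<in> one_loop_graphs s"
  shows "multigraph G" "finite (edges G)" "finite (verts G)" "nlegs G = s"
    "connected_graph (G\<lparr>edges := edges G\<rparr>)"
    "\<And>e. e \<in> edges G \<Longrightarrow> connected_graph (G\<lparr>edges := edges G - {e}\<rparr>)"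
    "\<And>v. v \<in> verts G \<Longrightarrow> 3 \<le> valency G v"
    "card (edges G) = card (verts G)" "edges G \<noteq> {}"
proof -
  have m: "multigraph G" and c: "connected_graph G" and r: "graph_rank G = 1"
    using assms by (auto simp: one_loop_graphs_def admissible_def)
  show "card (edges G) = card (verts G)"
    using graph_rank_connected[of G "edges G"] m c r by simp
  with m show "edges G \<noteq> {}"
    by (auto simp: multigraph_def)
qed (use assms in \<open>auto simp: one_loop_graphs_def admissible_def multigraph_def\<close>)

text \<open>Removing a single edge keeps the graph connected and lowers the rank to zero. By
  monotonicity the rank of \<open>Z\<close> lies between that of the empty edge set and that of such
  a complement, both zero.\<close>

lemma one_loop_graph_forest:
  assumes G: "G \<in> one_loop_graphs s" and Z: "Z \<subset> edges G"
  shows "forest G Z"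
proof -
  note D = one_loop_graphsD[OF G]
  obtain e where e: "e \<in> edges G" "e \<notin> Z"
    using Z by blast
  have "graph_rank (G\<lparr>edges := edges G - {e}\<rparr>) = 0"
    using graph_rank_connected[OF D(1) D(6)[OF e(1)]] e D(2,8)
      card_gt_0_iff[of "edges G"] by (auto simp: of_nat_diff card_Diff_singleton)
  moreover have "graph_rank (G\<lparr>edges := Z\<rparr>) \<le> graph_rank (G\<lparr>edges := edges G - {e}\<rparr>)"
    using D e Z by (intro graph_rank_mono) auto
  moreover have "graph_rank (G\<lparr>edges := {}\<rparr>) \<le> graph_rank (G\<lparr>edges := Z\<rparr>)"
    using D Z by (intro graph_rank_mono) auto
  ultimately show ?thesis
    using graph_rank_no_edges[OF D(1)] Z by (simp add: forest_def)
qed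

lemma regular_metrics_one_loop:
  assumes "G \<in> one_loop_graphs s"
  shows "l \<in> regular_metrics G \<longleftrightarrow> l \<in> edges G \<rightarrow>\<^sub>E {0..} \<and> (\<exists>e\<in>edges G. l e > 0)"
proof (cases "l \<in> edges G \<rightarrow>\<^sub>E {0..}")
  case True
  have "forest G (zero_edges G l) \<longleftrightarrow> (\<exists>e\<in>edges G. l e > 0)"
  proof
    assume f: "forest G (zero_edges G l)"
    show "\<exists>e\<in>edges G. l e > 0"
    proof (rule ccontr)
      assume "\<not> ?thesis"
      then have "zero_edges G l = edges G"
        using True by (force simp: zero_edges_def)
      then show False
        using f assms by (simp add: forest_def one_loop_graphs_def)
    qed
  next
    assume "\<exists>e\<in>edges G. l e > 0"
    then obtain e where "e \<in> edges G" "l e > 0" ..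
    then show "forest G (zero_edges G l)"
      by (intro one_loop_graph_forest[OF assms]) (force simp: zero_edges_def)
  qed
  then show ?thesis
    using True by (simp add: regular_metrics_def)
qed (simp add: regular_metrics_def)

section \<open>Vertex degrees: every one-loop graph is a cycle with legs\<close>

lemma ex_incident_edge:
  assumes "connected_graph G" "u \<in> verts G" "v \<in> verts G" "u \<noteq> v"
  shows "\<exists>e\<in>edges G. v \<in># ends G e"
proof -
  have "(v, u) \<in> (adjacency G)\<^sup>*"
    using assms by (simp add: connected_graph_def)
  then obtain w where "(v, w) \<in> adjacency G"
    using assms(4) by (metis converse_rtranclE)
  then obtain e where "e \<in> edges G" "ends G e = {#v, w#}"
    by (auto simp: adjacency_def)
  then show ?thesis
    by (intro bexI[of _ e]) auto
qed

text \<open>If \<open>v\<close> is the only vertex, every edge is a loop and counts twice. Otherwise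
  \<open>v\<close> meets an edge \<open>e\<close>, and since the graph without \<open>e\<close> is
  still connected, \<open>v\<close> meets a second one.\<close>

lemma degree_ge_2:
  assumes G: "G \<in> one_loop_graphs s" and v: "v \<in> verts G"
  shows "2 \<le> (\<Sum>e\<in>edges G. count (ends G e) v)"
proof (cases "verts G = {v}")
  case True
  have "count (ends G e) v = 2" if "e \<in> edges G" for e
  proof -
    have "size (ends G e) = 2" "set_mset (ends G e) \<subseteq> {v}"
      using one_loop_graphsD(1)[OF G] True that by (auto simp: multigraph_def)
    then have "ends G e = replicate_mset 2 v"
      using set_mset_subset_singletonD by metis
    then show ?thesis by simp
  qed
  then have "(\<Sum>e\<in>edges G. count (ends G e) v) = (\<Sum>e\<in>edges G. 2)"
    by simp
  moreover have "card (edges G) \<noteq> 0"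
    using one_loop_graphsD(2,9)[OF G] by simp
  ultimately show ?thesis
    by simp
next
  case False
  then obtain u where u: "u \<in> verts G" "u \<noteq> v"
    using v by auto
  note D = one_loop_graphsD[OF G]
  obtain e where e: "e \<in> edges G" "v \<in># ends G e"
    using ex_incident_edge[of "G\<lparr>edges := edges G\<rparr>" u v] D u v by auto
  obtain d where d: "d \<in> edges G" "d \<noteq> e" "v \<in># ends G d"
    using ex_incident_edge[of "G\<lparr>edges := edges G - {e}\<rparr>" u v] D(6)[OF e(1)] u v by auto
  have "2 \<le> count (ends G e) v + count (ends G d) v"
  proof -
    have "1 \<le> count (ends G e) v" "1 \<le> count (ends G d) v"
      using e d by simp_all
    then show ?thesis by linarith
  qed
  also have "\<dots> = (\<Sum>e\<in>{e, d}. count (ends G e) v)"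
    using d by simp
  also have "\<dots> \<le> (\<Sum>e\<in>edges G. count (ends G e) v)"
    using D e d by (intro sum_mono2) auto
  finally show ?thesis .
qed

text \<open>The degrees add up to twice the number of edges, which in rank one is twice the number
  of vertices. A lower bound of 2 everywhere is then an equality everywhere.\<close>

lemma degree_eq_2:
  assumes G: "G \<in> one_loop_graphs s" and v: "v \<in> verts G"
  shows "(\<Sum>e\<in>edges G. count (ends G e) v) = 2"
proof -
  note D = one_loop_graphsD[OF G]
  have "(\<Sum>v\<in>verts G. \<Sum>e\<in>edges G. count (ends G e) v) = (\<Sum>e\<in>edges G. \<Sum>v\<in>verts G. count (ends G e) v)"
    by (rule sum.swap)
  also have "\<dots> = (\<Sum>e\<in>edges G. 2)"
  proof (rule sum.cong)
    fix e assume "e \<in> edges G"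
    then have e: "set_mset (ends G e) \<subseteq> verts G" "size (ends G e) = 2"
      using D by (auto simp: multigraph_def)
    have "(\<Sum>v\<in>set_mset (ends G e). count (ends G e) v) = (\<Sum>v\<in>verts G. count (ends G e) v)"
      using D(3) e(1) by (intro sum.mono_neutral_left) (auto simp: not_in_iff)
    then show "(\<Sum>v\<in>verts G. count (ends G e) v) = 2"
      using e(2) by (simp add: size_multiset_overloaded_eq)
  qed simp
  also have "\<dots> = (\<Sum>v\<in>verts G. 2)"
    using D by simp
  finally have "(\<Sum>v\<in>verts G. 2) = (\<Sum>v\<in>verts G. \<Sum>e\<in>edges G. count (ends G e) v)"
    by simp
  then have "2 = (\<Sum>e\<in>edges G. count (ends G e) v)"
    by (rule sum_mono_inv) (use degree_ge_2[OF G] v D(3) in auto)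
  then show ?thesis by simp
qed

text \<open>Valency 3 exceeds the contribution 2 of the internal edges. This is what makes both
  parts of a partition of the legs nonempty later on.\<close>

lemma vertex_has_leg:
  assumes G: "G \<in> one_loop_graphs s" and v: "v \<in> verts G"
  obtains i where "i \<in> {1..s}" "leg G i = v"
proof -
  have "3 \<le> valency G v"
    using one_loop_graphsD(7)[OF G v] .
  then have "card {i \<in> {1..nlegs G}. leg G i = v} \<noteq> 0"
    unfolding valency_def degree_eq_2[OF G v] by linarith
  then have "{i \<in> {1..nlegs G}. leg G i = v} \<noteq> {}"
    by (metis card.empty)
  then show ?thesis
    using that one_loop_graphsD(4)[OF G] by blast
qed

section \<open>Iterated contractions and points of the moduli space\<close>

lemma multigraph_contract:
  assumes "multigraph G"
  shows "multigraph (contract G Z)"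
  using assms by (auto simp: multigraph_def)

lemma component_contract:
  assumes G: "multigraph G" and Z: "Z \<subseteq> edges G" and Y: "Y \<subseteq> edges G - Z" and v: "v \<in> verts G"
  shows "component (contract G Z\<lparr>edges := Y\<rparr>) (component (G\<lparr>edges := Z\<rparr>) v) =
    component (G\<lparr>edges := Z\<rparr>) ` component (G\<lparr>edges := Z \<union> Y\<rparr>) v"
proof -
  let ?q = "component (G\<lparr>edges := Z\<rparr>)"
  let ?A = "adjacency (G\<lparr>edges := Z \<union> Y\<rparr>)" and ?B = "adjacency (contract G Z\<lparr>edges := Y\<rparr>)"
  have q_le: "(a, b) \<in> ?A\<^sup>*" if "?q a = ?q b" for a b
  proof -
    have "(a, b) \<in> (adjacency (G\<lparr>edges := Z\<rparr>))\<^sup>*"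
      using that by (rule component_eq_iff[THEN iffD1])
    then show ?thesis
      using rtrancl_mono[OF adjacency_mono[of Z "Z \<union> Y" G]] by blast
  qed
  have 1: "\<exists>w. C = ?q w \<and> (v, w) \<in> ?A\<^sup>*" if "(?q v, C) \<in> ?B\<^sup>*" for C
    using that
  proof induction
    case base
    then show ?case by blast
  next
    case (step C D)
    obtain w where w: "C = ?q w" "(v, w) \<in> ?A\<^sup>*"
      using step.IH by blast
    obtain e where e: "e \<in> Y" "image_mset ?q (ends G e) = {#C, D#}"
      using step.hyps(2) by (auto simp: adjacency_def)
    obtain a N where a: "ends G e = add_mset a N" "?q a = C" "image_mset ?q N = {#D#}"
      using msed_map_invR[OF e(2)] by blast
    obtain b where b: "N = {#b#}" "?q b = D"
      using msed_map_invR[OF a(3)] by auto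
    have "(w, a) \<in> ?A\<^sup>*"
      using w a by (intro q_le) simp
    moreover have "(a, b) \<in> ?A"
      using e(1) a b by (auto simp: adjacency_def)
    ultimately have "(v, b) \<in> ?A\<^sup>*"
      using w(2) by (meson rtrancl.rtrancl_into_rtrancl rtrancl_trans)
    then show ?case
      using b by blast
  qed
  have 2: "(?q v, ?q w) \<in> ?B\<^sup>*" if "(v, w) \<in> ?A\<^sup>*" for w
    using that
  proof induction
    case base
    then show ?case by simp
  next
    case (step a b)
    obtain e where e: "e \<in> Z \<union> Y" "ends G e = {#a, b#}"
      using step.hyps(2) by (auto simp: adjacency_def)
    show ?case
    proof (cases "e \<in> Z")
      case True
      then have "(a, b) \<in> adjacency (G\<lparr>edges := Z\<rparr>)"
        using e by (auto simp: adjacency_def)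
      then have "?q a = ?q b"
        by (intro component_eq_iff[THEN iffD2] r_into_rtrancl)
      then show ?thesis
        using step.IH by simp
    next
      case False
      then have "(?q a, ?q b) \<in> ?B"
        using e by (auto simp: adjacency_def intro!: bexI[of _ e])
      then show ?thesis
        using step.IH by (meson rtrancl.rtrancl_into_rtrancl)
    qed
  qed
  show ?thesis
    using 1 2 by (auto simp: component_def[of "contract G Z\<lparr>edges := Y\<rparr>"]
        component_def[of "G\<lparr>edges := Z \<union> Y\<rparr>"])
qed

lemma Union_image_component:
  assumes "Z \<subseteq> Y"
  shows "\<Union>(component (G\<lparr>edges := Z\<rparr>) ` component (G\<lparr>edges := Y\<rparr>) v) = component (G\<lparr>edges := Y\<rparr>) v"
proof
  show "component (G\<lparr>edges := Y\<rparr>) v \<subseteq> \<Union>(component (G\<lparr>edges := Z\<rparr>) ` component (G\<lparr>edges := Y\<rparr>) v)"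
    using component_self by fast
  have "component (G\<lparr>edges := Z\<rparr>) w \<subseteq> component (G\<lparr>edges := Y\<rparr>) v"
    if "w \<in> component (G\<lparr>edges := Y\<rparr>) v" for w
    using component_mono[OF assms, of G w] component_eq_of_mem[OF that] by simp
  then show "\<Union>(component (G\<lparr>edges := Z\<rparr>) ` component (G\<lparr>edges := Y\<rparr>) v) \<subseteq> component (G\<lparr>edges := Y\<rparr>) v"
    by blast
qed

text \<open>Vertices of the iterated contraction are sets of components, hence sets of sets.
  \<open>Union\<close> flattens them, and cutting a component of \<open>Z \<union> Y\<close> into
  its \<open>Z\<close>-components is the inverse.\<close>

lemma graph_iso_contract_contract:
  assumes G: "multigraph G" and Z: "Z \<subseteq> edges G" and Y: "Y \<subseteq> edges G - Z"
  shows "graph_iso (contract (contract G Z) Y) (contract G (Z \<union> Y)) Union (\<lambda>e. e)"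
    and "graph_iso (contract G (Z \<union> Y)) (contract (contract G Z) Y)
      ((`) (component (G\<lparr>edges := Z\<rparr>))) (\<lambda>e. e)"
proof -
  let ?q = "component (G\<lparr>edges := Z\<rparr>)" and ?r = "component (G\<lparr>edges := Z \<union> Y\<rparr>)"
  let ?p = "component (contract G Z\<lparr>edges := Y\<rparr>)"
  have p: "?p (?q v) = ?q ` ?r v" if "v \<in> verts G" for v
    using component_contract[OF G Z Y that] .
  have U: "\<Union>(?q ` ?r v) = ?r v" for v
    by (rule Union_image_component) simp
  have verts: "?p ` ?q ` verts G = (`) ?q ` ?r ` verts G"
    using p by (auto simp: image_image)
  have ends: "set_mset (ends G e) \<subseteq> verts G" if "e \<in> edges G" for e
    using G that by (auto simp: multigraph_def)
  have legs: "leg G i \<in> verts G" if "i \<in> {1..nlegs G}" for i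
    using G that by (auto simp: multigraph_def)
  have inj: "inj_on ((`) ?q) (?r ` verts G)"
    by (rule inj_on_inverseI[where g = Union]) (use U in auto)
  have bij: "bij_betw ((`) ?q) (?r ` verts G) (?p ` ?q ` verts G)"
    using inj by (simp add: bij_betw_def verts)
  have E: "edges G - Z - Y = edges G - (Z \<union> Y)" "bij_betw (\<lambda>e. e) (edges G - (Z \<union> Y)) (edges G - (Z \<union> Y))"
    by (auto simp: bij_betw_def)
  have Uim: "Union ` (`) ?q ` ?r ` verts G = ?r ` verts G"
    by (simp add: image_image U)
  have "inj_on Union ((`) ?q ` ?r ` verts G)"
    by (rule inj_on_inverseI[where g = "(`) ?q"]) (use U in auto)
  then have "bij_betw Union (?p ` ?q ` verts G) (?r ` verts G)"
    unfolding verts bij_betw_def using Uim by blast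
  moreover have "image_mset ?r (ends G e) = image_mset Union (image_mset ?p (image_mset ?q (ends G e)))"
    if "e \<in> edges G" for e
    using ends[OF that] p U by (auto simp: multiset.map_comp intro!: image_mset_cong)
  ultimately show "graph_iso (contract (contract G Z) Y) (contract G (Z \<union> Y)) Union (\<lambda>e. e)"
    using p U legs E by (auto simp: graph_iso_def)
  have "image_mset ?p (image_mset ?q (ends G e)) = image_mset ((`) ?q) (image_mset ?r (ends G e))"
    if "e \<in> edges G" for e
    using ends[OF that] p by (auto simp: multiset.map_comp intro!: image_mset_cong)
  then show "graph_iso (contract G (Z \<union> Y)) (contract (contract G Z) Y) ((`) ?q) (\<lambda>e. e)"
    using bij p legs E by (auto simp: graph_iso_def)
qed

text \<open>Isomorphic contractions stay isomorphic when corresponding edges are contracted further.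
  The action on edges, which alone matters for lengths and colors, remains \<open>\<psi>\<close>;
  only the action on vertices changes.\<close>

lemma graph_iso_contract_extend:
  assumes G: "multigraph G" and H: "multigraph H" and Z: "Z \<subseteq> edges G" and W: "W \<subseteq> edges H"
    and iso: "graph_iso (contract G Z) (contract H W) \<phi> \<psi>" and Y: "Y \<subseteq> edges G - Z"
  shows "\<exists>\<phi>'. graph_iso (contract G (Z \<union> Y)) (contract H (W \<union> \<psi> ` Y)) \<phi>' \<psi>"
proof -
  have "\<psi> ` (edges G - Z) = edges H - W"
    using iso by (simp add: graph_iso_def bij_betw_def)
  then have "\<psi> ` Y \<subseteq> edges H - W"
    using Y by blast
  then have 1: "graph_iso (contract (contract H W) (\<psi> ` Y)) (contract H (W \<union> \<psi> ` Y)) Union (\<lambda>e. e)"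
    using H W by (intro graph_iso_contract_contract)
  have 2: "graph_iso (contract (contract G Z) Y) (contract (contract H W) (\<psi> ` Y)) ((`) \<phi>) \<psi>"
    using G H iso Y by (intro graph_iso_contract multigraph_contract) auto
  have "graph_iso (contract G (Z \<union> Y)) (contract (contract G Z) Y)
      ((`) (component (G\<lparr>edges := Z\<rparr>))) (\<lambda>e. e)"
    using G Z Y by (intro graph_iso_contract_contract)
  from graph_iso_trans[OF graph_iso_trans[OF this 2] 1] show ?thesis
    by (auto simp: comp_def)
qed

section \<open>Points of the moduli space from unnormalized edge lengths\<close>

definition weighting :: "('v, 'e) legged_graph \<Rightarrow> ('e \<Rightarrow> real) \<Rightarrow> bool" where
  "weighting G l \<longleftrightarrow> (\<forall>e\<in>edges G. 0 \<le> l e) \<and> (\<exists>e\<in>edges G. 0 < l e)"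

lemma restrict_regular_metrics:
  assumes "G \<in> one_loop_graphs s"
  shows "restrict l (edges G) \<in> regular_metrics G \<longleftrightarrow> weighting G l"
  using regular_metrics_one_loop[OF assms] by (auto simp: weighting_def)

lemma zero_edges_restrict [simp]: "zero_edges G (restrict l (edges G)) = zero_edges G l"
  by (auto simp: zero_edges_def)

lemma colored_graphsD:
  assumes "(G, c) \<in> colored_graphs s m"
  shows "G \<in> one_loop_graphs s" "c \<in> edges G \<rightarrow>\<^sub>E {1..m}" "multigraph G" "finite (edges G)"
    "nlegs G = s"
  using assms by (auto simp: colored_graphs_def colorings_def one_loop_graphs_def multigraph_def)

text \<open>The restriction allows \<open>l\<close> to be any function that is a weighting on the
  edges, extensional or not, and the total length is arbitrary. Convex combinations can thus be
  written down directly.\<close>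

definition point :: "nat \<Rightarrow> nat \<Rightarrow> lgraph \<Rightarrow> (nat \<Rightarrow> nat) \<Rightarrow> (nat \<Rightarrow> real) \<Rightarrow> metric_graph set" where
  "point s m G c l = metric_graph_rel s m `` {(G, restrict l (edges G), c)}"

lemma restrict_metric_graphs:
  assumes "(G, c) \<in> colored_graphs s m"
  shows "(G, restrict l (edges G), c) \<in> metric_graphs s m \<longleftrightarrow> weighting G l"
  using assms restrict_regular_metrics[of G s l] by (auto simp: colored_graphs_def metric_graphs_def)

lemma point_in_topspace:
  assumes "(G, c) \<in> colored_graphs s m" "weighting G l"
  shows "point s m G c l \<in> topspace (MCG1 s m)"
  unfolding point_def topspace_MCG1 using restrict_metric_graphs[OF assms(1)] assms(2)
  by (blast intro: quotientI)

lemma point_cases: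
  assumes "x \<in> topspace (MCG1 s m)"
  obtains G c l where "(G, c) \<in> colored_graphs s m" "weighting G l" "x = point s m G c l"
proof -
  obtain G l c where Glc: "(G, l, c) \<in> metric_graphs s m" and x: "x = metric_graph_rel s m `` {(G, l, c)}"
    using assms unfolding topspace_MCG1 by (auto elim!: quotientE)
  have G: "(G, c) \<in> colored_graphs s m" and l: "l \<in> regular_metrics G"
    using Glc by (auto simp: metric_graphs_def colored_graphs_def)
  then have "restrict l (edges G) = l"
    by (auto simp: regular_metrics_def PiE_def extensional_restrict)
  then show ?thesis
    using that[of G c l] G Glc x restrict_metric_graphs[OF G, of l] by (simp add: point_def)
qed

lemma point_eq_iff:
  assumes G: "(G, c) \<in> colored_graphs s m" "weighting G l"
    and H: "(H, d) \<in> colored_graphs s m" "weighting H k"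
  shows "point s m G c l = point s m H d k \<longleftrightarrow>
    (\<exists>\<phi> \<psi> a. a > 0 \<and> graph_iso (contract G (zero_edges G l)) (contract H (zero_edges H k)) \<phi> \<psi> \<and>
      (\<forall>e\<in>edges G - zero_edges G l. k (\<psi> e) = a * l e \<and> d (\<psi> e) = c e))"
    (is "_ \<longleftrightarrow> ?R")
proof -
  have mem: "(G, restrict l (edges G), c) \<in> metric_graphs s m" "(H, restrict k (edges H), d) \<in> metric_graphs s m"
    using assms restrict_metric_graphs by blast+
  have "\<psi> e \<in> edges H" if "graph_iso (contract G Z) (contract H W) \<phi> \<psi>" "e \<in> edges G" "e \<notin> Z" for Z W \<phi> \<psi> e
    using that by (auto simp: graph_iso_def bij_betw_def)
  then have *: "(\<forall>e\<in>edges G - Z. restrict k (edges H) (\<psi> e) = a * restrict l (edges G) e \<and> d (\<psi> e) = c e)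
      \<longleftrightarrow> (\<forall>e\<in>edges G - Z. k (\<psi> e) = a * l e \<and> d (\<psi> e) = c e)"
    if "graph_iso (contract G Z) (contract H W) \<phi> \<psi>" for Z W a \<phi> \<psi>
    using that by auto
  have "point s m G c l = point s m H d k \<longleftrightarrow>
      ((G, restrict l (edges G), c), (H, restrict k (edges H), d)) \<in> metric_graph_rel s m"
    unfolding point_def by (rule eq_equiv_class_iff[OF equiv_metric_graph_rel mem])
  also have "\<dots> \<longleftrightarrow> ?R"
    unfolding metric_graph_rel_def using mem *
    by (simp del: restrict_apply) blast
  finally show ?thesis .
qed

text \<open>\<open>Z\<close> and \<open>W\<close> may be smaller than the zero sets: the remaining
  zero edges correspond under \<open>\<psi>\<close> and are contracted afterwards. So one
  isomorphism serves a whole family of weightings, including the degenerate ones at the ends of a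
  segment.\<close>

lemma point_eqI:
  assumes G: "(G, c) \<in> colored_graphs s m" and H: "(H, d) \<in> colored_graphs s m"
    and Z: "Z \<subseteq> edges G" and W: "W \<subseteq> edges H"
    and iso: "graph_iso (contract G Z) (contract H W) \<phi> \<psi>"
    and col: "\<And>e. e \<in> edges G - Z \<Longrightarrow> d (\<psi> e) = c e"
    and l: "weighting G l" "\<And>e. e \<in> Z \<Longrightarrow> l e = 0"
    and k: "\<And>e. e \<in> W \<Longrightarrow> k e = 0"
    and a: "a > 0" "\<And>e. e \<in> edges G - Z \<Longrightarrow> k (\<psi> e) = a * l e"
  shows "point s m G c l = point s m H d k"
proof -
  have bij: "bij_betw \<psi> (edges G - Z) (edges H - W)"
    using iso by (simp add: graph_iso_def)
  define Y where "Y = {e \<in> edges G - Z. l e = 0}"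
  have kW: "k e = 0 \<longleftrightarrow> e \<in> W \<union> \<psi> ` Y" if e: "e \<in> edges H" for e
  proof (cases "e \<in> W")
    case False
    then obtain b where b: "b \<in> edges G - Z" "e = \<psi> b"
      using bij e by (auto simp: bij_betw_def)
    then have "e \<in> \<psi> ` Y \<longleftrightarrow> b \<in> Y"
      using bij by (auto simp: bij_betw_def Y_def dest: inj_onD)
    then show ?thesis
      using a b False by (auto simp: Y_def)
  qed (use k in auto)
  have "\<psi> ` Y \<subseteq> edges H"
    using bij by (auto simp: bij_betw_def Y_def)
  then have zH: "zero_edges H k = W \<union> \<psi> ` Y"
    using kW W by (auto simp: zero_edges_def)
  have zG: "zero_edges G l = Z \<union> Y"
    using Z l by (auto simp: zero_edges_def Y_def)
  have "weighting H k"
    unfolding weighting_def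
  proof
    show "\<forall>e\<in>edges H. 0 \<le> k e"
    proof
      fix e assume e: "e \<in> edges H"
      show "0 \<le> k e"
      proof (cases "e \<in> W")
        case False
        then obtain b where b: "b \<in> edges G - Z" "e = \<psi> b"
          using bij e by (auto simp: bij_betw_def)
        then show ?thesis
          using a l(1) by (auto simp: weighting_def)
      qed (use k in auto)
    qed
    obtain b where b: "b \<in> edges G" "l b > 0"
      using l(1) by (auto simp: weighting_def)
    then have "b \<in> edges G - Z"
      using l(2) by fastforce
    then show "\<exists>e\<in>edges H. 0 < k e"
      using a b bij by (intro bexI[of _ "\<psi> b"]) (auto simp: bij_betw_def)
  qed
  moreover have "\<exists>\<phi>'. graph_iso (contract G (Z \<union> Y)) (contract H (W \<union> \<psi> ` Y)) \<phi>' \<psi>"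
    using G H Z W iso by (intro graph_iso_contract_extend) (auto dest: colored_graphsD simp: Y_def)
  ultimately show ?thesis
    using point_eq_iff[OF G l(1) H, of k] a col unfolding zG zH by (auto 4 4)
qed

section \<open>Contractible open stars\<close>

lemma continuous_map_from_sum_topology:
  assumes "\<And>i. i \<in> I \<Longrightarrow> continuous_map (X i) Y (\<lambda>x. f (i, x))"
  shows "continuous_map (sum_topology X I) Y f"
  unfolding continuous_map_def
proof (intro conjI allI impI)
  show "f \<in> topspace (sum_topology X I) \<rightarrow> topspace Y"
    using assms by (fastforce simp: continuous_map_def)
  fix U assume U: "openin Y U"
  have "openin (X i) {x. (i, x) \<in> {z \<in> topspace (sum_topology X I). f z \<in> U}}" if i: "i \<in> I" for i
  proof -
    have "{x. (i, x) \<in> {z \<in> topspace (sum_topology X I). f z \<in> U}} = {x \<in> topspace (X i). f (i, x) \<in> U}"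
      using i by auto
    then show ?thesis
      using assms[OF i] U by (simp add: continuous_map_def)
  qed
  then show "openin (sum_topology X I) {z \<in> topspace (sum_topology X I). f z \<in> U}"
    by (auto simp: openin_sum_topology)
qed

lemma continuous_map_edge_length: "continuous_map (cell_sum s m) euclideanreal (\<lambda>x. snd x e)"
  unfolding cell_sum_def
proof (rule continuous_map_from_sum_topology)
  fix i assume "i \<in> cells s m"
  obtain G c where i: "i = (G, c)"
    by (cases i)
  have "continuous_map (length_simplex G) euclideanreal (\<lambda>l. l e)"
  proof (cases "e \<in> edges G")
    case True
    then show ?thesis
      unfolding length_simplex_def
      by (intro continuous_map_from_subtopology continuous_map_product_projection)
  next
    case False
    \<comment> \<open>Metrics are extensional, so the coordinate of a non-edge is constantly
      \<open>undefined\<close>.\<close>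
    have "continuous_map (length_simplex G) euclideanreal (\<lambda>_. undefined)"
      by simp
    then show ?thesis
      by (rule continuous_map_eq) (use False in \<open>auto simp: length_simplex_def\<close>)
  qed
  then show "continuous_map (case i of (G, c) \<Rightarrow> length_simplex G) euclideanreal (\<lambda>x. snd (i, x) e)"
    by (simp add: i)
qed

lemma point_cong:
  assumes "\<And>e. e \<in> edges G \<Longrightarrow> l e = k e"
  shows "point s m G c l = point s m G c k"
proof -
  have "restrict l (edges G) = restrict k (edges G)"
    using assms by auto
  then show ?thesis
    by (simp add: point_def)
qed

lemma weighting_cong:
  assumes "\<And>e. e \<in> edges G \<Longrightarrow> l e = k e"
  shows "weighting G l \<longleftrightarrow> weighting G k"
  using assms by (simp add: weighting_def)

lemma weighting_sum_pos:
  assumes "weighting G l" "finite (edges G)"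
  shows "0 < sum l (edges G)"
  using assms by (auto simp: weighting_def intro: sum_pos2)

lemma topspace_cell_sumD:
  assumes "((G, c), l) \<in> topspace (cell_sum s m)"
  shows "(G, c) \<in> colored_graphs s m" "weighting G l" "sum l (edges G) = 1"
    "cell_map s m ((G, c), l) = point s m G c l"
proof -
  show G: "(G, c) \<in> colored_graphs s m"
    using assms cells_subset by (auto simp: topspace_cell_sum)
  have l: "l \<in> regular_metrics G"
    using assms by (auto simp: topspace_cell_sum)
  then have r: "restrict l (edges G) = l"
    by (auto simp: regular_metrics_def PiE_def extensional_restrict)
  then show "weighting G l"
    using restrict_regular_metrics[OF colored_graphsD(1)[OF G], of l] l by simp
  show "sum l (edges G) = 1"
    using assms by (auto simp: topspace_cell_sum)
  show "cell_map s m ((G, c), l) = point s m G c l"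
    by (simp add: cell_map_def point_def r)
qed

text \<open>The topology only knows the chosen cells and metrics of total length 1. The map is
  lifted to the cell representing \<open>(G, c)\<close> by an isomorphism and by division by the
  total length, which is continuous and positive.\<close>

lemma continuous_map_point:
  assumes G: "(G, c) \<in> colored_graphs s m"
    and w: "\<And>x. x \<in> topspace T \<Longrightarrow> weighting G (l x)"
    and cont: "\<And>e. e \<in> edges G \<Longrightarrow> continuous_map T euclideanreal (\<lambda>x. l x e)"
  shows "continuous_map T (MCG1 s m) (\<lambda>x. point s m G c (l x))"
proof -
  obtain H d where H: "(H, d) \<in> cells s m" and rel: "((H, d), (G, c)) \<in> colored_graph_rel s m"
    using ex_cell[OF G] by (metis prod.exhaust)
  have Hc: "(H, d) \<in> colored_graphs s m"
    using H cells_subset by blast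
  obtain f g where iso: "graph_iso H G f g" and d: "\<And>e. e \<in> edges H \<Longrightarrow> c (g e) = d e"
    using rel by (auto simp: colored_graph_rel_def)
  have g: "bij_betw g (edges H) (edges G)"
    using iso by (simp add: graph_iso_def)
  have ge: "g e \<in> edges G" if "e \<in> edges H" for e
    using g that by (auto simp: bij_betw_def)
  note finG = colored_graphsD(4)[OF G]
  define L where "L x = (\<Sum>e\<in>edges G. l x e)" for x
  define \<mu> where "\<mu> x = (\<lambda>e\<in>edges H. l x (g e) / L x)" for x
  have L: "L x > 0" if "x \<in> topspace T" for x
    unfolding L_def using w[OF that] finG by (rule weighting_sum_pos)
  have wH: "weighting H (\<lambda>e. l x (g e) / L x)" if x: "x \<in> topspace T" for x
  proof -
    obtain e' where "e' \<in> edges G" "l x e' > 0"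
      using w[OF x] by (auto simp: weighting_def)
    moreover from this(1) obtain e where "e \<in> edges H" "e' = g e"
      using g by (auto simp: bij_betw_def)
    ultimately have "e \<in> edges H" "l x (g e) > 0"
      by simp_all
    then have "0 < l x (g e) / L x"
      using L[OF x] by simp
    moreover have "\<forall>e\<in>edges H. 0 \<le> l x (g e) / L x"
      using L[OF x] w[OF x] ge by (simp add: weighting_def)
    ultimately show ?thesis
      using \<open>e \<in> edges H\<close> by (auto simp: weighting_def)
  qed
  have top: "((H, d), \<mu> x) \<in> topspace (cell_sum s m)" if x: "x \<in> topspace T" for x
  proof -
    have "(\<Sum>e\<in>edges H. l x (g e)) = L x"
      using g unfolding L_def by (rule sum.reindex_bij_betw)
    then have "(\<Sum>e\<in>edges H. \<mu> x e) = 1"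
      using L[OF x] by (simp add: \<mu>_def flip: sum_divide_distrib)
    moreover have "\<mu> x \<in> regular_metrics H"
      unfolding \<mu>_def restrict_regular_metrics[OF colored_graphsD(1)[OF Hc]] by (rule wH[OF x])
    ultimately show ?thesis
      using H by (simp add: topspace_cell_sum)
  qed
  have eq: "cell_map s m ((H, d), \<mu> x) = point s m G c (l x)" if x: "x \<in> topspace T" for x
  proof -
    have iso': "graph_iso (contract H {}) (contract G {}) ((`) f) g"
      using graph_iso_contract(1)[OF colored_graphsD(3)[OF Hc] colored_graphsD(3)[OF G] iso, of "{}"]
      by simp
    have "point s m H d (\<lambda>e. l x (g e) / L x) = point s m G c (l x)"
      by (rule point_eqI[OF Hc G _ _ iso', where a = "L x"]) (use d wH[OF x] L[OF x] in auto)
    then show ?thesis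
      using topspace_cell_sumD(4)[OF top[OF x]]
        point_cong[of H "\<mu> x" "\<lambda>e. l x (g e) / L x" s m d] by (simp add: \<mu>_def)
  qed
  have L_cont: "continuous_map T euclideanreal L"
    unfolding L_def using finG cont by (rule continuous_map_sum)
  have "continuous_map T euclideanreal (\<lambda>x. \<mu> x e)" if "e \<in> edges H" for e
    unfolding \<mu>_def restrict_apply' [OF that]
    by (rule continuous_map_real_divide[OF cont[OF ge[OF that]] L_cont]) (drule L, simp)
  then have "continuous_map T (product_topology (\<lambda>_. euclideanreal) (edges H)) \<mu>"
    unfolding continuous_map_componentwise by (auto simp: \<mu>_def)
  then have "continuous_map T (length_simplex H) \<mu>"
    unfolding length_simplex_def continuous_map_in_subtopology
    using top by (simp add: topspace_cell_sum Pi_iff)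
  moreover have "continuous_map (length_simplex H) (cell_sum s m) (\<lambda>l. ((H, d), l))"
    using continuous_map_component_injection[OF H, of "\<lambda>(G, c). length_simplex G"]
    by (simp add: cell_sum_def)
  ultimately have "continuous_map T (cell_sum s m) ((\<lambda>l. ((H, d), l)) \<circ> \<mu>)"
    by (rule continuous_map_compose)
  then have "continuous_map T (MCG1 s m) (cell_map s m \<circ> ((\<lambda>l. ((H, d), l)) \<circ> \<mu>))"
    by (rule continuous_map_compose) (rule quotient_imp_continuous_map[OF quotient_map_cell_map])
  then show ?thesis
    by (rule continuous_map_eq) (simp add: eq)
qed

section \<open>Normalized lengths and threshold stars\<close>

lemma normalized_cases:
  assumes "x \<in> topspace (MCG1 s m)"
  obtains G c l where "(G, c) \<in> colored_graphs s m" "weighting G l" "sum l (edges G) = 1"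
    "x = point s m G c l"
proof -
  have "x \<in> cell_map s m ` topspace (cell_sum s m)"
    using assms by (simp add: cell_map_image topspace_MCG1)
  then obtain z where "z \<in> topspace (cell_sum s m)" "x = cell_map s m z"
    by blast
  moreover obtain G c l where "z = ((G, c), l)"
    by (metis prod.exhaust)
  ultimately show ?thesis
    using that topspace_cell_sumD[of G c l s m] by blast
qed

text \<open>Total length 1 on both sides forces the scaling factor to be 1, so the nonzero lengths
  match exactly. Edges of length zero need not correspond at all, hence only functions
  \<open>f\<close> with \<open>f 0 = 0\<close> act on classes.\<close>

lemma normalized_point_eq:
  assumes G: "(G, c) \<in> colored_graphs s m" "weighting G l" "sum l (edges G) = 1"
    and H: "(H, d) \<in> colored_graphs s m" "weighting H k" "sum k (edges H) = 1"
    and eq: "point s m G c l = point s m H d k"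
  shows "l ` edges G - {0} = k ` edges H - {0}"
    and "f 0 = 0 \<Longrightarrow> weighting G (\<lambda>e. f (l e)) \<Longrightarrow>
      point s m G c (\<lambda>e. f (l e)) = point s m H d (\<lambda>e. f (k e))"
proof -
  let ?Z = "zero_edges G l" and ?W = "zero_edges H k"
  obtain \<phi> \<psi> a where a: "a > 0" and iso: "graph_iso (contract G ?Z) (contract H ?W) \<phi> \<psi>"
    and kl: "\<And>e. e \<in> edges G - ?Z \<Longrightarrow> k (\<psi> e) = a * l e \<and> d (\<psi> e) = c e"
    using eq unfolding point_eq_iff[OF G(1,2) H(1,2)] by blast
  have bij: "bij_betw \<psi> (edges G - ?Z) (edges H - ?W)"
    using iso by (simp add: graph_iso_def)
  have "sum k (edges H) = sum k (edges H - ?W)"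
    using colored_graphsD(4)[OF H(1)] by (intro sum.mono_neutral_right) (auto simp: zero_edges_def)
  also have "\<dots> = (\<Sum>e\<in>edges G - ?Z. k (\<psi> e))"
    using sum.reindex_bij_betw[OF bij, of k] by simp
  also have "\<dots> = a * sum l (edges G - ?Z)"
    unfolding sum_distrib_left using kl by (intro sum.cong) auto
  also have "sum l (edges G - ?Z) = sum l (edges G)"
    using colored_graphsD(4)[OF G(1)] by (intro sum.mono_neutral_left) (auto simp: zero_edges_def)
  finally have "a = 1"
    using G H by simp
  have "l ` edges G - {0} = l ` (edges G - ?Z)" "k ` edges H - {0} = k ` (edges H - ?W)"
    by (auto simp: zero_edges_def)
  moreover have "k ` (edges H - ?W) = (\<lambda>e. k (\<psi> e)) ` (edges G - ?Z)"
    unfolding bij_betw_imp_surj_on[OF bij, symmetric] image_image ..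
  moreover have "\<dots> = l ` (edges G - ?Z)"
    using kl \<open>a = 1\<close> by (intro image_cong) auto
  ultimately show "l ` edges G - {0} = k ` edges H - {0}"
    by simp
  assume f: "f 0 = 0" "weighting G (\<lambda>e. f (l e))"
  show "point s m G c (\<lambda>e. f (l e)) = point s m H d (\<lambda>e. f (k e))"
    by (rule point_eqI[OF G(1) H(1) _ _ iso, where a = 1])
      (use f kl \<open>a = 1\<close> in \<open>auto simp: zero_edges_def\<close>)
qed

definition long_edges :: "real \<Rightarrow> (nat \<Rightarrow> real) \<Rightarrow> nat \<Rightarrow> real" where
  "long_edges \<epsilon> l e = (if \<epsilon> < l e then 1 else 0)"

text \<open>The index \<open>y\<close> is the point at which the contraction ends, so all tracks
  within one star have the same end. Asking for one suitable representative is as good as asking for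
  all, by \<open>point_in_star_iff\<close>.\<close>

definition star :: "nat \<Rightarrow> nat \<Rightarrow> real \<Rightarrow> metric_graph set \<Rightarrow> metric_graph set set" where
  "star s m \<epsilon> y = {point s m G c l | G c l. (G, c) \<in> colored_graphs s m \<and> weighting G l \<and>
     sum l (edges G) = 1 \<and> (\<forall>e\<in>edges G. l e \<noteq> \<epsilon>) \<and> (\<exists>e\<in>edges G. \<epsilon> < l e) \<and>
     point s m G c (long_edges \<epsilon> l) = y}"

lemma weighting_long_edges: "\<exists>e\<in>edges G. \<epsilon> < l e \<Longrightarrow> weighting G (long_edges \<epsilon> l)"
  by (auto simp: weighting_def long_edges_def)

text \<open>The conditions involve only the nonzero lengths and the threshold function, which
  vanishes at zero because \<epsilon> > 0; both are independent of the normalized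
  representative.\<close>

lemma point_in_star_iff:
  assumes G: "(G, c) \<in> colored_graphs s m" "weighting G l" "sum l (edges G) = 1" and "\<epsilon> > 0"
  shows "point s m G c l \<in> star s m \<epsilon> y \<longleftrightarrow>
    (\<forall>e\<in>edges G. l e \<noteq> \<epsilon>) \<and> (\<exists>e\<in>edges G. \<epsilon> < l e) \<and> point s m G c (long_edges \<epsilon> l) = y"
    (is "_ \<longleftrightarrow> ?R")
proof
  assume "point s m G c l \<in> star s m \<epsilon> y"
  then obtain H d k where H: "(H, d) \<in> colored_graphs s m" "weighting H k" "sum k (edges H) = 1"
    and eq: "point s m H d k = point s m G c l" and k: "\<forall>e\<in>edges H. k e \<noteq> \<epsilon>" "\<exists>e\<in>edges H. \<epsilon> < k e"
    and y: "point s m H d (long_edges \<epsilon> k) = y"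
    by (auto simp: star_def)
  have im: "k ` edges H - {0} = l ` edges G - {0}"
    by (rule normalized_point_eq(1)[OF H G(1-3) eq])
  have "\<epsilon> \<notin> k ` edges H - {0}"
    using k by auto
  then have "\<forall>e\<in>edges G. l e \<noteq> \<epsilon>"
    unfolding im using \<open>\<epsilon> > 0\<close> by auto
  moreover have "\<exists>t\<in>k ` edges H - {0}. \<epsilon> < t"
    using k \<open>\<epsilon> > 0\<close> by fastforce
  then have "\<exists>e\<in>edges G. \<epsilon> < l e"
    unfolding im by auto
  moreover have "point s m H d (long_edges \<epsilon> k) = point s m G c (long_edges \<epsilon> l)"
    using normalized_point_eq(2)[OF H G(1-3) eq, of "\<lambda>t. if \<epsilon> < t then 1 else 0"]
      weighting_long_edges[OF k(2)] \<open>\<epsilon> > 0\<close> by (simp add: long_edges_def[abs_def])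
  ultimately show ?R
    using y by simp
qed (use assms in \<open>auto simp: star_def\<close>)

text \<open>Any threshold below some positive length will do, as long as it avoids the finitely many
  lengths of one representative.\<close>

lemma star_cover:
  assumes "x \<in> topspace (MCG1 s m)"
  obtains \<epsilon> y where "\<epsilon> > 0" "x \<in> star s m \<epsilon> y"
proof -
  obtain G c l where G: "(G, c) \<in> colored_graphs s m" "weighting G l" "sum l (edges G) = 1"
    and x: "x = point s m G c l"
    using normalized_cases[OF assms] by blast
  obtain e where e: "e \<in> edges G" "l e > 0"
    using G(2) by (auto simp: weighting_def)
  have "infinite ({0<..<l e} - l ` edges G)"
    using e colored_graphsD(4)[OF G(1)] by (intro Diff_infinite_finite) auto
  then obtain \<epsilon> where "\<epsilon> \<in> {0<..<l e} - l ` edges G"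
    by (metis finite.emptyI all_not_in_conv)
  then show ?thesis
    using that[of \<epsilon> "point s m G c (long_edges \<epsilon> l)"] G e by (auto simp: star_def x)
qed

text \<open>\<open>A\<close> prescribes the long edges in the cell \<open>i\<close>. On a patch
  \<open>long_edges\<close> is therefore constant on the edges, although it jumps at \<epsilon> in
  general.\<close>

definition patch :: "nat \<Rightarrow> nat \<Rightarrow> real \<Rightarrow> lgraph \<times> (nat \<Rightarrow> nat) \<Rightarrow> nat set \<Rightarrow>
    (colored_graph \<times> (nat \<Rightarrow> real)) set" where
  "patch s m \<epsilon> i A = {x \<in> topspace (cell_sum s m). fst x = i \<and>
     (\<forall>e\<in>edges (fst i). if e \<in> A then \<epsilon> < snd x e else snd x e < \<epsilon>)}"

lemma openin_patch: "openin (cell_sum s m) (patch s m \<epsilon> i A)"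
proof (cases "i \<in> cells s m")
  case i: True
  obtain G c where Gc: "i = (G, c)"
    by (cases i)
  then have fin: "finite (edges G)"
    using i cells_subset colored_graphsD(4) by blast
  have 1: "openin (cell_sum s m) {x \<in> topspace (cell_sum s m). fst x = i}"
  proof -
    have "openin (cell_sum s m) (Pair i ` topspace (length_simplex G))"
      using open_map_component_injection[OF i, of "\<lambda>(G, c). length_simplex G"]
      by (auto simp: open_map_def cell_sum_def Gc)
    moreover have "Pair i ` topspace (length_simplex G) = {x \<in> topspace (cell_sum s m). fst x = i}"
      using i by (auto simp: cell_sum_def Gc)
    ultimately show ?thesis by simp
  qed
  have 2: "openin (cell_sum s m) {x \<in> topspace (cell_sum s m). snd x e \<in> U}" if "open U" for e U
    using continuous_map_edge_length[of s m e] that by (auto simp: continuous_map_def)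
  have "openin (cell_sum s m) (\<Inter>e\<in>edges G. {x \<in> topspace (cell_sum s m).
      snd x e \<in> (if e \<in> A then {\<epsilon><..} else {..<\<epsilon>})} )" if "edges G \<noteq> {}"
    using fin that by (intro openin_INT2 2) auto
  moreover have "edges G \<noteq> {}"
    using i Gc cells_subset one_loop_graphsD(9) colored_graphsD(1) by blast
  ultimately have "openin (cell_sum s m) ({x \<in> topspace (cell_sum s m). fst x = i} \<inter>
      (\<Inter>e\<in>edges G. {x \<in> topspace (cell_sum s m). snd x e \<in> (if e \<in> A then {\<epsilon><..} else {..<\<epsilon>})}))"
    using 1 by (intro openin_Int) auto
  moreover have "patch s m \<epsilon> i A = {x \<in> topspace (cell_sum s m). fst x = i} \<inter>
      (\<Inter>e\<in>edges G. {x \<in> topspace (cell_sum s m). snd x e \<in> (if e \<in> A then {\<epsilon><..} else {..<\<epsilon>})})"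
    by (auto simp: patch_def Gc split: if_splits)
  ultimately show ?thesis by simp
next
  case False
  then have "patch s m \<epsilon> i A = {}"
    by (auto simp: patch_def topspace_cell_sum)
  then show ?thesis by (metis openin_empty)
qed

definition star_preimage :: "nat \<Rightarrow> nat \<Rightarrow> real \<Rightarrow> metric_graph set \<Rightarrow> (colored_graph \<times> (nat \<Rightarrow> real)) set" where
  "star_preimage s m \<epsilon> y = {z \<in> topspace (cell_sum s m). cell_map s m z \<in> star s m \<epsilon> y}"

text \<open>No length equals \<epsilon>, so \<open>z\<close> lies in the patch of its own long
  edges; nearby metrics in this patch have the same long edges and hence the same end point
  \<open>y\<close>. Preimages of stars are thus unions of open patches.\<close>

lemma patch_of_star:
  assumes "z \<in> star_preimage s m \<epsilon> y" "\<epsilon> > 0"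
  shows "z \<in> patch s m \<epsilon> (fst z) {e. \<epsilon> < snd z e}"
    and "patch s m \<epsilon> (fst z) {e. \<epsilon> < snd z e} \<subseteq> star_preimage s m \<epsilon> y"
proof -
  obtain G c l where z: "z = ((G, c), l)"
    by (metis prod.exhaust)
  have top: "((G, c), l) \<in> topspace (cell_sum s m)"
    using assms(1) by (simp add: star_preimage_def z)
  note D = topspace_cell_sumD[OF top]
  have "point s m G c l \<in> star s m \<epsilon> y"
    using assms(1) D(4) by (simp add: star_preimage_def z)
  then have l: "\<forall>e\<in>edges G. l e \<noteq> \<epsilon>" "\<exists>e\<in>edges G. \<epsilon> < l e" "point s m G c (long_edges \<epsilon> l) = y"
    using point_in_star_iff[OF D(1-3) assms(2)] by blast+
  show "z \<in> patch s m \<epsilon> (fst z) {e. \<epsilon> < snd z e}"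
    using l(1) top by (force simp: patch_def z)
  show "patch s m \<epsilon> (fst z) {e. \<epsilon> < snd z e} \<subseteq> star_preimage s m \<epsilon> y"
  proof
    fix w assume w: "w \<in> patch s m \<epsilon> (fst z) {e. \<epsilon> < snd z e}"
    then obtain k where k: "w = ((G, c), k)"
      by (cases w) (auto simp: patch_def z)
    have top': "((G, c), k) \<in> topspace (cell_sum s m)"
      using w unfolding patch_def k by blast
    have k': "\<epsilon> < k e" if "e \<in> edges G" "\<epsilon> < l e" for e
      using w that by (auto simp: patch_def k z)
    have k'': "k e < \<epsilon>" if "e \<in> edges G" "\<not> \<epsilon> < l e" for e
      using w that by (auto simp: patch_def k z)
    have "\<forall>e\<in>edges G. k e \<noteq> \<epsilon>" "\<exists>e\<in>edges G. \<epsilon> < k e"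
      using k' k'' l(2) by (metis less_irrefl, blast)
    moreover have "point s m G c (long_edges \<epsilon> k) = point s m G c (long_edges \<epsilon> l)"
      using k' k'' by (intro point_cong) (force simp: long_edges_def)
    ultimately have "point s m G c k \<in> star s m \<epsilon> y"
      using point_in_star_iff[OF topspace_cell_sumD(1-3)[OF top'] assms(2)] l(3) by simp
    then show "w \<in> star_preimage s m \<epsilon> y"
      using top' topspace_cell_sumD(4)[OF top'] by (simp add: star_preimage_def k)
  qed
qed

lemma openin_star_preimage:
  assumes "\<epsilon> > 0"
  shows "openin (cell_sum s m) (star_preimage s m \<epsilon> y)"
  using openin_patch patch_of_star[OF _ assms] by (subst openin_subopen) metis

lemma star_subset: "star s m \<epsilon> y \<subseteq> topspace (MCG1 s m)"
  by (auto simp: star_def intro: point_in_topspace)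

lemma openin_star:
  assumes "\<epsilon> > 0"
  shows "openin (MCG1 s m) (star s m \<epsilon> y)"
  using openin_star_preimage[OF assms, of s m y] star_subset[of s m \<epsilon> y]
  by (simp add: openin_MCG1 star_preimage_def topspace_MCG1)

section \<open>The straight-line contraction of a star\<close>

definition sharpen :: "real \<Rightarrow> real \<Rightarrow> (nat \<Rightarrow> real) \<Rightarrow> nat \<Rightarrow> real" where
  "sharpen \<epsilon> u l e = (1 - u) * l e + u * long_edges \<epsilon> l e"

lemma weighting_sharpen:
  assumes "weighting G l" "\<exists>e\<in>edges G. \<epsilon> < l e" "0 \<le> u" "u \<le> 1" "\<epsilon> > 0"
  shows "weighting G (sharpen \<epsilon> u l)"
proof -
  obtain e where e: "e \<in> edges G" "\<epsilon> < l e"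
    using assms by blast
  have "0 < (1 - u) * l e + u"
    using assms e by (cases "u = 1") (auto intro!: add_pos_nonneg mult_pos_pos)
  then have "0 < sharpen \<epsilon> u l e"
    using e by (simp add: sharpen_def long_edges_def)
  moreover have "0 \<le> sharpen \<epsilon> u l e" if "e \<in> edges G" for e
    using assms that by (auto simp: sharpen_def long_edges_def weighting_def)
  ultimately show ?thesis
    using e by (auto simp: weighting_def)
qed

text \<open>
  The second component of the argument is the time. Longer edges are equalized at length one without
  rescaling, since the points of the moduli space do not depend on the total length.
\<close>

definition sharpen_cell ::
    "nat \<Rightarrow> nat \<Rightarrow> real \<Rightarrow> (colored_graph \<times> (nat \<Rightarrow> real)) \<times> real \<Rightarrow> metric_graph set" where
  "sharpen_cell s m \<epsilon> x = point s m (fst (fst (fst x))) (snd (fst (fst x))) (sharpen \<epsilon> (snd x) (snd (fst x)))"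

lemma weighting_sharpen_star:
  assumes z: "((G, c), l) \<in> star_preimage s m \<epsilon> y" and "0 \<le> u" "u \<le> 1" "\<epsilon> > 0"
  shows "weighting G (sharpen \<epsilon> u l)"
proof -
  have top: "((G, c), l) \<in> topspace (cell_sum s m)" and S: "cell_map s m ((G, c), l) \<in> star s m \<epsilon> y"
    using z by (simp_all add: star_preimage_def)
  note D = topspace_cell_sumD[OF top]
  have "\<exists>e\<in>edges G. \<epsilon> < l e"
    using S unfolding D(4) point_in_star_iff[OF D(1-3) \<open>\<epsilon> > 0\<close>] by blast
  then show ?thesis
    using D(2) assms by (intro weighting_sharpen)
qed

text \<open>On the patch of \<open>z\<close> the threshold function can be replaced by its values at
  the metric of \<open>z\<close>. What remains is polynomial in time and edge lengths.\<close>

lemma continuous_map_sharpen_patch: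
  assumes z: "z \<in> star_preimage s m \<epsilon> y" and \<epsilon>: "\<epsilon> > 0"
  shows "continuous_map (subtopology (prod_topology (cell_sum s m) euclideanreal)
    (patch s m \<epsilon> (fst z) {e. \<epsilon> < snd z e} \<times> {0..1})) (MCG1 s m) (sharpen_cell s m \<epsilon>)"
    (is "continuous_map ?Q ?X ?k")
proof -
  obtain G c l where zz: "z = ((G, c), l)"
    by (metis prod.exhaust)
  have ztop: "((G, c), l) \<in> topspace (cell_sum s m)"
    using z by (simp add: star_preimage_def zz)
  note D = topspace_cell_sumD[OF ztop]
  let ?f = "\<lambda>x e. (1 - snd x) * snd (fst x) e + snd x * (if \<epsilon> < l e then 1 else 0)"
  have agree: "fst (fst x) = (G, c) \<and> weighting G (sharpen \<epsilon> (snd x) (snd (fst x))) \<and>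
      (\<forall>e\<in>edges G. sharpen \<epsilon> (snd x) (snd (fst x)) e = ?f x e)"
    if x: "x \<in> topspace ?Q" for x
  proof -
    have xT: "fst x \<in> patch s m \<epsilon> (G, c) {e. \<epsilon> < l e}" "0 \<le> snd x" "snd x \<le> 1"
      using x by (auto simp: zz)
    then have 1: "fst (fst x) = (G, c)"
      by (simp add: patch_def)
    have "fst x \<in> star_preimage s m \<epsilon> y"
      using xT(1) patch_of_star(2)[OF z \<epsilon>] by (auto simp: zz)
    then have "weighting G (sharpen \<epsilon> (snd x) (snd (fst x)))"
      using weighting_sharpen_star[of G c "snd (fst x)" s m \<epsilon> y "snd x"] xT(2,3) \<epsilon>
      by (simp flip: 1)
    moreover have "\<epsilon> < snd (fst x) e \<longleftrightarrow> \<epsilon> < l e" if "e \<in> edges G" for e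
      using xT(1) that by (auto simp: patch_def split: if_splits)
    ultimately show ?thesis
      by (simp add: 1 sharpen_def long_edges_def)
  qed
  have "continuous_map ?Q ?X (\<lambda>x. point s m G c (?f x))"
  proof (rule continuous_map_point[OF D(1)])
    fix e assume "e \<in> edges G"
    have fst: "continuous_map ?Q (cell_sum s m) fst"
      by (intro continuous_map_from_subtopology continuous_map_fst)
    have 1: "continuous_map ?Q euclideanreal (\<lambda>x. snd (fst x) e)"
      using continuous_map_compose[OF fst continuous_map_edge_length[of s m e]] by (simp only: comp_def)
    have 2: "continuous_map ?Q euclideanreal snd"
      by (intro continuous_map_from_subtopology continuous_map_snd)
    have 3: "continuous_map ?Q euclideanreal (\<lambda>_. r)" for r
      by simp
    show "continuous_map ?Q euclideanreal (\<lambda>x. ?f x e)"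
      by (rule continuous_map_add[OF continuous_map_real_mult[OF continuous_map_diff[OF 3 2] 1]
            continuous_map_real_mult[OF 2 3]])
  next
    fix x assume "x \<in> topspace ?Q"
    from agree[OF this] show "weighting G (?f x)"
      using weighting_cong[of G "sharpen \<epsilon> (snd x) (snd (fst x))" "?f x"] by blast
  qed
  then show ?thesis
  proof (rule continuous_map_eq)
    fix x assume "x \<in> topspace ?Q"
    note A = agree[OF this]
    then have "point s m G c (sharpen \<epsilon> (snd x) (snd (fst x))) = point s m G c (?f x)"
      by (intro point_cong) blast
    then show "point s m G c (?f x) = ?k x"
      using A by (simp add: sharpen_cell_def)
  qed
qed

lemma continuous_map_sharpen_cell:
  assumes \<epsilon>: "\<epsilon> > 0"
  shows "continuous_map (prod_topology (subtopology (cell_sum s m) (star_preimage s m \<epsilon> y)) (top_of_set {0..1}))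
    (MCG1 s m) (sharpen_cell s m \<epsilon>)"
    (is "continuous_map ?R ?X ?k")
proof (rule pasting_lemma[where I = "star_preimage s m \<epsilon> y" and f = "\<lambda>_. ?k"
        and T = "\<lambda>z. patch s m \<epsilon> (fst z) {e. \<epsilon> < snd z e} \<times> {0..1}"])
  let ?P = "star_preimage s m \<epsilon> y"
  fix z assume z: "z \<in> ?P"
  let ?T = "patch s m \<epsilon> (fst z) {e. \<epsilon> < snd z e}"
  have "openin (subtopology (cell_sum s m) ?P) ?T"
    unfolding openin_open_subtopology[OF openin_star_preimage[OF \<epsilon>]]
    using openin_patch patch_of_star(2)[OF z \<epsilon>] by blast
  then show "openin ?R (?T \<times> {0..1})"
    by (simp add: openin_prod_Times_iff)
  have "?P \<subseteq> topspace (cell_sum s m)"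
    by (auto simp: star_preimage_def)
  then have "topspace (cell_sum s m) \<inter> ?P = ?P"
    by blast
  then have "subtopology ?R (?T \<times> {0..1}) =
      subtopology (prod_topology (cell_sum s m) euclideanreal) ((?P \<inter> ?T) \<times> {0..1})"
    by (simp add: prod_topology_subtopology subtopology_subtopology Times_Int_Times)
  also have "?P \<inter> ?T = ?T"
    using patch_of_star(2)[OF z \<epsilon>] by blast
  finally show "continuous_map (subtopology ?R (?T \<times> {0..1})) ?X ?k"
    using continuous_map_sharpen_patch[OF z \<epsilon>] by simp
next
  fix x assume "x \<in> topspace ?R"
  then have "fst x \<in> star_preimage s m \<epsilon> y" "snd x \<in> {0..1}"
    by auto
  moreover from this(1) have "fst x \<in> patch s m \<epsilon> (fst (fst x)) {e. \<epsilon> < snd (fst x) e}"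
    by (rule patch_of_star(1)[OF _ \<epsilon>])
  ultimately show "\<exists>j. j \<in> star_preimage s m \<epsilon> y \<and>
      x \<in> patch s m \<epsilon> (fst j) {e. \<epsilon> < snd j e} \<times> {0..1} \<and> ?k x = ?k x"
    by (intro exI[of _ "fst x"]) (simp add: mem_Times_iff)
qed simp

text \<open>At a fixed time, sharpening applies one function of the length to every edge, and this
  function is zero at zero, so the representative does not matter.\<close>

lemma sharpen_cell_eq:
  assumes G: "(G, c) \<in> colored_graphs s m" "weighting G l" "sum l (edges G) = 1"
    and z: "z \<in> topspace (cell_sum s m)" "cell_map s m z = point s m G c l"
    and w: "weighting G (sharpen \<epsilon> u l)" and \<epsilon>: "\<epsilon> > 0"
  shows "sharpen_cell s m \<epsilon> (z, u) = point s m G c (sharpen \<epsilon> u l)"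
proof -
  obtain H d j where zz: "z = ((H, d), j)"
    by (metis prod.exhaust)
  note D = topspace_cell_sumD[OF z(1)[unfolded zz]]
  have eq: "point s m G c l = point s m H d j"
    using z(2) D(4) by (simp add: zz)
  let ?f = "\<lambda>t. (1 - u) * t + u * (if \<epsilon> < t then 1 else 0)"
  have f: "sharpen \<epsilon> u k = (\<lambda>e. ?f (k e))" for k
    by (simp add: fun_eq_iff sharpen_def long_edges_def)
  have "point s m G c (sharpen \<epsilon> u l) = point s m H d (sharpen \<epsilon> u j)"
    unfolding f by (rule normalized_point_eq(2)[OF G D(1-3) eq]) (use w \<epsilon> in \<open>auto simp: f\<close>)
  then show ?thesis
    by (simp add: sharpen_cell_def zz)
qed

text \<open>The contraction sharpens a representative picked by the section \<open>r\<close>, about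
  which no continuity is known; \<open>hk\<close> shows independence of it. Continuity is tested
  before passing to the quotient: \<open>cell_map\<close> remains a quotient map over the open star,
  and also after multiplying with the unit interval, which is locally compact Hausdorff.\<close>

lemma star_contraction:
  assumes \<epsilon>: "\<epsilon> > 0"
  shows "\<exists>h.
    continuous_map (prod_topology (subtopology (MCG1 s m) (star s m \<epsilon> y)) (top_of_set {0..1})) (MCG1 s m) h \<and>
    (\<forall>G c l u. (G, c) \<in> colored_graphs s m \<and> weighting G l \<and> sum l (edges G) = 1 \<and>
      point s m G c l \<in> star s m \<epsilon> y \<and> u \<in> {0..1} \<longrightarrow>
      h (point s m G c l, u) = point s m G c (sharpen \<epsilon> u l))"
proof -
  let ?X = "MCG1 s m" and ?C = "cell_sum s m" and ?S = "star s m \<epsilon> y" and ?P = "star_preimage s m \<epsilon> y"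
  let ?I = "top_of_set {0..1::real}" and ?k = "sharpen_cell s m \<epsilon>"
  define r where "r x = (SOME z. z \<in> topspace ?C \<and> cell_map s m z = x)" for x
  have r: "r x \<in> topspace ?C" "cell_map s m (r x) = x" if "x \<in> topspace ?X" for x
  proof -
    have "x \<in> cell_map s m ` topspace ?C"
      using that by (simp add: cell_map_image topspace_MCG1)
    then have "\<exists>z. z \<in> topspace ?C \<and> cell_map s m z = x"
      by blast
    then show "r x \<in> topspace ?C" "cell_map s m (r x) = x"
      unfolding r_def by (rule someI2_ex; blast)+
  qed
  have hk: "?k (r (point s m G c l), u) = point s m G c (sharpen \<epsilon> u l)"
    if G: "(G, c) \<in> colored_graphs s m" "weighting G l" "sum l (edges G) = 1"
      and S: "point s m G c l \<in> ?S" and u: "u \<in> {0..1}" for G c l u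
  proof (rule sharpen_cell_eq[OF G r(1) r(2) _ \<epsilon>])
    show "point s m G c l \<in> topspace ?X"
      using point_in_topspace[OF G(1,2)] .
    then show "point s m G c l \<in> topspace ?X" .
    have "\<exists>e\<in>edges G. \<epsilon> < l e"
      using S unfolding point_in_star_iff[OF G \<epsilon>] by blast
    then show "weighting G (sharpen \<epsilon> u l)"
      using G(2) u \<epsilon> by (intro weighting_sharpen) auto
  qed
  have q: "quotient_map (subtopology ?C ?P) (subtopology ?X ?S) (cell_map s m)"
    by (rule quotient_map_restriction[OF quotient_map_cell_map])
      (simp_all add: star_preimage_def openin_star[OF \<epsilon>])
  have q2: "quotient_map (prod_topology (subtopology ?C ?P) ?I) (prod_topology (subtopology ?X ?S) ?I)
      (\<lambda>(x, y). (cell_map s m x, y))"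
  proof (rule quotient_map_prod_left[OF _ _ q])
    show "locally_compact_space ?I"
      by (intro compact_imp_locally_compact_space) (simp add: compact_space_subtopology)
  qed (simp add: Hausdorff_space_subtopology)
  have "continuous_map (prod_topology (subtopology ?C ?P) ?I) ?X
      ((\<lambda>x. ?k (r (fst x), snd x)) \<circ> (\<lambda>(x, y). (cell_map s m x, y)))"
    using continuous_map_sharpen_cell[OF \<epsilon>]
  proof (rule continuous_map_eq)
    fix x assume "x \<in> topspace (prod_topology (subtopology ?C ?P) ?I)"
    then have x: "fst x \<in> ?P" "snd x \<in> {0..1}" "fst x \<in> topspace ?C"
      by auto
    obtain G c l where fx: "fst x = ((G, c), l)"
      by (metis prod.exhaust)
    note D = topspace_cell_sumD[OF x(3)[unfolded fx]]
    have S: "point s m G c l \<in> ?S"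
      using x(1) D(4) by (simp add: fx star_preimage_def)
    have "?k x = point s m G c (sharpen \<epsilon> (snd x) l)"
      by (simp add: sharpen_cell_def fx)
    also have "\<dots> = ?k (r (point s m G c l), snd x)"
      using hk[OF D(1-3) S x(2)] by simp
    also have "point s m G c l = cell_map s m (fst x)"
      using D(4) by (simp add: fx)
    finally show "?k x = ((\<lambda>x. ?k (r (fst x), snd x)) \<circ> (\<lambda>(x, y). (cell_map s m x, y))) x"
      by (simp add: case_prod_beta)
  qed
  from continuous_compose_quotient_map[OF q2 this]
  have cont: "continuous_map (prod_topology (subtopology ?X ?S) ?I) ?X (\<lambda>x. ?k (r (fst x), snd x))" .
  show ?thesis
    using cont hk by (intro exI[of _ "\<lambda>x. ?k (r (fst x), snd x)"] conjI allI impI) auto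
qed

section \<open>Paths along one-cells\<close>

text \<open>Convex combinations are taken without normalizing. After rescaling, such a path still
  follows a straight line in the simplex, though at varying speed.\<close>

definition segment :: "nat \<Rightarrow> nat \<Rightarrow> lgraph \<Rightarrow> (nat \<Rightarrow> nat) \<Rightarrow> (nat \<Rightarrow> real) \<Rightarrow> (nat \<Rightarrow> real) \<Rightarrow>
    real \<Rightarrow> metric_graph set located" where
  "segment s m G c l k t = locate (MCG1 s m) (point s m G c (\<lambda>e. (1 - t) * l e + t * k e))"

lemma weighting_combination:
  assumes "weighting G l" "weighting G k" "weighting G j" "0 \<le> a" "0 \<le> b" "0 \<le> c" "0 < a + b + c"
  shows "weighting G (\<lambda>e. a * l e + b * k e + c * j e)"
proof -
  have nonneg: "0 \<le> l e" "0 \<le> k e" "0 \<le> j e" if "e \<in> edges G" for e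
    using assms(1-3) that by (auto simp: weighting_def)
  have ex: "\<exists>e\<in>edges G. 0 < l e" "\<exists>e\<in>edges G. 0 < k e" "\<exists>e\<in>edges G. 0 < j e"
    using assms(1-3) by (auto simp: weighting_def)
  consider "0 < a" | "0 < b" | "0 < c"
    using assms(4-7) by linarith
  then have "\<exists>e\<in>edges G. 0 < a * l e + b * k e + c * j e"
  proof cases
    case 1
    then show ?thesis
      using ex(1) nonneg assms by (meson add_pos_nonneg mult_nonneg_nonneg mult_pos_pos)
  next
    case 2
    then show ?thesis
      using ex(2) nonneg assms by (meson add_nonneg_pos add_pos_nonneg mult_nonneg_nonneg mult_pos_pos)
  next
    case 3
    then show ?thesis
      using ex(3) nonneg assms by (meson add_nonneg_pos add_nonneg_nonneg mult_nonneg_nonneg mult_pos_pos)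
  qed
  then show ?thesis
    using nonneg assms by (auto simp: weighting_def)
qed

text \<open>Weightings are closed under convex combinations, so the parameter triangle
  \<open>K\<close> maps continuously to the moduli space, with the three segments as the images of
  its sides.\<close>

lemma homotopic_segment_join:
  assumes G: "(G, c) \<in> colored_graphs s m"
    and w: "weighting G l" "weighting G k" "weighting G j"
  shows "homotopic (segment s m G c l k +++ segment s m G c k j) (segment s m G c l j)"
proof -
  define K where "K = {p. 0 \<le> fst p \<and> 0 \<le> snd p \<and> fst p + snd p \<le> (1::real)}"
  define F where "F = (\<lambda>p. locate (MCG1 s m)
    (point s m G c (\<lambda>e. (1 - fst p - snd p) * l e + fst p * k e + snd p * j e)))"
  have "convex K"
  proof (rule convexI)
    fix p q u v assume *: "p \<in> K" "q \<in> K" "0 \<le> u" "0 \<le> v" "u + v = (1::real)"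
    then have "u * (fst p + snd p) + v * (fst q + snd q) \<le> u * 1 + v * 1"
      by (intro add_mono mult_left_mono) (auto simp: K_def)
    with * show "u *\<^sub>R p + v *\<^sub>R q \<in> K"
      by (simp add: K_def algebra_simps)
  qed
  moreover have "continuous_on K F"
  proof -
    have "continuous_map (top_of_set K) (MCG1 s m)
        (\<lambda>p. point s m G c (\<lambda>e. (1 - fst p - snd p) * l e + fst p * k e + snd p * j e))"
    proof (rule continuous_map_point[OF G])
      fix p assume "p \<in> topspace (top_of_set K)"
      then show "weighting G (\<lambda>e. (1 - fst p - snd p) * l e + fst p * k e + snd p * j e)"
        by (intro weighting_combination w) (auto simp: K_def)
    next
      fix e
      show "continuous_map (top_of_set K) euclideanreal
          (\<lambda>p. (1 - fst p - snd p) * l e + fst p * k e + snd p * j e)"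
        by (simp, intro continuous_intros)
    qed
    from continuous_map_compose[OF this continuous_map_locate] show ?thesis
      by (simp add: F_def comp_def)
  qed
  moreover have "F \<circ> linepath (0, 0) (1, 0) = segment s m G c l k"
    "F \<circ> linepath (1, 0) (0, 1) = segment s m G c k j" "F \<circ> linepath (0, 0) (0, 1) = segment s m G c l j"
    by (auto simp: fun_eq_iff F_def segment_def linepath_def)
  ultimately show ?thesis
    using homotopic_join_linepath[of K F "(0, 0)" "(1, 0)" "(0, 1)"] by (simp add: K_def)
qed

lemma pathstart_segment [simp]: "pathstart (segment s m G c l k) = locate (MCG1 s m) (point s m G c l)"
  and pathfinish_segment [simp]: "pathfinish (segment s m G c l k) = locate (MCG1 s m) (point s m G c k)"
  by (simp_all add: segment_def pathstart_def pathfinish_def)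

lemma path_segment:
  assumes "(G, c) \<in> colored_graphs s m" "weighting G l" "weighting G k"
  shows "path (segment s m G c l k)"
  using homotopic_paths_imp_path[OF homotopic_segment_join[OF assms(1,2,3,3)]] by blast

section \<open>Vertices and one-cells: colors and partitions of the legs\<close>

definition spike :: "nat \<Rightarrow> nat \<Rightarrow> real" where
  "spike e d = (if d = e then 1 else 0)"

lemma weighting_spike: "e \<in> edges G \<Longrightarrow> weighting G (spike e)"
  by (auto simp: weighting_def spike_def)

lemma component_without_edge:
  assumes "G \<in> one_loop_graphs s" "e \<in> edges G" "v \<in> verts G"
  shows "component (G\<lparr>edges := edges G - {e}\<rparr>) v = verts G"
  using one_loop_graphsD(1,6)[OF assms(1)] assms by (intro component_connected) auto

text \<open>Contracting all edges but one leaves a single vertex with a loop and all legs, so the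
  color of the loop is the only datum left.\<close>

lemma point_spike_eq:
  assumes G: "(G, c) \<in> colored_graphs s m" "e \<in> edges G" and H: "(H, d) \<in> colored_graphs s m" "f \<in> edges H"
    and "c e = d f"
  shows "point s m G c (spike e) = point s m H d (spike f)"
proof (rule point_eqI[OF G(1) H(1), where a = 1])
  note oG = colored_graphsD[OF G(1)] and oH = colored_graphsD[OF H(1)]
  have q: "component (G\<lparr>edges := edges G - {e}\<rparr>) v = verts G" if "v \<in> verts G" for v
    using component_without_edge[OF oG(1) G(2) that] .
  have r: "component (H\<lparr>edges := edges H - {f}\<rparr>) v = verts H" if "v \<in> verts H" for v
    using component_without_edge[OF oH(1) H(2) that] .
  have ne: "verts G \<noteq> {}" "verts H \<noteq> {}"
    using oG(3) oH(3) by (auto simp: multigraph_def)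
  obtain u w where uw: "ends G e = {#u, w#}" "u \<in> verts G" "w \<in> verts G"
    using ends_pair[OF oG(3) G(2)] .
  obtain u' w' where uw': "ends H f = {#u', w'#}" "u' \<in> verts H" "w' \<in> verts H"
    using ends_pair[OF oH(3) H(2)] .
  have legs: "leg G i \<in> verts G" "leg H i \<in> verts H" if "i \<in> {1..s}" for i
    using oG(3,5) oH(3,5) that by (auto simp: multigraph_def)
  have "(\<lambda>_. verts G) ` verts G = {verts G}" "(\<lambda>_. verts H) ` verts H = {verts H}"
    using ne by auto
  then have "component (G\<lparr>edges := edges G - {e}\<rparr>) ` verts G = {verts G}"
    "component (H\<lparr>edges := edges H - {f}\<rparr>) ` verts H = {verts H}"
    using q r by (simp_all cong: image_cong)
  moreover have "edges G - (edges G - {e}) = {e}" "edges H - (edges H - {f}) = {f}"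
    using G(2) H(2) by auto
  ultimately show "graph_iso (contract G (edges G - {e})) (contract H (edges H - {f})) (\<lambda>_. verts H) (\<lambda>_. f)"
    using uw uw' q r legs oG(5) oH(5) by (auto simp: graph_iso_def bij_betw_def)
qed (use assms weighting_spike in \<open>auto simp: spike_def\<close>)

text \<open>
  The graph obtained by contracting all edges but \<open>e\<close> and \<open>f\<close> has two vertices, and the legs in \<open>P\<close>
  are those at one of them.
\<close>

definition splits :: "lgraph \<Rightarrow> nat \<Rightarrow> nat \<Rightarrow> nat set \<Rightarrow> bool" where
  "splits G e f P \<longleftrightarrow> e \<in> edges G \<and> f \<in> edges G \<and> e \<noteq> f \<and>
    (let H = contract G (edges G - {e, f}) in \<exists>K L. K \<noteq> L \<and> verts H = {K, L} \<and>
      ends H e = {#K, L#} \<and> ends H f = {#K, L#} \<and>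
      (\<forall>i\<in>{1..nlegs G}. leg H i = (if i \<in> P then K else L)))"

lemma splits_swap: "splits G e f P \<Longrightarrow> splits G f e P"
  unfolding splits_def Let_def insert_commute[of f e] by blast

lemma splits_complement:
  assumes "splits G e f P" shows "splits G e f ({1..nlegs G} - P)"
proof -
  let ?H = "contract G (edges G - {e, f})"
  obtain K L where "K \<noteq> L" "verts ?H = {K, L}" "ends ?H e = {#K, L#}" "ends ?H f = {#K, L#}"
      "\<forall>i\<in>{1..nlegs G}. leg ?H i = (if i \<in> P then K else L)"
    using assms unfolding splits_def Let_def by blast
  then have "L \<noteq> K" "verts ?H = {L, K}" "ends ?H e = {#L, K#}" "ends ?H f = {#L, K#}"
      "\<forall>i\<in>{1..nlegs G}. leg ?H i = (if i \<in> {1..nlegs G} - P then L else K)"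
    by (auto simp: add_mset_commute)
  then show ?thesis
    using assms unfolding splits_def Let_def by blast
qed

text \<open>The partition and the two colors determine the colored two-vertex graph. One of
  \<open>x\<close> and \<open>y\<close> may vanish, so the end points of the one-cell are
  included.\<close>

lemma splits_point_eq:
  assumes G: "(G, c) \<in> colored_graphs s m" "splits G e f P"
    and H: "(H, d) \<in> colored_graphs s m" "splits H e' f' P"
    and col: "c e = d e'" "c f = d f'" and xy: "0 \<le> x" "0 \<le> y" "0 < x + y"
  shows "point s m G c (\<lambda>b. x * spike e b + y * spike f b) = point s m H d (\<lambda>b. x * spike e' b + y * spike f' b)"
proof -
  let ?C = "contract G (edges G - {e, f})" and ?D = "contract H (edges H - {e', f'})"
  obtain K L where KL: "K \<noteq> L" "verts ?C = {K, L}" "ends ?C e = {#K, L#}" "ends ?C f = {#K, L#}"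
      "\<forall>i\<in>{1..nlegs G}. leg ?C i = (if i \<in> P then K else L)" and ef: "e \<in> edges G" "f \<in> edges G" "e \<noteq> f"
    using G(2) unfolding splits_def Let_def by blast
  obtain K' L' where KL': "K' \<noteq> L'" "verts ?D = {K', L'}" "ends ?D e' = {#K', L'#}" "ends ?D f' = {#K', L'#}"
      "\<forall>i\<in>{1..nlegs H}. leg ?D i = (if i \<in> P then K' else L')" and ef': "e' \<in> edges H" "f' \<in> edges H" "e' \<noteq> f'"
    using H(2) unfolding splits_def Let_def by blast
  let ?\<phi> = "\<lambda>v. if v = K then K' else L'" and ?\<psi> = "\<lambda>b. if b = e then e' else f'"
  have n: "nlegs G = s" "nlegs H = s"
    using G(1) H(1) by (auto dest: colored_graphsD)
  have E: "edges ?C = {e, f}" "edges ?D = {e', f'}"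
    using ef ef' by auto
  have iso: "graph_iso ?C ?D ?\<phi> ?\<psi>"
    unfolding graph_iso_def E KL(2) KL'(2)
  proof (intro conjI)
    show "bij_betw ?\<phi> {K, L} {K', L'}" "bij_betw ?\<psi> {e, f} {e', f'}"
      using KL(1) KL'(1) ef(3) ef'(3) by (auto simp: bij_betw_def inj_on_def)
    show "\<forall>b\<in>{e, f}. ends ?D (?\<psi> b) = image_mset ?\<phi> (ends ?C b)"
      unfolding ball_simps using KL(1,3,4) KL'(3,4) ef(3) by (simp del: contract_sel)
    show "nlegs ?D = nlegs ?C"
      using n by simp
    show "\<forall>i\<in>{1..nlegs ?C}. leg ?D i = ?\<phi> (leg ?C i)"
      using KL(1,5) KL'(5) n by (simp del: contract_sel(5))
  qed
  have "weighting G (\<lambda>b. x * spike e b + y * spike f b)"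
    using weighting_combination[of G "spike e" "spike f" "spike e" x y 0] weighting_spike ef xy by auto
  then show ?thesis
    by (intro point_eqI[OF G(1) H(1) _ _ iso, where a = 1])
      (use ef ef' col in \<open>auto simp: spike_def\<close>)
qed

text \<open>Without \<open>e\<close> and \<open>f\<close> there is a forest with two edges fewer
  than vertices, hence with two components. Both removed edges join these components, and both parts
  of the partition are nonempty because \<open>u\<close> and \<open>w\<close> carry legs.\<close>

lemma splits_at_end:
  assumes G: "G \<in> one_loop_graphs s" and ef: "e \<in> edges G" "f \<in> edges G" "e \<noteq> f"
    and uw: "ends G e = {#u, w#}"
  defines "q \<equiv> component (G\<lparr>edges := edges G - {e, f}\<rparr>)"
  shows "splits G e f {i \<in> {1..s}. q (leg G i) = q u}" "q u \<noteq> q w"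
    "{i \<in> {1..s}. q (leg G i) = q u} \<noteq> {}" "{i \<in> {1..s}. q (leg G i) = q u} \<noteq> {1..s}"
proof -
  note D = one_loop_graphsD[OF G]
  have V: "set_mset (ends G b) \<subseteq> verts G" if "b \<in> edges G" for b
    using D(1) that by (auto simp: multigraph_def)
  have uV: "u \<in> verts G" "w \<in> verts G"
    using V[OF ef(1)] uw by auto
  let ?Z = "edges G - {e, f}"
  have "graph_rank (G\<lparr>edges := ?Z\<rparr>) = 0"
    using one_loop_graph_forest[OF G, of ?Z] ef by (auto simp: forest_def)
  moreover have "card ?Z + 2 = card (verts G)"
    using ef D(2,8) card_Diff_subset[of "{e, f}" "edges G"] card_mono[of "edges G" "{e, f}"] by simp
  ultimately have "card (q ` verts G) = 2"
    by (simp add: graph_rank_def q_def)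
  \<comment> \<open>If both ends of \<open>g\<close> lay in one component, restoring
    \<open>g\<close> would change no component, although the graph lacking only the other edge is
    connected.\<close>
  have sep: "q a \<noteq> q b" if g: "g \<in> {e, f}" "ends G g = {#a, b#}" for g a b
  proof
    assume eq: "q a = q b"
    define h where "h = (if g = e then f else e)"
    have h: "h \<in> edges G" "insert g ?Z = edges G - {h}"
      using g ef by (auto simp: h_def)
    have "q v = verts G" if "v \<in> verts G" for v
      using component_insert_eq[OF g(2) eq[unfolded q_def], of v] component_without_edge[OF G h(1) that]
      by (simp add: h(2) q_def)
    then have "q ` verts G = {verts G}"
      using uV by auto
    then show False
      using \<open>card (q ` verts G) = 2\<close> by simp
  qed
  show qne: "q u \<noteq> q w"
    using sep[of e u w] uw by simp
  have qV: "q ` verts G = {q u, q w}"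
  proof (rule sym, rule card_subset_eq)
    show "card {q u, q w} = card (q ` verts G)"
      using qne \<open>card (q ` verts G) = 2\<close> by simp
  qed (use D(3) uV in auto)
  obtain a b where ab: "ends G f = {#a, b#}" "a \<in> verts G" "b \<in> verts G"
    using ends_pair[OF D(1) ef(2)] .
  have qVD: "q v = q u \<or> q v = q w" if "v \<in> verts G" for v
    using imageI[OF that, of q] unfolding qV by simp
  have "q a \<noteq> q b"
    using sep[of f a b] ab(1) by simp
  then consider "q a = q u" "q b = q w" | "q a = q w" "q b = q u"
    using qVD[OF ab(2)] qVD[OF ab(3)] by metis
  then have endf: "{#q a, q b#} = {#q u, q w#}"
    by cases (simp_all add: add_mset_commute)
  let ?P = "{i \<in> {1..s}. q (leg G i) = q u}"
  have legs: "\<forall>i\<in>{Suc 0..s}. q (leg G i) \<noteq> q u \<longrightarrow> q (leg G i) = q w"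
  proof
    fix i assume "i \<in> {Suc 0..s}"
    then have "leg G i \<in> verts G"
      using D(1,4) by (auto simp: multigraph_def)
    then show "q (leg G i) \<noteq> q u \<longrightarrow> q (leg G i) = q w"
      using qVD[of "leg G i"] by blast
  qed
  show "splits G e f ?P"
    unfolding splits_def Let_def contract_sel q_def[symmetric] D(4)
    using ef qne qV legs uw ab(1) endf
    by (intro conjI) (simp_all, rule exI[of _ "q u"], rule exI[of _ "q w"], simp)
  obtain i where "i \<in> {1..s}" "leg G i = u"
    using vertex_has_leg[OF G uV(1)] .
  then show "?P \<noteq> {}"
    by blast
  obtain j where "j \<in> {1..s}" "leg G j = w"
    using vertex_has_leg[OF G uV(2)] .
  then show "?P \<noteq> {1..s}"
    using qne by auto
qed

lemma splits_ex:
  assumes G: "G \<in> one_loop_graphs s" and ef: "e \<in> edges G" "f \<in> edges G" "e \<noteq> f"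
  obtains P where "splits G e f P" "P \<subseteq> {1..s}" "P \<noteq> {}" "P \<noteq> {1..s}"
proof -
  obtain u w where "ends G e = {#u, w#}"
    using ends_pair[OF one_loop_graphsD(1)[OF G] ef(1)] .
  from splits_at_end[OF G ef this] that show ?thesis
    by (metis (no_types, lifting) mem_Collect_eq subsetI)
qed

section \<open>Triangles, the two-cells supplying all relations\<close>

definition triangle :: "nat \<Rightarrow> (nat \<Rightarrow> nat) \<Rightarrow> lgraph" where
  "triangle s f = \<lparr>verts = {0, 1, 2}, edges = {0, 1, 2},
    ends = (\<lambda>e. if e = 0 then {#0, 1#} else if e = 1 then {#1, 2#} else {#2, 0#}),
    nlegs = s, leg = f\<rparr>"

lemma adjacencyI: "e \<in> edges G \<Longrightarrow> ends G e = {#u, v#} \<Longrightarrow> (u, v) \<in> adjacency G"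
  by (auto simp: adjacency_def)

lemma connected_graph_three:
  assumes "verts G = {a, b, c}" "(a, b) \<in> adjacency G" "(b, c) \<in> adjacency G"
  shows "connected_graph G"
proof -
  have "component G a = component G b" "component G b = component G c"
    using assms by (auto simp: component_eq_iff)
  then show ?thesis
    using assms(1) by (auto simp: connected_graph_def simp flip: component_eq_iff)
qed

lemma triangle_one_loop:
  assumes "f ` {1..s} = {0, 1, 2}"
  shows "triangle s f \<in> one_loop_graphs s"
proof -
  let ?T = "triangle s f"
  have f: "f i \<in> {0, 1, 2}" if "i \<in> {1..s}" for i
    using assms that by blast
  have mg: "multigraph ?T"
    using f by (simp add: multigraph_def triangle_def)
  have adj: "(0, 1) \<in> adjacency (?T\<lparr>edges := Z\<rparr>)" if "0 \<in> Z" for Z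
    by (rule adjacencyI[of 0]) (simp_all add: that triangle_def)
  have adj': "(1, 2) \<in> adjacency (?T\<lparr>edges := Z\<rparr>)" if "1 \<in> Z" for Z
    by (rule adjacencyI[of 1]) (use that in \<open>simp_all add: triangle_def\<close>)
  have adj'': "(2, 0) \<in> adjacency (?T\<lparr>edges := Z\<rparr>)" if "2 \<in> Z" for Z
    by (rule adjacencyI[of 2]) (simp_all add: that triangle_def)
  have V1: "verts (?T\<lparr>edges := Z\<rparr>) = {0, 1, 2}" and V2: "verts (?T\<lparr>edges := Z\<rparr>) = {1, 2, 0}"
    and V3: "verts (?T\<lparr>edges := Z\<rparr>) = {2, 0, 1}" for Z
    by (auto simp: triangle_def)
  have E: "edges ?T = {0, 1, 2}"
    by (simp add: triangle_def)
  have con: "connected_graph (?T\<lparr>edges := edges ?T - {e}\<rparr>)" for e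
  proof -
    \<comment> \<open>At least two consecutive sides survive, and they form a path through all three
      vertices.\<close>
    consider "e \<noteq> 0 \<and> e \<noteq> 1" | "e \<noteq> 1 \<and> e \<noteq> 2" | "e \<noteq> 2 \<and> e \<noteq> 0"
      by linarith
    then show ?thesis
    proof cases
      case 1
      then show ?thesis
        by (intro connected_graph_three[OF V1] adj adj') (auto simp: E)
    next
      case 2
      then show ?thesis
        by (intro connected_graph_three[OF V2] adj' adj'') (auto simp: E)
    next
      case 3
      then show ?thesis
        by (intro connected_graph_three[OF V3] adj'' adj) (auto simp: E)
    qed
  qed
  have "connected_graph (?T\<lparr>edges := edges ?T\<rparr>)"
    by (intro connected_graph_three[OF V1] adj adj') (auto simp: E)
  then have "connected_graph ?T" "graph_rank ?T = 1"
    using graph_rank_connected[OF mg, of "edges ?T"] by (simp_all add: triangle_def)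
  moreover have "3 \<le> valency ?T v" if v: "v \<in> verts ?T" for v
  proof -
    have v3: "v = 0 \<or> v = 1 \<or> v = 2"
      using v by (simp add: triangle_def)
    then have "v \<in> f ` {1..s}"
      unfolding assms by simp
    then have "{i \<in> {1..nlegs ?T}. leg ?T i = v} \<noteq> {}"
      by (auto simp: triangle_def)
    then have "card {i \<in> {1..nlegs ?T}. leg ?T i = v} > 0"
      by (simp add: card_gt_0_iff)
    moreover have "(\<Sum>e\<in>edges ?T. count (ends ?T e) v) = 2"
      using v3 by (auto simp: triangle_def)
    ultimately show ?thesis
      by (simp add: valency_def)
  qed
  ultimately show ?thesis
    using mg con by (auto simp: one_loop_graphs_def admissible_def triangle_def)
qed

text \<open>Contracting the third side merges its two vertices, so exactly the legs at the common
  vertex of the other two sides are split off.\<close>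

lemma triangle_splits:
  assumes f: "f ` {1..s} = {0, 1, 2}"
  shows "splits (triangle s f) 0 1 {i \<in> {1..s}. f i = 1}"
    "splits (triangle s f) 1 2 {i \<in> {1..s}. f i = 2}"
    "splits (triangle s f) 2 0 {i \<in> {1..s}. f i = 0}"
proof -
  let ?T = "triangle s f"
  \<comment> \<open>Here \<open>g\<close> is the contracted side, with ends \<open>w\<close> and
    \<open>x\<close>, and \<open>u\<close> is the vertex shared by \<open>e\<close> and
    \<open>e'\<close>.\<close>
  have gen: "splits ?T e e' {i \<in> {1..s}. f i = u}"
    if e: "e \<in> {0, 1, 2}" "e' \<in> {0, 1, 2}" "e \<noteq> e'" "g \<in> {0, 1, 2} - {e, e'}"
      and u: "ends ?T e = {#u, w#}" "ends ?T g = {#w, x#}" "{0, 1, 2} = {u, w, x}" for e e' g u w x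
  proof -
    let ?q = "component (?T\<lparr>edges := edges ?T - {e, e'}\<rparr>)"
    have E: "edges ?T = {0, 1, 2}"
      by (simp add: triangle_def)
    have eE: "e \<in> edges ?T" "e' \<in> edges ?T"
      using e by (simp_all add: E)
    note sp = splits_at_end[OF triangle_one_loop[OF f] eE e(3) u(1)]
    have "(w, x) \<in> adjacency (?T\<lparr>edges := edges ?T - {e, e'}\<rparr>)"
      by (rule adjacencyI[of g]) (use e(4) u(2) in \<open>auto simp: E\<close>)
    then have qwx: "?q w = ?q x"
      by (simp add: component_eq_iff)
    have "?q (f i) = ?q u \<longleftrightarrow> f i = u" if "i \<in> {1..s}" for i
    proof -
      have "f i \<in> {u, w, x}"
        using f that u(3) by blast
      then show ?thesis
        using sp(2) qwx by auto
    qed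
    then have "{i \<in> {1..s}. ?q (leg ?T i) = ?q u} = {i \<in> {1..s}. f i = u}"
      by (auto simp: triangle_def)
    then show ?thesis
      using sp(1) by simp
  qed
  show "splits ?T 0 1 {i \<in> {1..s}. f i = 1}"
    by (rule gen[of 0 1 2 1 0 2]) (auto simp: triangle_def add_mset_commute)
  show "splits ?T 1 2 {i \<in> {1..s}. f i = 2}"
    by (rule gen[of 1 2 0 2 1 0]) (auto simp: triangle_def add_mset_commute)
  show "splits ?T 2 0 {i \<in> {1..s}. f i = 0}"
    by (rule gen[of 2 0 1 0 2 1]) (auto simp: triangle_def add_mset_commute)
qed

section \<open>Homotopy classes of one-cells depend only on the end colors\<close>

definition edge_path :: "nat \<Rightarrow> nat \<Rightarrow> lgraph \<Rightarrow> (nat \<Rightarrow> nat) \<Rightarrow> nat \<Rightarrow> nat \<Rightarrow>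
    real \<Rightarrow> metric_graph set located" where
  "edge_path s m G c e f = segment s m G c (spike e) (spike f)"

lemma path_edge_path:
  assumes "(G, c) \<in> colored_graphs s m" "e \<in> edges G" "f \<in> edges G"
  shows "path (edge_path s m G c e f)"
  unfolding edge_path_def using assms by (intro path_segment weighting_spike)

lemma pathstart_edge_path [simp]:
    "pathstart (edge_path s m G c e f) = locate (MCG1 s m) (point s m G c (spike e))"
  and pathfinish_edge_path [simp]:
    "pathfinish (edge_path s m G c e f) = locate (MCG1 s m) (point s m G c (spike f))"
  by (simp_all add: edge_path_def)

lemma homotopic_edge_path_join:
  assumes "(G, c) \<in> colored_graphs s m" "e \<in> edges G" "f \<in> edges G" "g \<in> edges G"
  shows "homotopic (edge_path s m G c e f +++ edge_path s m G c f g) (edge_path s m G c e g)"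
  unfolding edge_path_def using assms by (intro homotopic_segment_join weighting_spike)

lemma edge_path_splits_eq:
  assumes "(G, c) \<in> colored_graphs s m" "splits G e f P"
    and "(H, d) \<in> colored_graphs s m" "splits H e' f' P"
    and "c e = d e'" "c f = d f'" and t: "t \<in> {0..1}"
  shows "edge_path s m G c e f t = edge_path s m H d e' f' t"
  unfolding edge_path_def segment_def
  using splits_point_eq[OF assms(1-6), of "1 - t" t] t by simp

lemma splitsD: "splits G e f P \<Longrightarrow> e \<in> edges G \<and> f \<in> edges G \<and> e \<noteq> f"
  by (simp add: splits_def)

lemma homotopic_same_split:
  assumes "(G, c) \<in> colored_graphs s m" "splits G e f P"
    and "(H, d) \<in> colored_graphs s m" "splits H e' f' P"
    and "c e = d e'" "c f = d f'"
  shows "homotopic (edge_path s m G c e f) (edge_path s m H d e' f')"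
  using edge_path_splits_eq[OF assms] path_edge_path[OF assms(1)] splitsD[OF assms(2)]
  by (intro homotopic_paths_eq) auto

text \<open>Exchanging the two edges fixes both vertices of the contracted graph and all legs. When
  the colors agree, it identifies the points at \<open>t\<close> and \<open>1 - t\<close>, so the
  one-cell is folded at its midpoint.\<close>

lemma homotopic_monochromatic:
  assumes G: "(G, c) \<in> colored_graphs s m" and ef: "e \<in> edges G" "f \<in> edges G" "e \<noteq> f" and c: "c e = c f"
  shows "homotopic (edge_path s m G c e f) (\<lambda>_. pathstart (edge_path s m G c e f))"
proof (rule homotopic_palindrome)
  show "path (edge_path s m G c e f)"
    by (rule path_edge_path) fact+
  fix t :: real assume t: "t \<in> {0..1}"
  obtain P where P: "splits G e f P"
    using splits_ex[OF colored_graphsD(1)[OF G] ef] by blast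
  have "edge_path s m G c e f (1 - t) = edge_path s m G c f e (1 - t)"
    using t c by (intro edge_path_splits_eq[OF G P G splits_swap[OF P]]) auto
  also have "\<dots> = edge_path s m G c e f t"
    by (simp add: edge_path_def segment_def add.commute)
  finally show "edge_path s m G c e f (1 - t) = edge_path s m G c e f t" .
qed

definition tricolor :: "nat \<Rightarrow> nat \<Rightarrow> nat \<Rightarrow> nat \<Rightarrow> nat" where
  "tricolor i j k = (\<lambda>e\<in>{0, 1, 2}. if e = 0 then i else if e = 1 then j else k)"

lemma tricolor_simps [simp]:
  "tricolor i j k 0 = i" "tricolor i j k (Suc 0) = j" "tricolor i j k 2 = k"
  by (simp_all add: tricolor_def)

lemma triangle_edges [simp]: "edges (triangle s f) = {0, 1, 2}"
  by (simp add: triangle_def)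

lemma triangle_colored:
  assumes "f ` {1..s} = {0, 1, 2}" "{i, j, k} \<subseteq> {1..m}"
  shows "(triangle s f, tricolor i j k) \<in> colored_graphs s m"
  using triangle_one_loop[OF assms(1)] assms(2)
  by (auto simp: colored_graphs_def colorings_def tricolor_def)

lemma color_mem: "(G, c) \<in> colored_graphs s m \<Longrightarrow> e \<in> edges G \<Longrightarrow> c e \<in> {1..m}"
  using colored_graphsD(2) by blast

lemma image_eq_012:
  fixes f :: "'a \<Rightarrow> nat"
  assumes "x \<in> A" "y \<in> A" "z \<in> A" "f x = 0" "f y = 1" "f z = 2" "\<And>a. f a \<le> 2"
  shows "f ` A = {0, 1, 2}"
proof
  show "f ` A \<subseteq> {0, 1, 2}"
  proof (rule image_subsetI)
    fix a show "f a \<in> {0, 1, 2}"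
      using assms(7)[of a] by auto
  qed
  show "{0, 1, 2} \<subseteq> f ` A"
    using assms(1-3) assms(4-6)[symmetric] by (simp add: rev_image_eqI)
qed

text \<open>
  A triangle with colors \<open>i, j, j\<close> has one side joining two points of color \<open>j\<close>. That side is
  null-homotopic, so the two remaining sides, which split off different sets of legs, are homotopic.
\<close>

lemma homotopic_disjoint_splits:
  assumes G: "(G, c) \<in> colored_graphs s m" "splits G e f P"
    and H: "(H, d) \<in> colored_graphs s m" "splits H e' f' Q"
    and col: "c e = d e'" "c f = d f'"
    and PQ: "P \<subseteq> {1..s}" "Q \<subseteq> {1..s}" "P \<noteq> {}" "Q \<noteq> {}" "P \<inter> Q = {}" "P \<union> Q \<noteq> {1..s}"
  shows "homotopic (edge_path s m G c e f) (edge_path s m H d e' f')"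
proof -
  \<comment> \<open>\<open>P\<close> sits at vertex 1, where sides 0 and 1 meet, and
    \<open>Q\<close> at vertex 0, where sides 2 and 0 meet. The legs outside both sets occupy vertex
    2.\<close>
  define r where "r i = (if i \<in> P then 1 else if i \<in> Q then 0 else 2 :: nat)" for i
  obtain p q x where pqx: "p \<in> P" "q \<in> Q" "x \<in> {1..s}" "x \<notin> P" "x \<notin> Q"
    using PQ by blast
  have "q \<notin> P"
    using pqx PQ(5) by blast
  have r: "r ` {1..s} = {0, 1, 2}"
    by (rule image_eq_012[of q _ p x]) (use pqx PQ(1,2) \<open>q \<notin> P\<close> in \<open>auto simp: r_def\<close>)
  have rP: "{i \<in> {1..s}. r i = 1} = P" "{i \<in> {1..s}. r i = 0} = Q"
    using PQ by (auto simp: r_def)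
  let ?T = "triangle s r" and ?c = "tricolor (c e) (c f) (c f)"
  let ?p = "edge_path s m ?T ?c"
  have "c e \<in> {1..m}" "c f \<in> {1..m}"
    using color_mem[OF G(1)] splitsD[OF G(2)] by auto
  then have T: "(?T, ?c) \<in> colored_graphs s m"
    by (intro triangle_colored[OF r]) auto
  note sp = triangle_splits[OF r, unfolded rP]
  have P: "path (?p 0 1)" "path (?p 1 2)"
    by (intro path_edge_path[OF T]; simp)+
  have "homotopic (edge_path s m G c e f) (?p 0 1)"
    by (rule homotopic_same_split[OF G T sp(1)]) simp_all
  also have "homotopic (?p 0 1) (?p 0 1 +++ (\<lambda>_. pathfinish (?p 0 1)))"
    by (rule homotopic_paths_sym, rule homotopic_const_right) (use P in simp_all)
  also have "homotopic \<dots> (?p 0 1 +++ ?p 1 2)"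
  proof (rule homotopic_paths_join)
    have "homotopic (?p 1 2) (\<lambda>_. pathstart (?p 1 2))"
      by (rule homotopic_monochromatic[OF T]) simp_all
    then show "homotopic (\<lambda>_. pathfinish (?p 0 1)) (?p 1 2)"
      by (simp add: homotopic_paths_sym)
  qed (use P in \<open>simp_all add: pathstart_def\<close>)
  also have "homotopic \<dots> (?p 0 2)"
    by (rule homotopic_edge_path_join[OF T]) simp_all
  also have "homotopic (?p 0 2) (edge_path s m H d e' f')"
    by (rule homotopic_same_split[OF T splits_swap[OF sp(3)] H]) (use col in simp_all)
  finally show ?thesis .
qed

text \<open>Besides \<open>b\<close>, two more legs are available to occupy the other two vertices
  of a triangle.\<close>

lemma singleton_split_ex:
  assumes "s \<ge> 3" "b \<in> {1..s}" "i \<in> {1..m}" "j \<in> {1..m}"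
  obtains G c e f where "(G, c) \<in> colored_graphs s m" "splits G e f {b}" "c e = i" "c f = j"
proof -
  obtain x y where xy: "x \<in> {1..s}" "y \<in> {1..s}" "x \<noteq> b" "y \<noteq> b" "x \<noteq> y"
  proof -
    have "card ({1..s} - {b}) \<ge> 2"
      using assms by simp
    then obtain A where "A \<subseteq> {1..s} - {b}" "card A = 2"
      by (meson obtain_subset_with_card_n)
    then show ?thesis
      using that by (auto simp: card_2_iff)
  qed
  define r where "r k = (if k = b then 1 else if k = x then 0 else 2 :: nat)" for k
  have r: "r ` {1..s} = {0, 1, 2}"
    by (rule image_eq_012[of x _ b y]) (use xy assms(2) in \<open>auto simp: r_def\<close>)
  have "{k \<in> {1..s}. r k = 1} = {b}"
    using assms(2) by (auto simp: r_def)
  then show ?thesis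
    using that[OF triangle_colored[OF r, of i j j m], of 0 1] triangle_splits(1)[OF r] assms by simp
qed

text \<open>With at least three legs, distinct singletons are disjoint and do not exhaust the legs,
  so one triangle connects them.\<close>

lemma homotopic_singleton_splits:
  assumes "s \<ge> 3" and G: "(G, c) \<in> colored_graphs s m" "splits G e f {a}"
    and H: "(H, d) \<in> colored_graphs s m" "splits H e' f' {b}"
    and col: "c e = d e'" "c f = d f'" and ab: "a \<in> {1..s}" "b \<in> {1..s}"
  shows "homotopic (edge_path s m G c e f) (edge_path s m H d e' f')"
proof (cases "a = b")
  case True
  then show ?thesis
    using homotopic_same_split[OF G H(1) _ col] H(2) by simp
next
  case False
  have "card {a, b} < card {1..s}"
    using \<open>s \<ge> 3\<close> False by simp
  then have "{a} \<union> {b} \<noteq> {1..s}"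
    by (auto simp: insert_commute)
  then show ?thesis
    using False ab by (intro homotopic_disjoint_splits[OF G H col]) auto
qed

text \<open>Take \<open>b\<close> outside \<open>P\<close>. If \<open>P\<close> and \<open>b\<close>
  are all the legs, the same one-cell already splits off \<open>{b}\<close> when seen from its other
  vertex; otherwise one triangle leads from \<open>P\<close> to \<open>{b}\<close>.\<close>

lemma homotopic_to_singleton_split:
  assumes "s \<ge> 3" and G: "(G, c) \<in> colored_graphs s m" "splits G e f P"
    and P: "P \<subseteq> {1..s}" "P \<noteq> {}" "P \<noteq> {1..s}"
  obtains b H d e' f' where "b \<in> {1..s}" "(H, d) \<in> colored_graphs s m" "splits H e' f' {b}"
    "c e = d e'" "c f = d f'" "homotopic (edge_path s m G c e f) (edge_path s m H d e' f')"
proof -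
  obtain b where b: "b \<in> {1..s}" "b \<notin> P"
    using P by blast
  show ?thesis
  proof (cases "P \<union> {b} = {1..s}")
    case True
    then have "{1..nlegs G} - P = {b}"
      using b colored_graphsD(5)[OF G(1)] by auto
    then have sp: "splits G e f {b}"
      using splits_complement[OF G(2)] by simp
    show ?thesis
      by (rule that[OF b(1) G(1) sp])
        (use path_edge_path[OF G(1)] splitsD[OF sp] in auto)
  next
    case False
    have "c e \<in> {1..m}" "c f \<in> {1..m}"
      using color_mem[OF G(1)] splitsD[OF G(2)] by auto
    then obtain H d e' f' where H: "(H, d) \<in> colored_graphs s m" "splits H e' f' {b}" "d e' = c e" "d f' = c f"
      using singleton_split_ex[OF \<open>s \<ge> 3\<close> b(1)] by metis
    have "homotopic (edge_path s m G c e f) (edge_path s m H d e' f')"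
      using False b P by (intro homotopic_disjoint_splits[OF G H(1,2)]) (use H in auto)
    then show ?thesis
      using that[OF b(1) H(1,2)] H(3,4) by simp
  qed
qed

text \<open>Two partitions may overlap or cover all legs, so they are compared through singletons,
  which all agree.\<close>

lemma homotopic_edge_paths:
  assumes s: "s \<ge> 3" and G: "(G, c) \<in> colored_graphs s m" "e \<in> edges G" "f \<in> edges G" "e \<noteq> f"
    and H: "(H, d) \<in> colored_graphs s m" "e' \<in> edges H" "f' \<in> edges H" "e' \<noteq> f'"
    and col: "c e = d e'" "c f = d f'"
  shows "homotopic (edge_path s m G c e f) (edge_path s m H d e' f')"
proof -
  obtain P where P: "splits G e f P" "P \<subseteq> {1..s}" "P \<noteq> {}" "P \<noteq> {1..s}"
    using splits_ex[OF colored_graphsD(1)[OF G(1)] G(2-4)] by metis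
  obtain Q where Q: "splits H e' f' Q" "Q \<subseteq> {1..s}" "Q \<noteq> {}" "Q \<noteq> {1..s}"
    using splits_ex[OF colored_graphsD(1)[OF H(1)] H(2-4)] by metis
  obtain b A a e1 f1 where A: "b \<in> {1..s}" "(A, a) \<in> colored_graphs s m" "splits A e1 f1 {b}"
    "c e = a e1" "c f = a f1" "homotopic (edge_path s m G c e f) (edge_path s m A a e1 f1)"
    using homotopic_to_singleton_split[OF s G(1) P] by metis
  obtain b' B g e2 f2 where B: "b' \<in> {1..s}" "(B, g) \<in> colored_graphs s m" "splits B e2 f2 {b'}"
    "d e' = g e2" "d f' = g f2" "homotopic (edge_path s m H d e' f') (edge_path s m B g e2 f2)"
    using homotopic_to_singleton_split[OF s H(1) Q] by metis
  have "homotopic (edge_path s m A a e1 f1) (edge_path s m B g e2 f2)"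
    using A(4,5) B(4,5) col by (intro homotopic_singleton_splits[OF s A(2,3) B(2,3) _ _ A(1) B(1)]) auto
  then show ?thesis
    using A(6) B(6) by (meson homotopic_paths_sym homotopic_paths_trans)
qed

section \<open>Standard paths from the base point to every color\<close>

definition base_legs :: "nat \<Rightarrow> nat" where
  "base_legs i = (if i = 1 then 1 else if i = 2 then 2 else 0)"

text \<open>The path leads from color 1, that of the base point, to color \<open>i\<close>. For
  \<open>i = 1\<close> it is a folded one-cell and not a constant path, so that
  \<open>homotopic_edge_paths\<close> covers this color as well.\<close>

definition color_path :: "nat \<Rightarrow> nat \<Rightarrow> nat \<Rightarrow> real \<Rightarrow> metric_graph set located" where
  "color_path s m i = edge_path s m (triangle s base_legs) (tricolor 1 i 1) 0 1"

lemma base_legs_image: "s \<ge> 3 \<Longrightarrow> base_legs ` {1..s} = {0, 1, 2}"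
  by (rule image_eq_012[of 3 _ 1 2]) (auto simp: base_legs_def)

definition base_point :: "nat \<Rightarrow> nat \<Rightarrow> metric_graph set" where
  "base_point s m = point s m (triangle s base_legs) (tricolor 1 1 1) (spike 0)"

lemma color_path_props:
  assumes "s \<ge> 3" and i: "i \<in> {1..m}"
  shows "path (color_path s m i)" "pathstart (color_path s m i) = locate (MCG1 s m) (base_point s m)"
    "(G, c) \<in> colored_graphs s m \<Longrightarrow> e \<in> edges G \<Longrightarrow> c e = i \<Longrightarrow>
      pathfinish (color_path s m i) = locate (MCG1 s m) (point s m G c (spike e))"
proof -
  have T: "(triangle s base_legs, tricolor 1 j 1) \<in> colored_graphs s m" if "j \<in> {1..m}" for j
    using that i by (intro triangle_colored base_legs_image assms) auto
  show "path (color_path s m i)"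
    unfolding color_path_def by (rule path_edge_path[OF T[OF i]]) simp_all
  have "point s m (triangle s base_legs) (tricolor 1 i 1) (spike 0) = base_point s m"
    unfolding base_point_def using i by (intro point_spike_eq T) auto
  then show "pathstart (color_path s m i) = locate (MCG1 s m) (base_point s m)"
    by (simp add: color_path_def)
  assume G: "(G, c) \<in> colored_graphs s m" "e \<in> edges G" "c e = i"
  have "point s m (triangle s base_legs) (tricolor 1 i 1) (spike 1) = point s m G c (spike e)"
    using i G by (intro point_spike_eq T) auto
  then show "pathfinish (color_path s m i) = locate (MCG1 s m) (point s m G c (spike e))"
    by (simp add: color_path_def)
qed

text \<open>In the triangle with colors 1, \<open>c e\<close>, \<open>c f\<close>, the three sides
  are homotopic to the three paths involved, and the two-cell fills it. The case
  \<open>e = f\<close> is separate because the edge path is then constant and not a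
  one-cell.\<close>

lemma homotopic_color_path_join:
  assumes s: "s \<ge> 3" and G: "(G, c) \<in> colored_graphs s m" "e \<in> edges G" "f \<in> edges G"
  shows "homotopic (color_path s m (c e) +++ edge_path s m G c e f) (color_path s m (c f))"
proof -
  have col: "c e \<in> {1..m}" "c f \<in> {1..m}"
    using color_mem[OF G(1)] G by auto
  note E = color_path_props[OF s col(1)] and F = color_path_props[OF s col(2)]
  show ?thesis
  proof (cases "e = f")
    case True
    have "edge_path s m G c e e = (\<lambda>_. pathfinish (color_path s m (c e)))"
      using E(3)[OF G(1,2)] by (simp add: edge_path_def segment_def fun_eq_iff algebra_simps)
    then show ?thesis
      using True homotopic_const_right[OF E(1)] by simp
  next
    case False
    let ?T = "triangle s base_legs"
    let ?p = "edge_path s m ?T (tricolor 1 (c e) (c f))"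
    have T: "(?T, tricolor i j k) \<in> colored_graphs s m" if "{i, j, k} \<subseteq> {1..m}" for i j k
      using that by (intro triangle_colored base_legs_image s)
    have T1: "(?T, tricolor 1 (c e) (c f)) \<in> colored_graphs s m"
      using col by (intro T) auto
    have e1: "homotopic (color_path s m (c e)) (?p 0 1)"
      unfolding color_path_def by (intro homotopic_edge_paths[OF s] T) (use col in auto)
    have e2: "homotopic (edge_path s m G c e f) (?p 1 2)"
      by (rule homotopic_edge_paths[OF s G False T1]) simp_all
    have e3: "homotopic (?p 0 2) (color_path s m (c f))"
      unfolding color_path_def by (intro homotopic_edge_paths[OF s] T) (use col in auto)
    have "homotopic (color_path s m (c e) +++ edge_path s m G c e f) (?p 0 1 +++ ?p 1 2)"
      using E(3)[OF G(1,2)] by (intro homotopic_paths_join e1 e2) simp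
    also have "homotopic \<dots> (?p 0 2)"
      by (rule homotopic_edge_path_join[OF T1]) simp_all
    also note e3
    finally show ?thesis .
  qed
qed

section \<open>Canonical paths\<close>

definition trail :: "nat \<Rightarrow> nat \<Rightarrow> lgraph \<Rightarrow> (nat \<Rightarrow> nat) \<Rightarrow> (nat \<Rightarrow> real) \<Rightarrow> nat \<Rightarrow>
    real \<Rightarrow> metric_graph set located" where
  "trail s m G c l e = color_path s m (c e) +++ segment s m G c (spike e) l"

lemma trail_props:
  assumes s: "s \<ge> 3" and G: "(G, c) \<in> colored_graphs s m" "weighting G l" "e \<in> edges G"
  shows "path (trail s m G c l e)"
    "pathstart (trail s m G c l e) = locate (MCG1 s m) (base_point s m)"
    "pathfinish (trail s m G c l e) = locate (MCG1 s m) (point s m G c l)"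
    "pathfinish (color_path s m (c e)) = pathstart (segment s m G c (spike e) l)"
proof -
  note C = color_path_props[OF s color_mem[OF G(1,3)]]
  note P = path_segment[OF G(1) weighting_spike[OF G(3)] G(2)]
  show fin: "pathfinish (color_path s m (c e)) = pathstart (segment s m G c (spike e) l)"
    using C(3)[OF G(1,3)] by simp
  show "path (trail s m G c l e)"
    unfolding trail_def using C(1) P fin by (rule path_join_imp)
  show "pathstart (trail s m G c l e) = locate (MCG1 s m) (base_point s m)"
    "pathfinish (trail s m G c l e) = locate (MCG1 s m) (point s m G c l)"
    using C(2) by (simp_all add: trail_def)
qed

lemma homotopic_trail_extend:
  assumes s: "s \<ge> 3" and G: "(G, c) \<in> colored_graphs s m" "weighting G l" "weighting G k" "e \<in> edges G"
  shows "homotopic (trail s m G c l e +++ segment s m G c l k) (trail s m G c k e)"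
proof -
  note C = color_path_props[OF s color_mem[OF G(1,4)]] and W = weighting_spike[OF G(4)]
  have "homotopic (trail s m G c l e +++ segment s m G c l k)
      (color_path s m (c e) +++ (segment s m G c (spike e) l +++ segment s m G c l k))"
    unfolding trail_def
    by (rule homotopic_paths_sym, rule homotopic_paths_assoc)
      (use C(1) C(3)[OF G(1,4)] path_segment[OF G(1)] W G in auto)
  also have "homotopic \<dots> (trail s m G c k e)"
    unfolding trail_def using C(1) C(3)[OF G(1,4)] W G
    by (intro homotopic_paths_join homotopic_segment_join) auto
  finally show ?thesis .
qed

text \<open>Inside the simplex the way from \<open>spike e\<close> to \<open>l\<close> may go
  through \<open>spike f\<close>; the added piece is absorbed into the color path.\<close>

lemma homotopic_trail_edge:
  assumes s: "s \<ge> 3" and G: "(G, c) \<in> colored_graphs s m" "weighting G l" "e \<in> edges G" "f \<in> edges G"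
  shows "homotopic (trail s m G c l e) (trail s m G c l f)"
proof -
  note C = color_path_props[OF s color_mem[OF G(1,3)]]
  note We = weighting_spike[OF G(3)] and Wf = weighting_spike[OF G(4)]
  let ?e = "segment s m G c (spike e)" and ?f = "segment s m G c (spike f)"
  have "homotopic (trail s m G c l e) (color_path s m (c e) +++ (?e (spike f) +++ ?f l))"
    unfolding trail_def using C(1) C(3)[OF G(1,3)]
    by (intro homotopic_paths_join homotopic_paths_sym[OF homotopic_segment_join[OF G(1) We Wf G(2)]]) auto
  also have "homotopic \<dots> ((color_path s m (c e) +++ ?e (spike f)) +++ ?f l)"
    by (rule homotopic_paths_assoc)
      (use C(1) C(3)[OF G(1,3)] path_segment[OF G(1)] We Wf G in auto)
  also have "homotopic \<dots> (trail s m G c l f)"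
    unfolding trail_def
  proof (rule homotopic_paths_join)
    show "homotopic (color_path s m (c e) +++ ?e (spike f)) (color_path s m (c f))"
      using homotopic_color_path_join[OF s G(1,3,4)] by (simp add: edge_path_def)
  qed (use path_segment[OF G(1)] Wf G in auto)
  finally show ?thesis .
qed

lemma weighting_scale: "weighting G l \<Longrightarrow> 0 < a \<Longrightarrow> weighting G (\<lambda>e. a * l e)"
  unfolding weighting_def by (metis mult_nonneg_nonneg mult_pos_pos less_imp_le)

lemma point_scale:
  assumes "(G, c) \<in> colored_graphs s m" "weighting G l" "0 < a"
  shows "point s m G c (\<lambda>e. a * l e) = point s m G c l"
  by (rule point_eqI[OF assms(1,1) _ _ graph_iso_refl, of "{}", symmetric])
    (use assms in auto)

text \<open>Prolonging the segment from \<open>l\<close> to a positive multiple of \<open>l\<close>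
  does not move the point, so the added piece is constant.\<close>

lemma homotopic_segment_scale:
  assumes G: "(G, c) \<in> colored_graphs s m" "weighting G l" "weighting G k" and a: "0 < a"
  shows "homotopic (segment s m G c k (\<lambda>e. a * l e)) (segment s m G c k l)"
proof -
  have al: "weighting G (\<lambda>e. a * l e)"
    using G(2) a by (rule weighting_scale)
  have const: "segment s m G c l (\<lambda>e. a * l e) t = locate (MCG1 s m) (point s m G c l)" if t: "t \<in> {0..1}" for t
  proof -
    have "0 < (1 - t) + t * a"
      using a t by (cases "t = 0") (auto intro!: add_nonneg_pos)
    from point_scale[OF G(1,2) this] show ?thesis
      by (simp add: segment_def algebra_simps)
  qed
  have "homotopic (segment s m G c k (\<lambda>e. a * l e)) (segment s m G c k l +++ segment s m G c l (\<lambda>e. a * l e))"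
    by (rule homotopic_paths_sym, rule homotopic_segment_join[OF G(1,3,2) al])
  also have "homotopic \<dots> (segment s m G c k l +++ (\<lambda>_. locate (MCG1 s m) (point s m G c l)))"
    by (intro homotopic_paths_join homotopic_paths_eq)
      (use const path_segment[OF G(1)] G al in auto)
  also have "homotopic \<dots> (segment s m G c k l)"
    by (rule homotopic_const_right) (use path_segment[OF G(1)] G in auto)
  finally show ?thesis .
qed

text \<open>The edges \<open>e\<close> and \<open>f\<close> need not correspond, and may even have
  length zero. Both trails are moved to an edge \<open>g\<close> of positive length and its image
  \<open>\<psi> g\<close>, which share their color; from there the segments agree pointwise once
  \<open>l\<close> is multiplied by \<open>a\<close>.\<close>

lemma homotopic_trails:
  assumes s: "s \<ge> 3" and G: "(G, c) \<in> colored_graphs s m" "weighting G l" "e \<in> edges G"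
    and H: "(H, d) \<in> colored_graphs s m" "weighting H k" "f \<in> edges H"
    and eq: "point s m G c l = point s m H d k"
  shows "homotopic (trail s m G c l e) (trail s m H d k f)"
proof -
  let ?Z = "zero_edges G l" and ?W = "zero_edges H k"
  obtain \<phi> \<psi> a where a: "a > 0" and iso: "graph_iso (contract G ?Z) (contract H ?W) \<phi> \<psi>"
    and kl: "\<And>b. b \<in> edges G - ?Z \<Longrightarrow> k (\<psi> b) = a * l b \<and> d (\<psi> b) = c b"
    using eq unfolding point_eq_iff[OF G(1,2) H(1,2)] by blast
  have bij: "bij_betw \<psi> (edges G - ?Z) (edges H - ?W)"
    using iso by (simp add: graph_iso_def)
  obtain g where g: "g \<in> edges G" "l g > 0"
    using G(2) by (auto simp: weighting_def)
  then have gZ: "g \<in> edges G - ?Z"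
    by (simp add: zero_edges_def)
  then have \<psi>g: "\<psi> g \<in> edges H - ?W"
    using bij_betwE[OF bij] by blast
  have cg: "d (\<psi> g) = c g"
    using kl[OF gZ] by simp
  have al: "weighting G (\<lambda>b. a * l b)"
    using G(2) a by (rule weighting_scale)
  note Wg = weighting_spike[OF g(1)]
  \<comment> \<open>As \<open>g\<close> lies outside \<open>?Z\<close>, the spikes put no weight on
    collapsed edges, and the same isomorphism of contractions works at every time
    \<open>t\<close>.\<close>
  have pw: "segment s m G c (spike g) (\<lambda>b. a * l b) t = segment s m H d (spike (\<psi> g)) k t"
    if t: "t \<in> {0..1}" for t
  proof -
    let ?u = "\<lambda>b. (1 - t) * spike g b + t * (a * l b)" and ?v = "\<lambda>b. (1 - t) * spike (\<psi> g) b + t * k b"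
    have w: "weighting G ?u"
      using weighting_combination[OF Wg al al, of "1 - t" t 0] t by simp
    have uv: "?v (\<psi> b) = 1 * ?u b" if b: "b \<in> edges G - ?Z" for b
    proof -
      have "\<psi> b = \<psi> g \<longleftrightarrow> b = g"
        using bij b gZ by (auto simp: bij_betw_def dest: inj_onD)
      then show ?thesis
        using kl[OF b] by (simp add: spike_def)
    qed
    have "?u b = 0" if "b \<in> ?Z" for b
      using that gZ by (auto simp: zero_edges_def spike_def)
    moreover have "?v b = 0" if "b \<in> ?W" for b
      using that \<psi>g by (auto simp: zero_edges_def spike_def)
    moreover have "?Z \<subseteq> edges G" "?W \<subseteq> edges H"
      by (auto simp: zero_edges_def)
    ultimately have "point s m G c ?u = point s m H d ?v"
      using kl by (intro point_eqI[OF G(1) H(1) _ _ iso _ w _ _ zero_less_one uv]) auto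
    then show ?thesis
      by (simp add: segment_def)
  qed
  have "homotopic (segment s m G c (spike g) l) (segment s m G c (spike g) (\<lambda>b. a * l b))"
    by (rule homotopic_paths_sym, rule homotopic_segment_scale[OF G(1,2) Wg a])
  also have "homotopic \<dots> (segment s m H d (spike (\<psi> g)) k)"
    using pw path_segment[OF G(1) Wg al] by (intro homotopic_paths_eq) auto
  finally have seg: "homotopic (segment s m G c (spike g) l) (segment s m H d (spike (\<psi> g)) k)" .
  have "homotopic (trail s m G c l e) (trail s m G c l g)"
    by (rule homotopic_trail_edge[OF s G g(1)])
  also have "homotopic \<dots> (trail s m H d k (\<psi> g))"
    unfolding trail_def cg
    using color_path_props[OF s color_mem[OF G(1) g(1)]] G(1) g(1)
    by (intro homotopic_paths_join seg) auto
  also have "homotopic \<dots> (trail s m H d k f)"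
    by (rule homotopic_trail_edge[OF s H(1,2) _ H(3)]) (use \<psi>g in auto)
  finally show ?thesis .
qed

text \<open>Representative and edge are chosen simultaneously; for three or more legs
  \<open>homotopic_trails\<close> makes the result unique up to homotopy.\<close>

definition canonical_path :: "nat \<Rightarrow> nat \<Rightarrow> metric_graph set \<Rightarrow> real \<Rightarrow> metric_graph set located" where
  "canonical_path s m x = (SOME p. \<exists>G c l e. (G, c) \<in> colored_graphs s m \<and> weighting G l \<and>
     e \<in> edges G \<and> x = point s m G c l \<and> p = trail s m G c l e)"

lemma canonical_path_cases:
  assumes "x \<in> topspace (MCG1 s m)"
  obtains G c l e where "(G, c) \<in> colored_graphs s m" "weighting G l" "e \<in> edges G"
    "x = point s m G c l" "canonical_path s m x = trail s m G c l e"
proof -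
  obtain G c l where G: "(G, c) \<in> colored_graphs s m" "weighting G l" "x = point s m G c l"
    using point_cases[OF assms] .
  moreover obtain e where "e \<in> edges G"
    using G(2) by (auto simp: weighting_def)
  ultimately have "\<exists>p G c l e. (G, c) \<in> colored_graphs s m \<and> weighting G l \<and>
     e \<in> edges G \<and> x = point s m G c l \<and> p = trail s m G c l e"
    by blast
  then have "\<exists>G c l e. (G, c) \<in> colored_graphs s m \<and> weighting G l \<and>
     e \<in> edges G \<and> x = point s m G c l \<and> canonical_path s m x = trail s m G c l e"
    unfolding canonical_path_def by (rule someI_ex)
  then show ?thesis
    using that by blast
qed

lemma homotopic_canonical_path:
  assumes "s \<ge> 3" "(G, c) \<in> colored_graphs s m" "weighting G l" "e \<in> edges G"
  shows "homotopic (canonical_path s m (point s m G c l)) (trail s m G c l e)"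
proof -
  obtain H d k f where H: "(H, d) \<in> colored_graphs s m" "weighting H k" "f \<in> edges H"
    "point s m G c l = point s m H d k" "canonical_path s m (point s m G c l) = trail s m H d k f"
    using canonical_path_cases[OF point_in_topspace[OF assms(2,3)]] .
  then show ?thesis
    using homotopic_trails[OF assms(1) H(1-3) assms(2-4)] by simp
qed

lemma canonical_path_props:
  assumes "s \<ge> 3" "x \<in> topspace (MCG1 s m)"
  shows "path (canonical_path s m x)"
    "pathstart (canonical_path s m x) = locate (MCG1 s m) (base_point s m)"
    "pathfinish (canonical_path s m x) = locate (MCG1 s m) x"
proof -
  obtain G c l e where G: "(G, c) \<in> colored_graphs s m" "weighting G l" "e \<in> edges G"
    "x = point s m G c l" "canonical_path s m x = trail s m G c l e"
    using canonical_path_cases[OF assms(2)] .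
  then show "path (canonical_path s m x)"
    "pathstart (canonical_path s m x) = locate (MCG1 s m) (base_point s m)"
    "pathfinish (canonical_path s m x) = locate (MCG1 s m) x"
    using trail_props[OF assms(1) G(1-3)] by simp_all
qed

lemma base_point_in_topspace:
  assumes "s \<ge> 3" "m \<ge> 1"
  shows "base_point s m \<in> topspace (MCG1 s m)"
  unfolding base_point_def using assms
  by (intro point_in_topspace weighting_spike triangle_colored base_legs_image) auto

text \<open>Contracting \<open>d\<close> sweeps out a square with sides \<open>d\<close>, the tracks
  of its two end points, and a constant side at \<open>y\<close>. So \<open>d\<close> amounts to
  following the track of \<open>d 0\<close> to \<open>y\<close> and that of \<open>d 1\<close>
  backwards, and appending either track to its canonical path gives the class of the canonical path
  of \<open>y\<close>.\<close>

lemma homotopic_in_star: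
  assumes s: "s \<ge> 3" and \<epsilon>: "\<epsilon> > 0"
    and d: "continuous_map (top_of_set {0..1}) (MCG1 s m) d" "d ` {0..1} \<subseteq> star s m \<epsilon> y"
  shows "homotopic (canonical_path s m (d 0) +++ (locate (MCG1 s m) \<circ> d)) (canonical_path s m (d 1))"
proof -
  let ?X = "MCG1 s m" and ?I = "top_of_set {0..1::real}" and ?S = "star s m \<epsilon> y"
  let ?\<gamma> = "canonical_path s m"
  obtain h where h: "continuous_map (prod_topology (subtopology ?X ?S) ?I) ?X h"
    and h_eq: "\<And>G c l u. (G, c) \<in> colored_graphs s m \<Longrightarrow> weighting G l \<Longrightarrow> sum l (edges G) = 1 \<Longrightarrow>
      point s m G c l \<in> ?S \<Longrightarrow> u \<in> {0..1} \<Longrightarrow> h (point s m G c l, u) = point s m G c (sharpen \<epsilon> u l)"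
    using star_contraction[OF \<epsilon>, of s m y] by metis
  define H where "H = (\<lambda>(t, u). locate ?X (h (d t, u)))"
  have "continuous_map ?I (subtopology ?X ?S) d"
    using d by (auto simp: continuous_map_in_subtopology)
  then have "continuous_map (prod_topology ?I ?I) (prod_topology (subtopology ?X ?S) ?I) (\<lambda>p. (d (fst p), snd p))"
    by (intro continuous_map_paired[THEN iffD2] conjI continuous_map_snd
        continuous_map_compose[OF continuous_map_fst, unfolded comp_def])
  from continuous_map_compose[OF continuous_map_compose[OF this h] continuous_map_locate]
  have H: "continuous_on ({0..1} \<times> {0..1}) H"
    by (simp add: H_def comp_def case_prod_beta prod_topology_subtopology_eu)
  define \<tau> where "\<tau> t u = H (t, u)" for t u
  \<comment> \<open>For each \<open>t\<close> separately, the track is a segment in the cell of some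
    representative of \<open>d t\<close>. No compatibility between these representatives is needed;
    \<open>H\<close> is already continuous.\<close>
  have track: "H (t, 0) = locate ?X (d t) \<and> H (t, 1) = locate ?X y \<and> path (\<tau> t) \<and>
      d t \<in> topspace ?X \<and> homotopic (?\<gamma> (d t) +++ \<tau> t) (?\<gamma> y)"
    if t: "t \<in> {0..1}" for t
  proof -
    have "d t \<in> ?S"
      using d(2) t by auto
    then obtain G c l where G: "(G, c) \<in> colored_graphs s m" "weighting G l" "sum l (edges G) = 1"
      and dt: "d t = point s m G c l" and long: "\<exists>e\<in>edges G. \<epsilon> < l e"
      and y: "point s m G c (long_edges \<epsilon> l) = y"
      unfolding star_def by blast
    obtain e where e: "e \<in> edges G"
      using long by blast
    note w = weighting_long_edges[OF long]
    let ?seg = "segment s m G c l (long_edges \<epsilon> l)"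
    have Hseg: "?seg u = H (t, u)" if u: "u \<in> {0..1}" for u
      using h_eq[OF G _ u] \<open>d t \<in> ?S\<close>
      by (simp add: H_def segment_def dt sharpen_def[abs_def])
    have seg: "homotopic ?seg (\<tau> t)"
      using Hseg path_segment[OF G(1,2) w] by (intro homotopic_paths_eq) (auto simp: \<tau>_def)
    have start: "pathfinish (?\<gamma> (d t)) = pathstart (\<tau> t)"
      using canonical_path_props(3)[OF s point_in_topspace[OF G(1,2)]]
        homotopic_paths_imp_pathstart[OF seg] by (simp add: dt)
    have "homotopic (?\<gamma> (d t) +++ \<tau> t) (trail s m G c l e +++ ?seg)"
      using start homotopic_canonical_path[OF s G(1,2) e]
      by (intro homotopic_paths_join homotopic_paths_sym[OF seg]) (auto simp: dt)
    also have "homotopic \<dots> (trail s m G c (long_edges \<epsilon> l) e)"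
      by (rule homotopic_trail_extend[OF s G(1,2) w e])
    also have "homotopic \<dots> (?\<gamma> y)"
      using homotopic_paths_sym[OF homotopic_canonical_path[OF s G(1) w e]] by (simp add: y)
    finally show ?thesis
      using Hseg[of 0] Hseg[of 1] homotopic_paths_imp_path[OF seg] y
        point_in_topspace[OF G(1,2)] by (simp add: segment_def dt)
  qed
  have e0: "H (0, 0) = locate ?X (d 0)" "path (\<tau> 0)" "homotopic (?\<gamma> (d 0) +++ \<tau> 0) (?\<gamma> y)"
      "path (?\<gamma> (d 0))" "pathfinish (?\<gamma> (d 0)) = locate ?X (d 0)" "H (0, 1) = locate ?X y"
    using track[of 0] canonical_path_props[OF s, of "d 0"] by auto
  have e1: "H (1, 0) = locate ?X (d 1)" "path (\<tau> 1)" "homotopic (?\<gamma> (d 1) +++ \<tau> 1) (?\<gamma> y)"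
      "path (?\<gamma> (d 1))" "pathfinish (?\<gamma> (d 1)) = locate ?X (d 1)" "H (1, 1) = locate ?X y"
    using track[of 1] canonical_path_props[OF s, of "d 1"] by auto
  have ends: "pathstart (\<tau> 0) = locate ?X (d 0)" "pathfinish (\<tau> 0) = locate ?X y"
    "pathstart (\<tau> 1) = locate ?X (d 1)" "pathfinish (\<tau> 1) = locate ?X y"
    using e0 e1 by (simp_all add: \<tau>_def pathstart_def pathfinish_def)
  let ?const = "\<lambda>_::real. locate ?X y"
  have const: "path ?const" "pathstart ?const = locate ?X y" "pathfinish ?const = locate ?X y"
    by (simp_all add: path_def pathstart_def pathfinish_def)
  have sq: "homotopic (\<lambda>t. H (t, 0)) (\<tau> 0 +++ ((\<lambda>t. H (t, 1)) +++ reversepath (\<tau> 1)))"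
    using homotopic_square[OF H] by (simp add: \<tau>_def[abs_def])
  have "homotopic (locate ?X \<circ> d) (\<lambda>t. H (t, 0))"
    using track homotopic_paths_imp_path[OF sq]
    by (intro homotopic_paths_sym[OF homotopic_paths_eq]) auto
  also note sq
  also have "homotopic (\<tau> 0 +++ ((\<lambda>t. H (t, 1)) +++ reversepath (\<tau> 1))) (\<tau> 0 +++ reversepath (\<tau> 1))"
  proof (rule homotopic_paths_join)
    have "homotopic ((\<lambda>t. H (t, 1)) +++ reversepath (\<tau> 1)) (?const +++ reversepath (\<tau> 1))"
    proof (rule homotopic_paths_join)
      \<comment> \<open>The far side of the square is constant because \<open>d\<close> stays in the
        star of a single \<open>y\<close>.\<close>
      show "homotopic (\<lambda>t. H (t, 1)) ?const"
        using track const(1) by (intro homotopic_paths_sym[OF homotopic_paths_eq]) auto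
    qed (use e1 ends in \<open>auto simp: pathfinish_def\<close>)
    also have "homotopic \<dots> (reversepath (\<tau> 1))"
      by (rule homotopic_const_left) (use e1 ends in auto)
    finally show "homotopic ((\<lambda>t. H (t, 1)) +++ reversepath (\<tau> 1)) (reversepath (\<tau> 1))" .
  qed (use e0 ends in \<open>auto simp: pathstart_def joinpaths_def\<close>)
  finally have d_eq: "homotopic (locate ?X \<circ> d) (\<tau> 0 +++ reversepath (\<tau> 1))" .
  have "homotopic (?\<gamma> (d 0) +++ (locate ?X \<circ> d)) (?\<gamma> (d 0) +++ (\<tau> 0 +++ reversepath (\<tau> 1)))"
    using e0 by (intro homotopic_paths_join[OF _ d_eq]) (auto simp: pathstart_def)
  also have "homotopic \<dots> ((?\<gamma> (d 0) +++ \<tau> 0) +++ reversepath (\<tau> 1))"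
    using e0 e1 ends by (intro homotopic_paths_assoc) auto
  also have "homotopic \<dots> ((?\<gamma> (d 1) +++ \<tau> 1) +++ reversepath (\<tau> 1))"
    by (rule homotopic_paths_join[OF homotopic_paths_trans[OF e0(3) homotopic_paths_sym[OF e1(3)]]])
      (use e1 ends in auto)
  also have "homotopic \<dots> (?\<gamma> (d 1) +++ (\<tau> 1 +++ reversepath (\<tau> 1)))"
    by (rule homotopic_paths_sym, rule homotopic_paths_assoc) (use e1 ends in auto)
  also have "homotopic \<dots> (?\<gamma> (d 1) +++ (\<lambda>_. locate ?X (d 1)))"
    using homotopic_join_reversepath[OF e1(2)] e1 ends
    by (intro homotopic_paths_join) auto
  also have "homotopic \<dots> (?\<gamma> (d 1))"
    by (rule homotopic_const_right) (use e1 in auto)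
  finally show ?thesis .
qed

theorem theorem4p7:
  fixes s m :: nat
  assumes "s \<ge> 3" and "m \<ge> 1"
  shows "simply_connected_space (MCG1 s m)"
proof (rule simply_connected_spaceI[where b = "base_point s m" and \<gamma> = "canonical_path s m"])
  show "base_point s m \<in> topspace (MCG1 s m)"
    by (rule base_point_in_topspace[OF assms])
  fix x assume x: "x \<in> topspace (MCG1 s m)"
  show "path (canonical_path s m x) \<and> pathstart (canonical_path s m x) = locate (MCG1 s m) (base_point s m) \<and>
      pathfinish (canonical_path s m x) = locate (MCG1 s m) x"
    using canonical_path_props[OF assms(1) x] by simp
  obtain \<epsilon> y where "\<epsilon> > 0" "x \<in> star s m \<epsilon> y"
    using star_cover[OF x] .
  then show "\<exists>W. openin (MCG1 s m) W \<and> x \<in> W \<and>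
      (\<forall>d. continuous_map (top_of_set {0..1}) (MCG1 s m) d \<and> d ` {0..1} \<subseteq> W \<longrightarrow>
        homotopic (canonical_path s m (d 0) +++ (locate (MCG1 s m) \<circ> d)) (canonical_path s m (d 1)))"
    using openin_star[of \<epsilon> s m y] homotopic_in_star[OF assms(1), of \<epsilon> m _ y]
    by (intro exI[of _ "star s m \<epsilon> y"]) simp
qed

end
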